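(* Suppose that $F$ is a quadratically closed field. Let $V$ be an $F$-vector space of finite dimension $n\geq 1$. Then the equivalence class of a non-degenerate, indecomposable and split bilinear form $f:V\times V\to F$ is uniquely determined by the similarity type of its asymmetry $\sigma$; that is, two non-degenerate, indecomposable and split forms on $V$ with similar asymmetries are equivalent. Moreover, if a bilinear form $f:V\times V\to F$ admits any of the following $n\times n$ matrices as a Gram matrix, then $f$ is non-degenerate, indecomposable and split, and its asymmetry $\sigma$ has exactly the indicated elementary divisors: (A) $A_n=\Gamma_n$, where $n$ is odd and $\mathrm{char}(F)\neq 2$; elementary divisor $(X-1)^n$. (B) $B_n=\Gamma_n^0$, where $n$ is odd and $\mathrm{char}(F)=2$; elementary divisor $(X-1)^n$. (C) $C_n=\Gamma_n$, where $n$ is even and $\mathrm{char}(F)\neq 2$; elementary divisor $(X+1)^n$. (D) $D_n=\begin{pmatrix}0&J_m(1)\\ I_m&0\end{pmatrix}$, where $n=2m$ and $m$ is even; elementary divisors $(X-1)^m,(X-1)^m$. (E) $E_n=\begin{pmatrix}0&J_m(1)\\ I_m&0\end{pmatrix}$, where $n=2m$, $m$ is odd and $\mathrm{char}(F)=2$; elementary divisors $(X-1)^m,(X-1)^m$. (F) $F_n=\begin{pmatrix}0&J_m(-1)\\ I_m&0\end{pmatrix}$, where $n=2m$, $m$ is odd and $\mathrm{char}(F)\neq 2$; elementary divisors $(X+1)^m,(X+1)^m$. (G) $G_n(\lambda)=\begin{pmatrix}0&J_m(\lambda)\\ I_m&0\end{pmatrix}$, where $0\neq\lambda\in F$, $\lambda^2\neq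 1$ and $n=2m$; elementary divisors $(X-\lambda)^m,(X-\lambda^{-1})^m$. Furthermore, any non-degenerate, indecomposable and split form on $V$ admits one and only one of these matrices as a Gram matrix, except only for the fact that $G_n(\lambda)$ and $G_n(\lambda^{-1})$ represent equivalent forms.
   Context: A field $F$ is quadratically closed if it has no quadratic extensions, i.e. every polynomial of degree 2 over $F$ has a root in $F$. Let $f:V\times V\to F$ be a bilinear form on a finite dimensional $F$-vector space $V$. Its Gram matrix relative to a basis $v_1,\dots,v_n$ is $(f(v_i,v_j))$. The form $f$ is non-degenerate if a (equivalently, every) Gram matrix is invertible. Forms $f:V\times V\to F$ and $g:W\times W\to F$ are equivalent if there is a linear isomorphism $x:V\to W$ with $g(xu,xv)=f(u,v)$ for all $u,v\in V$. Write $V=U_1\perp U_2$ if $V=U_1\oplus U_2$ and $f(U_1,U_2)=0=f(U_2,U_1)$; $f$ is indecomposable if $V=U_1\perp U_2$ only when $U_1=0$ or $U_2=0$. If $f$ is non-degenerate, its asymmetry is the unique $\sigma\in\mathrm{GL}(V)$ with $f(v,u)=f(u,\sigma v)$ for all $u,v\in V$. A non-degenerate form is split if the minimal polynomial of its asymmetry splits into linear factors over $F$. Elementary divisors of $\sigma$ are those of $V$ as an $F[X]$-module with $X$ acting as $\sigma$. $J_m(\lambda)$ is the $m\times m$ lower triangular Jordan block with $\lambda$ on the diagonal and $1$ on the subdiagonal; $I_m$ is the identity matrix. $\Gamma_n$ is the $n\times n$ matrix whose $(i,j)$ entry is $(-1)^{n-i}$ if $i+j\in\{n+1,n+2\}$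 and $0$ otherwise; e.g. $\Gamma_1=(1)$, $\Gamma_2=\begin{pmatrix}0&-1\\1&1\end{pmatrix}$, $\Gamma_3=\begin{pmatrix}0&0&1\\0&-1&-1\\1&1&0\end{pmatrix}$. For $n$ odd, $\Gamma_n^0$ is the $n\times n$ matrix whose $(i,j)$ entry is $1$ if $i+j=n+1$, or if $i+j=n+2$ and $i>(n+1)/2$, and $0$ otherwise; e.g. $\Gamma_1^0=(1)$, $\Gamma_3^0=\begin{pmatrix}0&0&1\\0&1&0\\1&1&0\end{pmatrix}$. *)

theory Defs
  imports "Jordan_Normal_Form.Matrix" "HOL-Computational_Algebra.Computational_Algebra"
begin

definition quadratically_closed :: "'a::field itself \<Rightarrow> bool" where
  "quadratically_closed _ \<longleftrightarrow> (\<forall>p :: 'a poly. degree p = 2 \<longrightarrow> (\<exists>x. poly p x = 0))"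

definition splits :: "'a::field poly \<Rightarrow> bool" where
  "splits p \<longleftrightarrow> (\<exists>c as. c \<noteq> 0 \<and> p = smult c (\<Prod>a\<leftarrow>as. [:- a, 1:]))"

definition bilinear_form :: "('a::field \<Rightarrow> 'v::ab_group_add \<Rightarrow> 'v) \<Rightarrow> ('v \<Rightarrow> 'v \<Rightarrow> 'a) \<Rightarrow> bool" where
  "bilinear_form scale f \<longleftrightarrow>
     (\<forall>v. Vector_Spaces.linear scale (*) (\<lambda>u. f u v)) \<and>
     (\<forall>u. Vector_Spaces.linear scale (*) (\<lambda>v. f u v))"

definition equivalent_forms ::
  "('a::field \<Rightarrow> 'v::ab_group_add \<Rightarrow> 'v) \<Rightarrow> ('a \<Rightarrow> 'w::ab_group_add \<Rightarrow> 'w) \<Rightarrow>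
   ('v \<Rightarrow> 'v \<Rightarrow> 'a) \<Rightarrow> ('w \<Rightarrow> 'w \<Rightarrow> 'a) \<Rightarrow> bool" where
  "equivalent_forms scaleV scaleW f g \<longleftrightarrow>
     (\<exists>x. Vector_Spaces.linear scaleV scaleW x \<and> bij x \<and> (\<forall>u v. g (x u) (x v) = f u v))"

definition ordered_basis ::
  "('a::field \<Rightarrow> 'v::ab_group_add \<Rightarrow> 'v) \<Rightarrow> 'v list \<Rightarrow> bool" where
  "ordered_basis scale vs \<longleftrightarrow> distinct vs \<and> \<not> module.dependent scale (set vs) \<and> module.span scale (set vs) = UNIV"

definition gram_matrix ::
  "('a::field \<Rightarrow> 'v::ab_group_add \<Rightarrow> 'v) \<Rightarrow> ('v \<Rightarrow> 'v \<Rightarrow> 'a) \<Rightarrow> 'v list \<Rightarrow> 'a mat" where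
  "gram_matrix scale f vs = mat (length vs) (length vs) (\<lambda>(i, j). f (vs ! i) (vs ! j))"

definition has_gram_matrix ::
  "('a::field \<Rightarrow> 'v::ab_group_add \<Rightarrow> 'v) \<Rightarrow> ('v \<Rightarrow> 'v \<Rightarrow> 'a) \<Rightarrow> 'a mat \<Rightarrow> bool" where
  "has_gram_matrix scale f M \<longleftrightarrow> (\<exists>vs. ordered_basis scale vs \<and> gram_matrix scale f vs = M)"

definition nondegenerate ::
  "('a::field \<Rightarrow> 'v::ab_group_add \<Rightarrow> 'v) \<Rightarrow> ('v \<Rightarrow> 'v \<Rightarrow> 'a) \<Rightarrow> bool" where
  "nondegenerate scale f \<longleftrightarrow> (\<exists>M. has_gram_matrix scale f M \<and> invertible_mat M)"

definition orthogonal_sum ::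
  "('a::field \<Rightarrow> 'v::ab_group_add \<Rightarrow> 'v) \<Rightarrow> ('v \<Rightarrow> 'v \<Rightarrow> 'a) \<Rightarrow> 'v set \<Rightarrow> 'v set \<Rightarrow> bool" where
  "orthogonal_sum scale f U W \<longleftrightarrow>
     module.subspace scale U \<and> module.subspace scale W \<and> U \<inter> W = {0} \<and>
     {u + w |u w. u \<in> U \<and> w \<in> W} = UNIV \<and>
     (\<forall>u\<in>U. \<forall>w\<in>W. f u w = 0 \<and> f w u = 0)"

definition indecomposable ::
  "('a::field \<Rightarrow> 'v::ab_group_add \<Rightarrow> 'v) \<Rightarrow> ('v \<Rightarrow> 'v \<Rightarrow> 'a) \<Rightarrow> bool" where
  "indecomposable scale f \<longleftrightarrow> (\<forall>U W. orthogonal_sum scale f U W \<longrightarrow> U = {0} \<or> W = {0})"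

definition general_linear ::
  "('a::field \<Rightarrow> 'v::ab_group_add \<Rightarrow> 'v) \<Rightarrow> ('v \<Rightarrow> 'v) set" where
  "general_linear scale = {\<sigma>. Vector_Spaces.linear scale scale \<sigma> \<and> bij \<sigma>}"

definition similar_maps ::
  "('a::field \<Rightarrow> 'v::ab_group_add \<Rightarrow> 'v) \<Rightarrow> ('v \<Rightarrow> 'v) \<Rightarrow> ('v \<Rightarrow> 'v) \<Rightarrow> bool" where
  "similar_maps scale \<sigma> \<tau> \<longleftrightarrow> (\<exists>x\<in>general_linear scale. x \<circ> \<sigma> = \<tau> \<circ> x)"

text \<open>Existence and uniqueness of the asymmetry hold for non-degenerate forms on a
  finite-dimensional space; the description is meaningful only there.\<close>

definition asymmetry ::
  "('a::field \<Rightarrow> 'v::ab_group_add \<Rightarrow> 'v) \<Rightarrow> ('v \<Rightarrow> 'v \<Rightarrow> 'a) \<Rightarrow> 'v \<Rightarrow> 'v" where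
  "asymmetry scale f = (THE \<sigma>. \<sigma> \<in> general_linear scale \<and> (\<forall>u v. f v u = f u (\<sigma> v)))"

text \<open>The action of \<open>F[X]\<close> on \<open>V\<close> in which \<open>X\<close> acts as \<open>\<sigma>\<close>.\<close>

definition poly_act ::
  "('a::field \<Rightarrow> 'v::ab_group_add \<Rightarrow> 'v) \<Rightarrow> ('v \<Rightarrow> 'v) \<Rightarrow> 'a poly \<Rightarrow> 'v \<Rightarrow> 'v" where
  "poly_act scale \<sigma> p v = (\<Sum>i\<le>degree p. scale (coeff p i) ((\<sigma> ^^ i) v))"

definition minimal_polynomial ::
  "('a::field \<Rightarrow> 'v::ab_group_add \<Rightarrow> 'v) \<Rightarrow> ('v \<Rightarrow> 'v) \<Rightarrow> 'a poly" where
  "minimal_polynomial scale \<sigma> =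
     (THE p. lead_coeff p = 1 \<and> (\<forall>q. (\<forall>v. poly_act scale \<sigma> q v = 0) \<longleftrightarrow> p dvd q))"

definition split_form ::
  "('a::field \<Rightarrow> 'v::ab_group_add \<Rightarrow> 'v) \<Rightarrow> ('v \<Rightarrow> 'v \<Rightarrow> 'a) \<Rightarrow> bool" where
  "split_form scale f \<longleftrightarrow>
     nondegenerate scale f \<and> splits (minimal_polynomial scale (asymmetry scale f))"

text \<open>\<open>V\<close> is isomorphic, as an \<open>F[X]\<close>-module, to the direct sum of the cyclic modules
  \<open>F[X]/(d)\<close> with \<open>d\<close> running through the multiset \<open>D\<close> of powers of monic irreducible
  polynomials. The isomorphism is given by generators \<open>vs ! i\<close>: the induced
  homomorphism from the free module \<open>F[X]\<^sup>k\<close> to \<open>V\<close> is onto, and its kernel is the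
  direct sum of the ideals \<open>(ds ! i)\<close>.\<close>

definition has_elementary_divisors ::
  "('a::field \<Rightarrow> 'v::ab_group_add \<Rightarrow> 'v) \<Rightarrow> ('v \<Rightarrow> 'v) \<Rightarrow> 'a poly multiset \<Rightarrow> bool" where
  "has_elementary_divisors scale \<sigma> D \<longleftrightarrow>
     (\<forall>d\<in>#D. \<exists>p k. irreducible p \<and> lead_coeff p = 1 \<and> k > 0 \<and> d = p ^ k) \<and>
     (\<exists>ds vs. mset ds = D \<and> length vs = length ds \<and>
        (\<forall>v. \<exists>ps. v = (\<Sum>i<length ds. poly_act scale \<sigma> (ps i) (vs ! i))) \<and>
        (\<forall>ps. (\<Sum>i<length ds. poly_act scale \<sigma> (ps i) (vs ! i)) = 0 \<longleftrightarrow>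
              (\<forall>i<length ds. ds ! i dvd ps i)))"

text \<open>Matrices given by entries with row and column indices in \<open>{1..n}\<close>.\<close>

definition mat1 :: "nat \<Rightarrow> (nat \<Rightarrow> nat \<Rightarrow> 'a) \<Rightarrow> 'a mat" where
  "mat1 n h = mat n n (\<lambda>(i, j). h (Suc i) (Suc j))"

definition Gamma_mat :: "nat \<Rightarrow> 'a::field mat" where
  "Gamma_mat n = mat1 n (\<lambda>i j. if i + j \<in> {n + 1, n + 2} then (- 1) ^ (n - i) else 0)"

definition Gamma0_mat :: "nat \<Rightarrow> 'a::field mat" where
  "Gamma0_mat n = mat1 n (\<lambda>i j.
     if i + j = n + 1 \<or> (i + j = n + 2 \<and> i > (n + 1) div 2) then 1 else 0)"

definition lower_jordan_block :: "nat \<Rightarrow> 'a::field \<Rightarrow> 'a mat" where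
  "lower_jordan_block m a = mat1 m (\<lambda>i j. if i = j then a else if i = j + 1 then 1 else 0)"

definition jordan_form_mat :: "nat \<Rightarrow> 'a::field \<Rightarrow> 'a mat" where
  "jordan_form_mat m a =
     four_block_mat (0\<^sub>m m m) (lower_jordan_block m a) (1\<^sub>m m) (0\<^sub>m m m)"

datatype 'a canonical = Mat_A | Mat_B | Mat_C | Mat_D | Mat_E | Mat_F | Mat_G 'a

fun admissible :: "nat \<Rightarrow> 'a::field canonical \<Rightarrow> bool" where
  "admissible n Mat_A \<longleftrightarrow> odd n \<and> CHAR('a) \<noteq> 2"
| "admissible n Mat_B \<longleftrightarrow> odd n \<and> CHAR('a) = 2"
| "admissible n Mat_C \<longleftrightarrow> even n \<and> CHAR('a) \<noteq> 2"
| "admissible n Mat_D \<longleftrightarrow> (\<exists>m. n = 2 * m \<and> even m)"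
| "admissible n Mat_E \<longleftrightarrow> (\<exists>m. n = 2 * m \<and> odd m) \<and> CHAR('a) = 2"
| "admissible n Mat_F \<longleftrightarrow> (\<exists>m. n = 2 * m \<and> odd m) \<and> CHAR('a) \<noteq> 2"
| "admissible n (Mat_G a) \<longleftrightarrow> (\<exists>m. n = 2 * m) \<and> a \<noteq> 0 \<and> a\<^sup>2 \<noteq> 1"

fun canonical_matrix :: "nat \<Rightarrow> 'a::field canonical \<Rightarrow> 'a mat" where
  "canonical_matrix n Mat_A = Gamma_mat n"
| "canonical_matrix n Mat_B = Gamma0_mat n"
| "canonical_matrix n Mat_C = Gamma_mat n"
| "canonical_matrix n Mat_D = jordan_form_mat (n div 2) 1"
| "canonical_matrix n Mat_E = jordan_form_mat (n div 2) 1"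
| "canonical_matrix n Mat_F = jordan_form_mat (n div 2) (- 1)"
| "canonical_matrix n (Mat_G a) = jordan_form_mat (n div 2) a"

fun canonical_divisors :: "nat \<Rightarrow> 'a::field canonical \<Rightarrow> 'a poly multiset" where
  "canonical_divisors n Mat_A = {# [:- 1, 1:] ^ n #}"
| "canonical_divisors n Mat_B = {# [:- 1, 1:] ^ n #}"
| "canonical_divisors n Mat_C = {# [:1, 1:] ^ n #}"
| "canonical_divisors n Mat_D = {# [:- 1, 1:] ^ (n div 2), [:- 1, 1:] ^ (n div 2) #}"
| "canonical_divisors n Mat_E = {# [:- 1, 1:] ^ (n div 2), [:- 1, 1:] ^ (n div 2) #}"
| "canonical_divisors n Mat_F = {# [:1, 1:] ^ (n div 2), [:1, 1:] ^ (n div 2) #}"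
| "canonical_divisors n (Mat_G a) = {# [:- a, 1:] ^ (n div 2), [:- inverse a, 1:] ^ (n div 2) #}"

end

(* Write tau for the inverse of the asymmetry sigma. The adjoint of p(sigma) is p(tau), so the
   generalised eigenspaces of sigma for a and b are orthogonal unless a b = 1; an indecomposable
   split form therefore lives on the eigenvalues a, 1/a for a single a.

   If a^2 <> 1, both eigenspaces are totally isotropic and paired by f. A top vector u of the first
   and a suitable vector v of the second generate a non-degenerate sigma-stable subspace, which has
   to be everything, and dual bases of the two halves give G_n(a).

   If a = e = 1 or -1, put N = sigma - e with N^(k+1) = 0 and h(x,y) = f(x, N^k y), a symmetric or
   skew form. If h is alternating, vectors u, v with h(u,v) <> 0 are modified, one power of N at a time,
   until each generates a totally isotropic cyclic submodule, and one concludes as before. If h(u,u) <> 0,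
   then u generates V, and f is determined by the functional p |-> f(u, p(sigma) u). The same
   modification matches this functional with the one belonging to Gamma_n or Gamma_n^0. Quadratic
   closure is used to normalise h(u,u) and, in characteristic 2, in the modification step.

   Conversely, each canonical matrix shows how sigma acts on its basis, and the canonical type is
   recovered from the annihilator of sigma. *)

theory Submission
  imports Defs "Jordan_Normal_Form.Determinant"
begin

section \<open>Linear algebra of a single operator\<close>

text \<open>The delicate point is which coefficients can be corrected. Exchanging the arguments of f
  turns p(X) into p(1/X) X, so the difference of two functionals p |-> f(u, p(\<sigma>) u) is
  invariant under this involution. At the first order r where such a difference is nonzero,
  invariance forces (-1)^r e = 1 and, in characteristic 2, r even. Under that parity the two cross
  terms of the modification agree at e instead of cancelling. They add up to a factor 2, and in
  characteristic 2 the derivative at e takes over its role; this is why derivatives and 1-jets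
  appear.

  Comparing two forms requires inversion to be the same polynomial operation for both. Therefore
  \<sigma>^-1 is written as t(\<sigma>) with a polynomial t that is a parameter throughout, and in
  the unipotent case t is built from e and k alone.

  No basis is computed for \<open>Gamma_mat\<close> or \<open>Gamma0_mat\<close>: a model form with
  that Gram matrix is put on the same space and shown to be equivalent to f.\<close>

lemma vector_space_mult: "vector_space ((*) :: 'a::field \<Rightarrow> 'a \<Rightarrow> 'a)"
  by unfold_locales (auto simp: algebra_simps)

context finite_dimensional_vector_space
begin

lemma linear_stable_eqI:
  assumes T: "Vector_Spaces.linear scale scale T" and S: "subspace S"
    and sub: "T ` S \<subseteq> S" and inj: "\<And>x. x \<in> S \<Longrightarrow> T x = 0 \<Longrightarrow> x = 0"
  shows "T ` S = S"
proof -
  interpret p: finite_dimensional_vector_space_pair scale Basis scale Basis by unfold_locales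
  interpret T: Vector_Spaces.linear scale scale T by fact
  have "inj_on T S"
    by (metis T.inj_on_iff_eq_0 S inj)
  then have "dim (T ` S) = dim S"
    using p.dim_image_eq[OF T] S by (metis span_eq_iff)
  moreover have "subspace (T ` S)"
    using S by (rule T.subspace_image)
  ultimately show ?thesis
    using subspace_dim_equal[OF _ S sub] by simp
qed

lemma linear_surj_on_inj:
  assumes T: "Vector_Spaces.linear scale scale T" and S: "subspace S"
    and eq: "T ` S = S" and x: "x \<in> S" "T x = 0"
  shows "x = 0"
proof -
  obtain B where B: "B \<subseteq> S" "independent B" "S \<subseteq> span B" "card B = dim S"
    using basis_exists by blast
  interpret T: Vector_Spaces.linear scale scale T by fact
  have fin: "finite B" using B(2) by (rule finiteI_independent)
  have spanB: "span B = S" using B S by (metis span_eq_iff span_mono subset_antisym)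
  have "span (T ` B) = S" using spanB eq by (metis T.span_image)
  moreover have "T ` B \<subseteq> S" using B eq by blast
  moreover have "card (T ` B) \<le> dim S" using card_image_le[OF fin] B(4) by metis
  ultimately have ind: "independent (T ` B)"
    using card_le_dim_spanning[of "T ` B" S] fin by (metis finite_imageI order_refl)
  have "card (T ` B) = card B"
    using B(4) ind fin \<open>span (T ` B) = S\<close> by (metis dim_span_eq_card_independent)
  then have "inj_on T B" using fin by (simp add: eq_card_imp_inj_on)
  then have "inj_on T (span B)"
    using T.inj_on_span_independent_image ind by blast
  then show ?thesis using x spanB by (metis T.inj_on_iff_eq_0 S)
qed

text \<open>Coefficients are indexed by positions, so distinctness comes out of the independence
  hypothesis: two equal entries would satisfy a relation with coefficients 1 and -1.\<close>

lemma ordered_basisI: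
  assumes span: "\<And>x. \<exists>c. x = (\<Sum>i<length vs. c i *s vs ! i)"
    and ind: "\<And>c. (\<Sum>i<length vs. c i *s vs ! i) = 0 \<Longrightarrow> \<forall>i<length vs. c i = 0"
  shows "ordered_basis scale vs"
proof -
  have dist: "distinct vs"
  proof (rule ccontr)
    assume "\<not> distinct vs"
    then obtain i j where ij: "i < length vs" "j < length vs" "i \<noteq> j" "vs ! i = vs ! j"
      by (auto simp: distinct_conv_nth)
    let ?c = "\<lambda>k. (if k = i then 1 else 0) + (if k = j then -1 else 0) :: 'a"
    have "(\<Sum>k<length vs. ?c k *s vs ! k) =
      (\<Sum>k<length vs. if k = i then vs ! k else 0) - (\<Sum>k<length vs. if k = j then vs ! k else 0)"
      unfolding sum_subtractf[symmetric] using ij by (intro sum.cong) (auto simp: scale_left_distrib)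
    also have "\<dots> = 0" using ij by simp
    finally show False using ind ij by fastforce
  qed
  have sum_set: "(\<Sum>v\<in>set vs. g v) = (\<Sum>i<length vs. g (vs ! i))" for g :: "'b \<Rightarrow> 'b"
    using dist by (simp add: sum_list_distinct_conv_sum_set[symmetric] sum_list_sum_nth atLeast0LessThan)
  have "independent (set vs)"
    unfolding independent_explicit
    using ind[of "\<lambda>i. c (vs ! i)" for c] by (auto simp: sum_set in_set_conv_nth)
  moreover have "x \<in> span (set vs)" for x
  proof -
    obtain c where x: "x = (\<Sum>i<length vs. c i *s vs ! i)" using span by blast
    show ?thesis unfolding x by (intro span_sum span_scale span_base) simp
  qed
  ultimately show ?thesis using dist by (auto simp: ordered_basis_def)
qed

lemma ordered_basis_coords:
  assumes "ordered_basis scale vs"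
  obtains c where "x = (\<Sum>i<length vs. c i *s vs ! i)"
proof -
  have dist: "distinct vs" and "x \<in> span (set vs)" using assms by (auto simp: ordered_basis_def)
  then obtain u where "x = (\<Sum>v\<in>set vs. u v *s v)"
    using span_finite[of "set vs"] by auto
  also have "\<dots> = (\<Sum>i<length vs. u (vs ! i) *s vs ! i)"
    using dist by (simp add: sum_list_distinct_conv_sum_set[symmetric] sum_list_sum_nth atLeast0LessThan)
  finally show ?thesis using that[of "\<lambda>i. u (vs ! i)"] by blast
qed

lemma ordered_basis_independent:
  assumes "ordered_basis scale vs" "(\<Sum>i<length vs. c i *s vs ! i) = 0" "i < length vs"
  shows "c i = 0"
proof -
  have dist: "distinct vs" and ind: "independent (set vs)" using assms by (auto simp: ordered_basis_def)
  define u where "u v = c (the_inv_into {..<length vs} ((!) vs) v)" for v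
  have inj: "inj_on ((!) vs) {..<length vs}" using dist by (auto simp: inj_on_def nth_eq_iff_index_eq)
  have u: "u (vs ! i) = c i" if "i < length vs" for i
    unfolding u_def using the_inv_into_f_f[OF inj] that by simp
  have "(\<Sum>v\<in>set vs. u v *s v) = (\<Sum>i<length vs. u (vs ! i) *s vs ! i)"
    using dist by (simp add: sum_list_distinct_conv_sum_set[symmetric] sum_list_sum_nth atLeast0LessThan)
  also have "\<dots> = 0" using assms(2) u by simp
  finally show ?thesis using ind u assms(3) unfolding independent_explicit by (metis nth_mem)
qed

lemma ordered_basis_length:
  assumes "ordered_basis scale vs"
  shows "length vs = dim (UNIV :: 'b set)"
  using assms dim_span_eq_card_independent[of "set vs"]
  by (auto simp: ordered_basis_def distinct_card)

lemma obtain_ordered_basis: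
  obtains vs where "ordered_basis scale vs" "length vs = dim (UNIV :: 'b set)"
proof -
  obtain vs where "set vs = Basis" "distinct vs" using finite_Basis finite_distinct_list by blast
  then have "ordered_basis scale vs"
    using independent_Basis span_Basis by (auto simp: ordered_basis_def)
  then show ?thesis using that ordered_basis_length by blast
qed

end

section \<open>The F[X]-module structure given by an endomorphism\<close>

locale fd_endo = finite_dimensional_vector_space scale Basis
  for scale :: "'a::field \<Rightarrow> 'v::ab_group_add \<Rightarrow> 'v" (infixr "*s" 75) and Basis +
  fixes \<sigma> :: "'v \<Rightarrow> 'v"
  assumes linear_sigma: "Vector_Spaces.linear scale scale \<sigma>"
begin

abbreviation P :: "'a poly \<Rightarrow> 'v \<Rightarrow> 'v" where "P \<equiv> poly_act scale \<sigma>"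

sublocale sigma: Vector_Spaces.linear scale scale \<sigma> by (rule linear_sigma)

lemma P_eq_sum: "degree p \<le> n \<Longrightarrow> P p v = (\<Sum>i\<le>n. coeff p i *s (\<sigma> ^^ i) v)"
  unfolding poly_act_def
  by (rule sum.mono_neutral_left) (auto simp: coeff_eq_0)

lemma P_add: "P (p + q) v = P p v + P q v"
proof -
  define n where "n = max (degree p) (degree q)"
  have "degree (p + q) \<le> n" "degree p \<le> n" "degree q \<le> n"
    unfolding n_def by (auto intro: degree_add_le_max)
  then show ?thesis by (simp add: P_eq_sum scale_left_distrib sum.distrib)
qed

lemma P_0 [simp]: "P 0 v = 0" by (simp add: poly_act_def)

lemma P_smult: "P (smult c p) v = c *s P p v"
  using degree_smult_le[of c p] by (simp add: P_eq_sum[of _ "degree p"] scale_sum_right)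

lemma P_minus: "P (- p) v = - P p v" using P_smult[of "-1" p] by simp

lemma P_diff: "P (p - q) v = P p v - P q v"
  using P_add[of p "- q"] by (simp add: P_minus)

lemma P_const [simp]: "P [:c:] v = c *s v" by (simp add: poly_act_def)

lemma P_one [simp]: "P 1 v = v" by (simp add: poly_act_def)

lemma P_pCons: "P (pCons a p) v = a *s v + \<sigma> (P p v)"
proof -
  have "P (pCons a p) v = (\<Sum>i\<le>Suc (degree p). coeff (pCons a p) i *s (\<sigma> ^^ i) v)"
    by (rule P_eq_sum) (rule degree_pCons_le)
  also have "\<dots> = a *s v + (\<Sum>i\<le>degree p. coeff p i *s (\<sigma> ^^ Suc i) v)"
    by (subst sum.atMost_Suc_shift) simp
  finally show ?thesis by (simp add: poly_act_def sigma.sum sigma.scale)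
qed

lemma P_X: "P [:0, 1:] v = \<sigma> v" by (simp add: P_pCons)
lemma P_linear_factor: "P [:-a, 1:] v = \<sigma> v - a *s v" by (simp add: P_pCons)

lemma P_vadd: "P p (v + w) = P p v + P p w"
  by (induction p) (simp_all add: P_pCons sigma.add scale_right_distrib algebra_simps)

lemma P_vscale: "P p (c *s v) = c *s P p v"
  by (induction p) (simp_all add: P_pCons sigma.scale scale_right_distrib mult.commute)

lemma P_linear: "Vector_Spaces.linear scale scale (P p)"
  by (auto simp: Vector_Spaces.linear_iff vector_space_axioms P_vadd P_vscale)

sublocale P: Vector_Spaces.linear scale scale "P p" for p by (rule P_linear)

lemma P_mult: "P (p * q) v = P p (P q v)"
  by (induction p) (simp_all add: P_pCons P_add P_smult)

lemma P_commute: "P p (P q v) = P q (P p v)" by (metis P_mult mult.commute)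

lemma P_sigma: "P p (\<sigma> v) = \<sigma> (P p v)" by (metis P_X P_commute)

lemma P_dvd: "p dvd q \<Longrightarrow> P p v = 0 \<Longrightarrow> P q v = 0"
  by (metis P_commute P_mult P.zero dvdE)

lemma P_eigen: "\<sigma> v = a *s v \<Longrightarrow> P p v = poly p a *s v"
  by (induction p) (simp_all add: P_pCons sigma.scale sigma.add scale_left_distrib mult.commute)

definition cyc :: "'v \<Rightarrow> 'v set" where "cyc u = range (\<lambda>p. P p u)"

lemma cycI [simp]: "P p u \<in> cyc u" by (simp add: cyc_def)
lemma cyc_self [simp]: "u \<in> cyc u" using cycI[of 1 u] by simp
lemma cycE: "x \<in> cyc u \<Longrightarrow> (\<And>p. x = P p u \<Longrightarrow> thesis) \<Longrightarrow> thesis" by (auto simp: cyc_def)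

lemma cyc_P: "x \<in> cyc u \<Longrightarrow> P p x \<in> cyc u"
  by (auto elim!: cycE simp flip: P_mult)

lemma cyc_sigma: "x \<in> cyc u \<Longrightarrow> \<sigma> x \<in> cyc u" using cyc_P[of x u "[:0,1:]"] by (simp add: P_X)

lemma subspace_cyc: "subspace (cyc u)"
  unfolding subspace_def cyc_def
  by (auto simp flip: P_add P_smult) (metis P_0 rangeI)

lemma subspace_P:
  assumes "subspace S" "\<And>x. x \<in> S \<Longrightarrow> \<sigma> x \<in> S" "x \<in> S"
  shows "P p x \<in> S"
  using assms by (induction p) (auto simp: P_pCons subspace_0 subspace_add subspace_scale)

section \<open>Jordan chains\<close>

text \<open>Top of a Jordan chain of length \<open>k + 1\<close>; indexing by \<open>k\<close> avoids truncated subtraction.\<close>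

definition chain :: "'a \<Rightarrow> nat \<Rightarrow> 'v \<Rightarrow> bool" where
  "chain a k u \<longleftrightarrow> P ([:-a, 1:] ^ Suc k) u = 0 \<and> P ([:-a, 1:] ^ k) u \<noteq> 0"

lemma chain_bottom_eigen: "P ([:-a, 1:] ^ Suc k) u = 0 \<Longrightarrow> \<sigma> (P ([:-a, 1:] ^ k) u) = a *s P ([:-a, 1:] ^ k) u"
  by (simp only: power_Suc P_mult P_linear_factor) simp

text \<open>The bottom of the chain is an eigenvector (or 0), so a polynomial acts on it through its
  value at \<open>a\<close>. All later leading-coefficient computations rest on this.\<close>

lemma P_chain_top:
  "P ([:-a, 1:] ^ Suc k) u = 0 \<Longrightarrow> P ([:-a, 1:] ^ k * q) u = poly q a *s P ([:-a, 1:] ^ k) u"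
  using P_eigen[OF chain_bottom_eigen] by (metis P_mult mult.commute)

lemma chain_order_split:
  fixes p :: "'a poly"
  assumes "\<not> [:-a, 1:] ^ Suc k dvd p"
  obtains j q where "p = [:-a, 1:] ^ j * q" "j \<le> k" "poly q a \<noteq> 0"
proof -
  have "p \<noteq> 0" using assms by auto
  from order_decomp[OF this, of a] obtain q where
    q: "p = [:-a, 1:] ^ order a p * q" "\<not> [:-a, 1:] dvd q" by blast
  moreover have "order a p \<le> k"
    using assms by (metis dvd_trans le_imp_power_dvd not_less_eq_eq order_1)
  ultimately show ?thesis using that by (auto simp: poly_eq_0_iff_dvd)
qed

text \<open>The module of a single Jordan block has a one-dimensional socle: if p = (X - a)^i q with
  q(a) \<noteq> 0, then k - i further factors X - a carry P p u to a nonzero multiple of the bottom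
  vector.\<close>

lemma chain_reach:
  assumes "chain a k u" "P p u \<noteq> 0"
  obtains j c where "j \<le> k" "c \<noteq> 0" "P ([:-a, 1:] ^ j) (P p u) = c *s P ([:-a, 1:] ^ k) u"
proof -
  have "\<not> [:-a, 1:] ^ Suc k dvd p" using assms P_dvd unfolding chain_def by blast
  then obtain j q where q: "p = [:-a, 1:] ^ j * q" "j \<le> k" "poly q a \<noteq> 0" by (rule chain_order_split)
  have "P ([:-a, 1:] ^ (k - j)) (P p u) = P ([:-a, 1:] ^ k * q) u"
    unfolding P_mult[symmetric] q(1) mult.assoc[symmetric] power_add[symmetric] using q(2) by simp
  also have "\<dots> = poly q a *s P ([:-a, 1:] ^ k) u"
    using assms(1) P_chain_top unfolding chain_def by blast
  finally show ?thesis using that[of "k - j"] q(3) by simp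
qed

lemma chain_ann_iff:
  assumes "chain a k u"
  shows "P p u = 0 \<longleftrightarrow> [:-a, 1:] ^ Suc k dvd p"
proof
  assume 0: "P p u = 0"
  show "[:-a, 1:] ^ Suc k dvd p"
  proof (rule ccontr)
    assume "\<not> ?thesis"
    then obtain j q where q: "p = [:-a, 1:] ^ j * q" "j \<le> k" "poly q a \<noteq> 0" by (rule chain_order_split)
    have "P ([:-a, 1:] ^ (k - j)) (P p u) = P ([:-a, 1:] ^ k * q) u"
      unfolding P_mult[symmetric] q(1) mult.assoc[symmetric] power_add[symmetric] using q(2) by simp
    also have "\<dots> = poly q a *s P ([:-a, 1:] ^ k) u"
      using assms P_chain_top unfolding chain_def by blast
    finally show False using 0 q(3) assms by (simp add: chain_def)
  qed
qed (use assms P_dvd in \<open>auto simp: chain_def\<close>)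

lemma chain_kernel:
  assumes "chain a k u" "x \<in> cyc u" "\<sigma> x = a *s x"
  obtains c where "x = c *s P ([:-a, 1:] ^ k) u"
proof -
  obtain p where p: "x = P p u" using assms(2) by (rule cycE)
  have "P ([:-a, 1:] * p) u = 0" using assms(3) by (simp only: P_mult p P_linear_factor) simp
  then have "[:-a, 1:] * [:-a, 1:] ^ k dvd [:-a, 1:] * p" using chain_ann_iff[OF assms(1)] by simp
  then have "[:-a, 1:] ^ k dvd p" by (subst (asm) dvd_mult_cancel_left) simp
  then obtain q where "p = [:-a, 1:] ^ k * q" by (rule dvdE)
  then show ?thesis using that P_chain_top assms(1) p unfolding chain_def by blast
qed

text \<open>Apply the linear factors one after the other: the last nonzero vector before the product
  reaches 0 is an eigenvector.\<close>

lemma prod_kernel_eigenvector: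
  assumes "P (\<Prod>a\<leftarrow>as. [:-a, 1:]) v = 0" "v \<noteq> 0"
  obtains a p where "a \<in> set as" "P p v \<noteq> 0" "\<sigma> (P p v) = a *s P p v"
  using assms
proof (induction as arbitrary: v thesis)
  case (Cons a as)
  show ?case
  proof (cases "P (\<Prod>a\<leftarrow>as. [:-a, 1:]) v = 0")
    case True
    then show ?thesis using Cons.IH[of v] Cons.prems by auto
  next
    case False
    then show ?thesis
      using Cons.prems(1)[of a "\<Prod>a\<leftarrow>as. [:-a, 1:]"] Cons.prems(2)
      by (simp add: P_mult P_linear_factor del: mult_pCons_left)
  qed
qed simp

lemma chain_basis_independent:
  assumes "chain a k u" "(\<Sum>i<Suc k. c i *s P ([:-a, 1:] ^ i) u) = 0" "i < Suc k"
  shows "c i = 0"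
  using assms(3)
proof (induction i rule: less_induct)
  case (less i)
  let ?N = "\<lambda>j. P ([:-a, 1:] ^ j)"
  have 0: "?N j u = 0" if "j > k" for j
    using assms(1) that P_dvd[OF le_imp_power_dvd[of "Suc k" j]] unfolding chain_def by auto
  \<comment> \<open>Applying N^(k-i), with N = \<sigma> - a, kills the terms with j > i; those with
    j < i have zero coefficient by induction. Only c i times the bottom vector survives.\<close>
  have "?N (k - i) (\<Sum>j<Suc k. c j *s ?N j u) = (\<Sum>j<Suc k. c j *s ?N (k - i + j) u)"
    by (simp only: P.sum P.scale P_mult[symmetric] power_add)
  also have "\<dots> = (\<Sum>j<Suc k. if j = i then c i *s ?N k u else 0)"
  proof (rule sum.cong[OF refl])
    fix j assume "j \<in> {..<Suc k}"
    consider "j < i" | "j = i" | "j > i" by linarith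
    then show "c j *s ?N (k - i + j) u = (if j = i then c i *s ?N k u else 0)"
      using less 0[of "k - i + j"] by cases auto
  qed
  also have "\<dots> = c i *s ?N k u" using less.prems by (subst sum.delta) auto
  finally show ?case using assms(1,2) by (simp add: chain_def)
qed

text \<open>Taylor expansion of p at \<open>a\<close>, one coefficient at a time: synthetic division
  gives p = q (X - a) + p(a), and q acts on (\<sigma> - a) u, which is killed by one power
  fewer.\<close>

lemma cyc_sum:
  assumes "P ([:-a, 1:] ^ Suc k) u = 0" "x \<in> cyc u"
  obtains c where "x = (\<Sum>i<Suc k. c i *s P ([:-a, 1:] ^ i) u)"
proof -
  have *: "\<exists>c. P p u = (\<Sum>i<Suc k. c i *s P ([:-a, 1:] ^ i) u)" if "P ([:-a, 1:] ^ Suc k) u = 0" for p u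
    using that
  proof (induction k arbitrary: u p)
    case 0
    then show ?case using P_chain_top[of a 0 u p] by auto
  next
    case (Suc k)
    define q where "q = synthetic_div p a"
    have p: "p = q * [:-a, 1:] + [:poly p a:]"
      using synthetic_div_correct'[of a p] by (simp only: q_def mult.commute)
    have "P ([:-a, 1:] ^ Suc k) (P [:-a, 1:] u) = 0"
      using Suc.prems by (simp only: P_mult[symmetric] power_Suc2[symmetric])
    from Suc.IH[OF this, of q] obtain c where
      c: "P q (P [:-a, 1:] u) = (\<Sum>i<Suc k. c i *s P ([:-a, 1:] ^ Suc i) u)"
      by (auto simp only: P_mult[symmetric] power_Suc2[symmetric])
    have "P p u = P q (P [:-a, 1:] u) + poly p a *s u"
      by (subst p) (simp only: P_add P_mult P_const)
    then show ?case
      unfolding c by (intro exI[of _ "case_nat (poly p a) c"])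
        (subst sum.lessThan_Suc_shift, simp add: add.commute del: power_Suc)
  qed
  show ?thesis using *[OF assms(1)] assms(2) that by (metis cycE)
qed

lemma chain_ordered_basis:
  assumes "chain a k u" "cyc u = UNIV"
  shows "ordered_basis scale (map (\<lambda>i. P ([:-a, 1:] ^ i) u) [0..<Suc k])"
proof (rule ordered_basisI)
  have len: "length (map (\<lambda>i. P ([:-a, 1:] ^ i) u) [0..<Suc k]) = Suc k" by simp
  have nth: "c i *s map (\<lambda>i. P ([:-a, 1:] ^ i) u) [0..<Suc k] ! i = c i *s P ([:-a, 1:] ^ i) u"
    if "i < Suc k" for i c using that by (simp del: upt_Suc)
  have S: "(\<Sum>i<Suc k. c i *s map (\<lambda>i. P ([:-a, 1:] ^ i) u) [0..<Suc k] ! i)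
     = (\<Sum>i<Suc k. c i *s P ([:-a, 1:] ^ i) u)" for c
    using nth by (intro sum.cong) auto
  show "\<exists>c. x = (\<Sum>i<length (map (\<lambda>i. P ([:-a, 1:] ^ i) u) [0..<Suc k]).
    c i *s map (\<lambda>i. P ([:-a, 1:] ^ i) u) [0..<Suc k] ! i)" for x
    unfolding len S using cyc_sum[of a k u x] assms by (auto simp: chain_def)
  show "\<forall>i<length (map (\<lambda>i. P ([:-a, 1:] ^ i) u) [0..<Suc k]). c i = 0"
    if "(\<Sum>i<length (map (\<lambda>i. P ([:-a, 1:] ^ i) u) [0..<Suc k]).
    c i *s map (\<lambda>i. P ([:-a, 1:] ^ i) u) [0..<Suc k] ! i) = 0" for c
    using chain_basis_independent[OF assms(1)] that unfolding len S by blast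
qed

lemma chain_dim: "chain a k u \<Longrightarrow> cyc u = UNIV \<Longrightarrow> dim (UNIV :: 'v set) = Suc k"
  using ordered_basis_length[OF chain_ordered_basis] by simp

lemma chain_full_cyc:
  assumes "chain a k u" "dim (UNIV :: 'v set) = Suc k"
  shows "cyc u = UNIV"
proof -
  let ?e = "\<lambda>i. P ([:-a, 1:] ^ i) u"
  have inj: "inj_on ?e {..<Suc k}"
  proof (rule inj_onI, rule ccontr)
    fix i j assume ij: "i \<in> {..<Suc k}" "j \<in> {..<Suc k}" "?e i = ?e j" "i \<noteq> j"
    define c :: "nat \<Rightarrow> 'a" where "c l = (if l = i then 1 else 0) + (if l = j then -1 else 0)" for l
    have "(\<Sum>l<Suc k. c l *s ?e l) =
      (\<Sum>l<Suc k. if l = i then ?e l else 0) - (\<Sum>l<Suc k. if l = j then ?e l else 0)"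
      unfolding sum_subtractf[symmetric] using ij
      by (intro sum.cong) (auto simp: scale_left_distrib c_def)
    also have "\<dots> = 0" using ij by simp
    finally have eq: "(\<Sum>l<Suc k. c l *s ?e l) = 0" .
    have "c i = 0" using chain_basis_independent[OF assms(1) eq] ij(1) by simp
    with ij show False by (simp add: c_def)
  qed
  have "independent (?e ` {..<Suc k})"
    unfolding independent_explicit
  proof (intro conjI allI impI ballI)
    fix c v assume "(\<Sum>v\<in>?e ` {..<Suc k}. c v *s v) = 0" and v: "v \<in> ?e ` {..<Suc k}"
    then have "(\<Sum>i<Suc k. c (?e i) *s ?e i) = 0" by (simp only: sum.reindex[OF inj] o_def)
    then have "c (?e i) = 0" if "i < Suc k" for i
      using chain_basis_independent[OF assms(1) _ that, of "\<lambda>i. c (?e i)"] by blast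
    with v show "c v = 0" by blast
  qed simp
  moreover have "card (?e ` {..<Suc k}) = Suc k" using inj by (simp add: card_image)
  ultimately have "UNIV \<subseteq> span (?e ` {..<Suc k})"
    using card_ge_dim_independent[of "?e ` {..<Suc k}" UNIV] assms(2) by simp
  moreover have "span (?e ` {..<Suc k}) \<subseteq> cyc u"
    by (rule span_minimal) (auto simp: subspace_cyc)
  ultimately show ?thesis by blast
qed

end

section \<open>Bilinear forms, Gram matrices and asymmetries\<close>

lemma invertible_mat_iff_det:
  fixes M :: "'a::field mat"
  assumes M: "M \<in> carrier_mat n n"
  shows "invertible_mat M \<longleftrightarrow> det M \<noteq> 0"
proof
  assume "invertible_mat M"
  then obtain B where B: "M * B = 1\<^sub>m n" "B * M = 1\<^sub>m (dim_row B)"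
    using M unfolding invertible_mat_def inverts_mat_def by auto
  have "dim_col B = n" using B(1) M by (metis index_mult_mat(3) index_one_mat(3))
  moreover have "dim_row B = n" using B(2) M by (metis carrier_matD(2) index_mult_mat(3) index_one_mat(3))
  ultimately have "B \<in> carrier_mat n n" by auto
  then have "det M * det B = 1" using det_mult[OF M] B(1) by (metis det_one)
  then show "det M \<noteq> 0" by auto
next
  assume "det M \<noteq> 0"
  from det_non_zero_imp_unit[OF M this, of "()"] M show "invertible_mat M"
    by (auto simp: Units_def ring_mat_def invertible_mat_def inverts_mat_def square_mat.simps)
qed

locale fd_bilinear = finite_dimensional_vector_space scale Basis
  for scale :: "'a::field \<Rightarrow> 'v::ab_group_add \<Rightarrow> 'v" (infixr "*s" 75) and Basis +
  fixes f :: "'v \<Rightarrow> 'v \<Rightarrow> 'a"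
  assumes bilinear: "bilinear_form scale f"
begin

lemma f_ladd: "f (x + y) z = f x z + f y z" and f_lscale: "f (c *s x) z = c * f x z"
  and f_radd: "f x (y + z) = f x y + f x z" and f_rscale: "f x (c *s y) = c * f x y"
  using bilinear unfolding bilinear_form_def Vector_Spaces.linear_iff by auto

lemma f_lzero [simp]: "f 0 z = 0" using f_lscale[of 0 0] by simp
lemma f_rzero [simp]: "f z 0 = 0" using f_rscale[of z 0 0] by simp
lemma f_lminus: "f (- x) z = - f x z" using f_lscale[of "-1" x] by simp
lemma f_rminus: "f z (- x) = - f z x" using f_rscale[of z "-1" x] by simp
lemma f_ldiff: "f (x - y) z = f x z - f y z" using f_ladd[of x "- y"] by (simp add: f_lminus)
lemma f_rdiff: "f z (x - y) = f z x - f z y" using f_radd[of z x "- y"] by (simp add: f_rminus)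
lemma f_lsum: "f (\<Sum>i\<in>A. g i) z = (\<Sum>i\<in>A. f (g i) z)"
  by (induction A rule: infinite_finite_induct) (simp_all add: f_ladd)
lemma f_rsum: "f z (\<Sum>i\<in>A. g i) = (\<Sum>i\<in>A. f z (g i))"
  by (induction A rule: infinite_finite_induct) (simp_all add: f_radd)

lemmas f_lin = f_ladd f_lscale f_radd f_rscale f_lminus f_rminus f_ldiff f_rdiff

lemma f_zero_span:
  assumes "\<And>b. b \<in> B \<Longrightarrow> f b x = 0" "y \<in> span B"
  shows "f y x = 0"
  using assms(2) by (induction rule: span_induct_alt) (auto simp: f_ladd f_lscale assms(1))

text \<open>Basis-free counterpart of \<open>nondegenerate\<close>, see
  \<open>nondegenerate_iff\<close>. It speaks of the right radical; the left radical is dealt with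
  in \<open>left_nondeg\<close>.\<close>

definition nondeg :: bool where "nondeg \<longleftrightarrow> (\<forall>x. (\<forall>y. f y x = 0) \<longrightarrow> x = 0)"

lemma nondegD: "nondeg \<Longrightarrow> (\<And>y. f y x = 0) \<Longrightarrow> x = 0" by (auto simp: nondeg_def)

text \<open>Recording the values f b x on a basis is an injective endomorphism by non-degeneracy,
  hence surjective; a preimage of the vector of values of \<phi> represents \<phi>.\<close>

lemma riesz:
  assumes nondeg and add: "\<And>x y. \<phi> (x + y) = \<phi> x + \<phi> y" and scale: "\<And>c x. \<phi> (c *s x) = c * \<phi> x"
  obtains x where "\<And>y. \<phi> y = f y x"
proof -
  let ?T = "\<lambda>x. \<Sum>b\<in>Basis. f b x *s b"
  have lin: "Vector_Spaces.linear scale scale ?T"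
    by (auto simp: Vector_Spaces.linear_iff vector_space_axioms f_radd f_rscale scale_left_distrib
        sum.distrib scale_sum_right)
  interpret T: Vector_Spaces.linear scale scale ?T by (rule lin)
  have indep: "c b = d b" if "(\<Sum>b\<in>Basis. c b *s b) = (\<Sum>b\<in>Basis. d b *s b)" "b \<in> Basis" for c d b
  proof -
    have "(\<Sum>b\<in>Basis. (c b - d b) *s b) = 0"
      using that(1) by (simp add: scale_left_diff_distrib sum_subtractf)
    then show ?thesis using independent_Basis that(2) unfolding independent_explicit by force
  qed
  have "inj ?T"
    unfolding T.inj_iff_eq_0
  proof (intro allI impI)
    fix x assume "?T x = 0"
    then have "f b x = 0" if "b \<in> Basis" for b using indep[of "\<lambda>b. f b x" "\<lambda>_. 0"] that by simp
    then have "f y x = 0" for y using f_zero_span[of Basis] span_Basis by auto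
    then show "x = 0" using \<open>nondeg\<close> by (auto intro: nondegD)
  qed
  then have "surj ?T" by (rule linear_inj_imp_surj[OF lin])
  then obtain x where x: "?T x = (\<Sum>b\<in>Basis. \<phi> b *s b)"
    using surjD[of ?T "\<Sum>b\<in>Basis. \<phi> b *s b"] by (metis (no_types, lifting))
  have zero: "\<phi> 0 = 0" using scale[of 0 0] by simp
  have "\<phi> y = f y x" if "y \<in> span Basis" for y
    using that
  proof (induction rule: span_induct_alt)
    case (step c b y)
    have "f b x = \<phi> b" using indep[OF x step.hyps] .
    then show ?case using step.IH by (simp only: add scale f_ladd f_lscale)
  qed (simp add: zero)
  then show ?thesis using that span_Basis by auto
qed

text \<open>Every coordinate functional has the form y |-> f y z by \<open>riesz\<close>, so a
  vector of the left radical has only zero coordinates.\<close>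

lemma left_nondeg:
  assumes nondeg "\<And>y. f x y = 0"
  shows "x = 0"
proof -
  have "representation Basis x b = 0" for b
  proof -
    obtain z where "\<And>y. representation Basis y b = f y z"
      using riesz[OF assms(1), of "\<lambda>y. representation Basis y b"]
      by (metis independent_Basis iso_tuple_UNIV_I representation_add representation_scale span_Basis)
    then show ?thesis using assms(2) by simp
  qed
  then show ?thesis
    using sum_representation_eq[OF independent_Basis _ finite_Basis order_refl, of x] span_Basis by simp
qed

lemma asymmetry_exists:
  assumes nondeg
  obtains \<sigma> where "\<sigma> \<in> general_linear scale" "\<And>u v. f v u = f u (\<sigma> v)"
proof -
  have "\<exists>w. \<forall>u. f v u = f u w" for v
    using riesz[OF assms, of "f v"] by (metis f_radd f_rscale)
  then obtain \<sigma> where \<sigma>: "\<And>v u. f v u = f u (\<sigma> v)" by metis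
  have eqI: "x = y" if "\<And>u. f u x = f u y" for x y
    using nondegD[OF assms, of "x - y"] that by (simp add: f_rdiff)
  have "\<sigma> (x + y) = \<sigma> x + \<sigma> y" for x y by (rule eqI) (simp add: \<sigma>[symmetric] f_lin)
  moreover have "\<sigma> (c *s x) = c *s \<sigma> x" for c x by (rule eqI) (simp add: \<sigma>[symmetric] f_lin)
  ultimately have lin: "Vector_Spaces.linear scale scale \<sigma>"
    by (auto simp: Vector_Spaces.linear_iff vector_space_axioms)
  interpret s: Vector_Spaces.linear scale scale \<sigma> by (rule lin)
  have "inj \<sigma>" unfolding s.inj_iff_eq_0
  proof (intro allI impI)
    fix x assume "\<sigma> x = 0"
    then show "x = 0" using \<sigma>[of x] by (intro left_nondeg[OF assms]) simp
  qed
  then have "\<sigma> \<in> general_linear scale"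
    using lin linear_inj_imp_surj[OF lin] by (auto simp: general_linear_def bij_def)
  then show ?thesis using that \<sigma> by blast
qed

lemma asymmetry_eqI:
  assumes nondeg "\<sigma> \<in> general_linear scale" "\<And>u v. f v u = f u (\<sigma> v)"
  shows "asymmetry scale f = \<sigma>"
  unfolding asymmetry_def
proof (rule the_equality)
  fix \<rho> assume \<rho>: "\<rho> \<in> general_linear scale \<and> (\<forall>u v. f v u = f u (\<rho> v))"
  show "\<rho> = \<sigma>"
  proof
    fix v
    have "f u (\<rho> v - \<sigma> v) = 0" for u
      using \<rho> assms(3) by (simp add: f_rdiff)
    then show "\<rho> v = \<sigma> v" using nondegD[OF assms(1), of "\<rho> v - \<sigma> v"] by simp
  qed
qed (use assms in blast)

lemma gram_mult_vec:
  assumes "length vs = n" "i < n" "w \<in> carrier_vec n"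
  shows "(gram_matrix scale f vs *\<^sub>v w) $ i = f (vs ! i) (\<Sum>j<n. w $ j *s vs ! j)"
  using assms
  by (simp add: gram_matrix_def scalar_prod_def f_rsum f_rscale atLeast0LessThan mult.commute)

lemma gram_kernel:
  assumes "ordered_basis scale vs" "length vs = n" "w \<in> carrier_vec n"
  shows "gram_matrix scale f vs *\<^sub>v w = 0\<^sub>v n \<longleftrightarrow> (\<forall>y. f y (\<Sum>j<n. w $ j *s vs ! j) = 0)"
proof
  assume "gram_matrix scale f vs *\<^sub>v w = 0\<^sub>v n"
  then have "f b (\<Sum>j<n. w $ j *s vs ! j) = 0" if "b \<in> set vs" for b
  proof -
    obtain i where i: "i < n" "b = vs ! i" using \<open>b \<in> set vs\<close> assms(2) by (auto simp: in_set_conv_nth)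
    show ?thesis using gram_mult_vec[OF assms(2) i(1) assms(3)] \<open>_ = 0\<^sub>v n\<close> i by simp
  qed
  then show "\<forall>y. f y (\<Sum>j<n. w $ j *s vs ! j) = 0"
    using f_zero_span[of "set vs"] assms(1) by (auto simp: ordered_basis_def)
next
  assume "\<forall>y. f y (\<Sum>j<n. w $ j *s vs ! j) = 0"
  then show "gram_matrix scale f vs *\<^sub>v w = 0\<^sub>v n"
    using gram_mult_vec[OF assms(2) _ assms(3)] assms(2) by (intro eq_vecI) (auto simp: gram_matrix_def)
qed

lemma gram_invertible_iff:
  assumes "ordered_basis scale vs"
  shows "invertible_mat (gram_matrix scale f vs) \<longleftrightarrow> nondeg"
proof -
  define n where "n = length vs"
  have M: "gram_matrix scale f vs \<in> carrier_mat n n" by (simp add: gram_matrix_def n_def)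
  note k = gram_kernel[OF assms n_def[symmetric]]
  show ?thesis
    unfolding invertible_mat_iff_det[OF M] det_0_iff_vec_prod_zero_field[OF M]
  proof
    assume *: "\<not> (\<exists>v. v \<in> carrier_vec n \<and> v \<noteq> 0\<^sub>v n \<and> gram_matrix scale f vs *\<^sub>v v = 0\<^sub>v n)"
    show nondeg unfolding nondeg_def
    proof (intro allI impI)
      fix x assume x: "\<forall>y. f y x = 0"
      obtain c where c: "x = (\<Sum>i<n. c i *s vs ! i)"
        using ordered_basis_coords[OF assms] unfolding n_def by blast
      have c': "x = (\<Sum>i<n. vec n c $ i *s vs ! i)" unfolding c by simp
      have "gram_matrix scale f vs *\<^sub>v vec n c = 0\<^sub>v n" using k[of "vec n c"] x c' by simp
      then have "vec n c = 0\<^sub>v n" using * vec_carrier by blast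
      then have "c i = 0" if "i < n" for i using that by (metis index_vec index_zero_vec(1))
      then show "x = 0" unfolding c by simp
    qed
  next
    assume nd: nondeg
    show "\<not> (\<exists>v. v \<in> carrier_vec n \<and> v \<noteq> 0\<^sub>v n \<and> gram_matrix scale f vs *\<^sub>v v = 0\<^sub>v n)"
    proof (intro notI, elim exE conjE)
      fix w assume w: "w \<in> carrier_vec n" "w \<noteq> 0\<^sub>v n" "gram_matrix scale f vs *\<^sub>v w = 0\<^sub>v n"
      then have "(\<Sum>j<n. w $ j *s vs ! j) = 0" using k nondegD[OF nd] by blast
      then have "w $ i = 0" if "i < n" for i
        using ordered_basis_independent[OF assms, of "\<lambda>i. w $ i"] that unfolding n_def by blast
      then show False using w by (metis carrier_vecD eq_vecI index_zero_vec(1) index_zero_vec(2))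
    qed
  qed
qed

lemma nondegenerate_iff: "nondegenerate scale f \<longleftrightarrow> nondeg"
  unfolding nondegenerate_def has_gram_matrix_def
  using gram_invertible_iff obtain_ordered_basis by metis

end

section \<open>Fitting decomposition, annihilating and minimal polynomials\<close>

lemma (in finite_dimensional_vector_space) fitting:
  assumes Y: "Vector_Spaces.linear scale scale Y"
  obtains K where "K > 0" "\<And>x. \<exists>z. (Y ^^ K) (x - (Y ^^ K) z) = 0"
    "\<And>z. (Y ^^ K) ((Y ^^ K) z) = 0 \<Longrightarrow> (Y ^^ K) z = 0"
proof -
  interpret Y: Vector_Spaces.linear scale scale Y by (rule Y)
  have lin: "Vector_Spaces.linear scale scale (Y ^^ k)" for k
    by (induction k) (auto simp: Vector_Spaces.linear_iff vector_space_axioms Y.add Y.scale)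
  have sub: "subspace (range (Y ^^ k))" for k
    using module_hom.subspace_image[OF lin[of k, THEN Vector_Spaces.linear.axioms(3)]] subspace_UNIV
    by blast
  \<comment> \<open>Minimising over the exponents \<open>Suc k\<close> makes K positive, so that the
    kernel of Y lies in the kernel of Y^K. Minimality makes Y^K map its range onto itself, hence
    injectively; the last two conclusions then say V = ker + range and ker \<inter> range =
    0.\<close>
  define k where "k = (ARG_MIN (\<lambda>k. dim (range (Y ^^ Suc k))) k. True)"
  define K where "K = Suc k"
  have min: "dim (range (Y ^^ K)) \<le> dim (range (Y ^^ Suc j))" for j
    unfolding K_def k_def by (rule arg_min_nat_le[of "\<lambda>_. True"]) simp
  interpret YK: Vector_Spaces.linear scale scale "Y ^^ K" by (rule lin)
  have eq: "(Y ^^ K) ` range (Y ^^ K) = range (Y ^^ K)"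
  proof (rule subspace_dim_equal)
    show "subspace ((Y ^^ K) ` range (Y ^^ K))" using sub YK.subspace_image by blast
    have "(Y ^^ K) ` range (Y ^^ K) = range (Y ^^ Suc (K + k))"
      unfolding image_comp funpow_add[symmetric] by (simp only: K_def add_Suc_right)
    then show "dim (range (Y ^^ K)) \<le> dim ((Y ^^ K) ` range (Y ^^ K))" using min by simp
  qed (auto simp: sub)
  show ?thesis
  proof (rule that)
    show "K > 0" by (simp add: K_def)
    show "\<exists>z. (Y ^^ K) (x - (Y ^^ K) z) = 0" for x
      using eq by (simp add: YK.diff) (metis (no_types, lifting) imageE rangeE rangeI)
    show "(Y ^^ K) z = 0" if "(Y ^^ K) ((Y ^^ K) z) = 0" for z
      using linear_surj_on_inj[OF lin sub eq _ that] by simp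
  qed
qed

context fd_endo
begin

lemma P_monom: "P (monom c i) v = c *s (\<sigma> ^^ i) v"
  by (induction i) (simp_all add: monom_0 monom_Suc P_pCons sigma.scale)

lemma P_sum: "P (\<Sum>i\<in>A. p i) v = (\<Sum>i\<in>A. P (p i) v)"
  by (induction A rule: infinite_finite_induct) (simp_all add: P_add)

text \<open>Among v, \<sigma> v, ..., \<sigma>^n v with n the dimension, either two vectors coincide
  or the n + 1 vectors are dependent. Dependence is a notion for sets, whence the two cases.\<close>

lemma vector_annihilator: obtains q where "q \<noteq> 0" "P q v = 0"
proof -
  let ?n = "dim (UNIV :: 'v set)"
  let ?e = "\<lambda>i. (\<sigma> ^^ i) v"
  show ?thesis
  proof (cases "inj_on ?e {..?n}")
    case True
    then have "card (?e ` {..?n}) = Suc ?n" by (simp add: card_image)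
    then have "dependent (?e ` {..?n})"
      using independent_bound_general[of "?e ` {..?n}"] dim_subset[of "?e ` {..?n}" UNIV] by fastforce
    then obtain c w where c: "(\<Sum>w\<in>?e ` {..?n}. c w *s w) = 0" and w: "w \<in> ?e ` {..?n}" "c w \<noteq> 0"
      using independent_explicit[of "?e ` {..?n}"] by auto
    define q where "q = (\<Sum>i\<le>?n. monom (c (?e i)) i)"
    obtain i where i: "i \<le> ?n" "w = ?e i" using w(1) by auto
    have "coeff q i = c w" unfolding q_def coeff_sum using i by (simp add: sum.delta)
    then have "q \<noteq> 0" using w(2) by auto
    moreover have "P q v = 0"
      using c unfolding q_def P_sum P_monom sum.reindex[OF True] o_def .
    ultimately show ?thesis by (rule that)
  next
    case False
    then obtain i j where ij: "i \<noteq> j" "?e i = ?e j" unfolding inj_on_def by blast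
    have "coeff (monom 1 i - monom 1 j :: 'a poly) i = 1" using ij by simp
    then have "monom 1 i - monom 1 j \<noteq> (0 :: 'a poly)" by force
    then show ?thesis
      by (rule that) (use ij in \<open>simp add: P_diff P_monom\<close>)
  qed
qed

lemma annihilator: obtains q where "q \<noteq> 0" "\<And>v. P q v = 0"
proof -
  obtain q where q: "\<And>b. q b \<noteq> 0" "\<And>b. P (q b) b = 0" 
  proof -
    have "\<exists>q. q \<noteq> 0 \<and> P q b = 0" for b using vector_annihilator[of b] by blast
    then show ?thesis using that by metis
  qed
  have "P (\<Prod>b\<in>Basis. q b) v = 0" if "v \<in> span Basis" for v
    using that
  proof (induction rule: span_induct_alt)
    case (step c b y)
    then have "P (\<Prod>b\<in>Basis. q b) b = 0" using q(2)[of b] P_dvd dvd_prodI[OF finite_Basis] by blast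
    then show ?case using step by (simp add: P_vadd P_vscale)
  qed simp
  moreover have "(\<Prod>b\<in>Basis. q b) \<noteq> 0" using q(1) finite_Basis by simp
  ultimately show ?thesis using that span_Basis by blast
qed

lemma minimal_polynomial_eqI:
  assumes "lead_coeff p = 1" "\<And>q. (\<forall>v. P q v = 0) \<longleftrightarrow> p dvd q"
  shows "minimal_polynomial scale \<sigma> = p"
  unfolding minimal_polynomial_def
proof (rule the_equality)
  fix r assume r: "lead_coeff r = 1 \<and> (\<forall>q. (\<forall>v. P q v = 0) \<longleftrightarrow> r dvd q)"
  then have r': "lead_coeff r = 1" "\<And>q. (\<forall>v. P q v = 0) \<longleftrightarrow> r dvd q" by simp_all
  have "r dvd p" "p dvd r"
    using r'(2)[of p] r'(2)[of r] assms(2)[of p] assms(2)[of r] by simp_all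
  then obtain k where k: "p = r * k" by (elim dvdE)
  have nz: "r \<noteq> 0" "p \<noteq> 0" using r'(1) assms(1) by auto
  then have "degree r = degree p"
    using \<open>r dvd p\<close> \<open>p dvd r\<close> by (metis dvd_imp_degree_le order_antisym)
  then have "degree k = 0" using k nz by (simp add: degree_mult_eq)
  then obtain c where c: "k = [:c:]" by (rule degree_eq_zeroE)
  have "lead_coeff k = 1" using r'(1) assms(1) k by (simp add: lead_coeff_mult)
  then show "r = p" using k c by simp
qed (use assms in blast)

text \<open>\<open>minimal_polynomial\<close> is a definite description, so existence must be
  supplied: an annihilator of least degree divides every annihilator by division with remainder, and
  is then made monic.\<close>

lemma minimal_polynomial_ann_iff: "(\<forall>v. P q v = 0) \<longleftrightarrow> minimal_polynomial scale \<sigma> dvd q"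
proof -
  define A where "A q \<longleftrightarrow> q \<noteq> 0 \<and> (\<forall>v. P q v = 0)" for q
  obtain q0 where "A q0" using annihilator unfolding A_def by metis
  define m where "m = arg_min degree A"
  have m: "A m" "\<And>q. A q \<Longrightarrow> degree m \<le> degree q"
    unfolding m_def using arg_min_natI[of A q0] arg_min_nat_le[of A _ degree] \<open>A q0\<close> by auto
  have iff: "(\<forall>v. P q v = 0) \<longleftrightarrow> m dvd q" for q
  proof
    assume q: "\<forall>v. P q v = 0"
    have "P (q mod m) v = 0" for v
      using q m(1) by (simp add: minus_div_mult_eq_mod[symmetric] P_diff P_mult A_def)
    then have "q mod m = 0"
      using m degree_mod_less[of m q] unfolding A_def by (metis not_less)
    then show "m dvd q" by auto
  next
    assume "m dvd q"
    then show "\<forall>v. P q v = 0" using m(1) P_dvd unfolding A_def by blast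
  qed
  define c where "c = inverse (lead_coeff m)"
  have c: "c \<noteq> 0" "lead_coeff (smult c m) = 1" using m(1) by (simp_all add: A_def c_def)
  have iff': "(\<forall>v. P q v = 0) \<longleftrightarrow> smult c m dvd q" for q
    unfolding iff smult_dvd_iff using c(1) by simp
  show ?thesis unfolding minimal_polynomial_eqI[OF c(2) iff'] by (rule iff')
qed

lemma eigenvector:
  assumes "splits (minimal_polynomial scale \<sigma>)" "(v :: 'v) \<noteq> 0"
  obtains a w where "w \<noteq> 0" "\<sigma> w = a *s w"
proof -
  obtain c as where c: "c \<noteq> 0" "minimal_polynomial scale \<sigma> = smult c (\<Prod>a\<leftarrow>as. [:-a, 1:])"
    using assms(1) unfolding splits_def by (elim exE conjE)
  have "P (minimal_polynomial scale \<sigma>) v = 0"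
    using minimal_polynomial_ann_iff[of "minimal_polynomial scale \<sigma>"] by simp
  then have "P (\<Prod>a\<leftarrow>as. [:-a, 1:]) v = 0" using c by (simp add: P_smult)
  then obtain a p where "P p v \<noteq> 0" "\<sigma> (P p v) = a *s P p v"
    by (rule prod_kernel_eigenvector[OF _ assms(2)])
  then show ?thesis by (rule that)
qed

text \<open>Since \<sigma> is injective, factors X can be stripped from a nonzero annihilator until
  its constant term a is nonzero. Writing the result as a + X s gives \<sigma>^-1 =
  -s(\<sigma>)/a.\<close>

lemma inverse_polynomial:
  assumes inj: "\<And>x. \<sigma> x = 0 \<Longrightarrow> x = 0"
  obtains t where "\<And>x. \<sigma> (P t x) = x"
proof -
  obtain q where q: "q \<noteq> 0" "\<And>v. P q v = 0" by (rule annihilator) (rule that)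
  obtain k r where r: "q = [:0, 1:] ^ k * r" "poly r 0 \<noteq> 0"
    using order_decomp[OF q(1), of 0] by (auto simp: poly_eq_0_iff_dvd)
  have "P ([:0, 1:] ^ k * r) x = 0 \<Longrightarrow> P r x = 0" for x
  proof (induction k)
    case (Suc k)
    have "P ([:0, 1:] ^ Suc k * r) x = \<sigma> (P ([:0, 1:] ^ k * r) x)"
      by (simp only: power_Suc mult.assoc P_mult[of "[:0, 1:]"] P_X)
    then have "\<sigma> (P ([:0, 1:] ^ k * r) x) = 0" using Suc.prems by (rule trans[OF sym])
    then show ?case by (rule Suc.IH[OF inj])
  next
    case 0
    then show ?case by (simp only: power_0 mult_1_left)
  qed
  then have Pr: "P r x = 0" for x using q(2)[of x] unfolding r(1) by blast
  obtain a s where s: "r = pCons a s" by (cases r)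
  have a: "a \<noteq> 0" using r(2) s by simp
  have "\<sigma> (P s x) = - (a *s x)" for x
    using Pr[of x] unfolding s P_pCons by (metis add.commute eq_neg_iff_add_eq_0)
  then have "\<sigma> (P (smult (- inverse a) s) x) = x" for x
    using a by (simp add: P_smult P_minus sigma.neg sigma.scale)
  then show ?thesis by (rule that)
qed

end

section \<open>Adjoints, orthogonal summands and hyperbolic pairs\<close>

lemma pcompose_power: "pcompose (p ^ n) q = pcompose p q ^ n" for p q :: "'a::comm_ring_1 poly"
  by (induction n) (simp_all add: pcompose_1 pcompose_mult)

lemma comaximal_power:
  fixes A B :: "'a::comm_ring_1"
  assumes "r * A + s * B = 1"
  obtains r' s' where "r' * A ^ m + s' * B ^ n = 1"
proof -
  have *: "\<exists>r s. r * A + s * B ^ n = 1" if "r * A + s * B = 1" for A B r s :: 'a and n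
  proof (induction n)
    case 0
    show ?case by (rule exI[of _ 0], rule exI[of _ 1]) simp
  next
    case (Suc n)
    then obtain r' s' where "r' * A + s' * B ^ n = 1" by blast
    then have "(r * A + s * B) * (r' * A + s' * B ^ n) = 1" using that by simp
    then have "(r * r' * A + r * s' * B ^ n + s * B * r') * A + (s * s') * B ^ Suc n = 1"
      by (simp add: algebra_simps)
    then show ?case by blast
  qed
  obtain r1 s1 where "r1 * A + s1 * B ^ n = 1" using *[OF assms] by blast
  then have "s1 * B ^ n + r1 * A = 1" by (simp add: add.commute)
  from *[OF this, of m] show ?thesis using that by (metis add.commute)
qed

lemma comaximal_linear:
  fixes a b :: "'a::field"
  assumes "a \<noteq> b"
  obtains r s where "r * [:-a, 1:] ^ m + s * [:-b, 1:] ^ n = 1"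
proof -
  define c where "c = inverse (b - a)"
  have "c * b - c * a = 1" using assms by (simp add: c_def flip: right_diff_distrib)
  then have "b * c - a * c = 1" by (simp only: mult.commute)
  then have "[:c:] * [:-a, 1:] + [:-c:] * [:-b, 1:] = 1" by (simp add: one_pCons)
  then show ?thesis using comaximal_power[of _ "[:-a, 1:]" _ "[:-b, 1:]" m n] that by blast
qed

lemma sum_lessThan_add:
  fixes g :: "nat \<Rightarrow> 'b::comm_monoid_add"
  shows "(\<Sum>i<m + n. g i) = (\<Sum>i<m. g i) + (\<Sum>j<n. g (m + j))"
  by (induction n) (simp_all add: add.assoc)

text \<open>With t(\<sigma>) = \<sigma>^-1, the adjoint of p(\<sigma>) is p(t(\<sigma>)), so
  adjunction becomes the operation \<open>pcompose p t\<close> on polynomials. Keeping t as a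
  parameter allows two forms to share it.\<close>

locale fd_form = fd_endo scale Basis \<sigma> + fd_bilinear scale Basis f
  for scale :: "'a::field \<Rightarrow> 'v::ab_group_add \<Rightarrow> 'v" (infixr "*s" 75) and Basis
    and f :: "'v \<Rightarrow> 'v \<Rightarrow> 'a" and \<sigma> :: "'v \<Rightarrow> 'v" +
  fixes t :: "'a poly"
  assumes nondeg: nondeg and asym: "f v u = f u (\<sigma> v)" and sigma_t: "\<sigma> (P t v) = v"
begin

lemma right_eqI: "(\<And>z. f z x = f z y) \<Longrightarrow> x = y"
  using nondegD[OF nondeg, of "x - y"] by (simp add: f_rdiff)

lemma left_eqI: "(\<And>z. f x z = f y z) \<Longrightarrow> x = y"
  using left_nondeg[OF nondeg, of "x - y"] by (simp add: f_ldiff)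

lemma t_sigma: "P t (\<sigma> v) = v" by (metis P_sigma sigma_t)

lemma sigma_inj: "\<sigma> x = 0 \<Longrightarrow> x = 0" by (metis t_sigma P.zero)


lemma isometry: "f (\<sigma> x) (\<sigma> y) = f x y" by (metis asym)

lemma adj_sigma: "f (\<sigma> x) y = f x (P t y)" by (metis isometry sigma_t)
lemma adj_t: "f (P t x) y = f x (\<sigma> y)" by (metis isometry sigma_t)

lemma adj: "f (P p x) y = f x (P (pcompose p t) y)"
  by (induction p arbitrary: y)
    (simp_all add: P_pCons pcompose_pCons P_add P_mult f_lin adj_sigma flip: P_commute[of t])

lemma adj': "f x (P p y) = f (P (pcompose p t) x) y"
  by (induction p arbitrary: x)
    (simp_all add: P_pCons pcompose_pCons P_add P_mult f_lin flip: adj_t P_commute[of t])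

text \<open>t(t(X)) need not be X as a polynomial; it acts like X because taking the adjoint twice
  changes nothing.\<close>

lemma P_pcompose_twice: "P (pcompose (pcompose q t) t) x = P q x"
  by (rule left_eqI) (simp flip: adj adj')

lemma stable_image_sigma:
  assumes "subspace S" "\<And>x. x \<in> S \<Longrightarrow> \<sigma> x \<in> S"
  shows "\<sigma> ` S = S"
  by (rule linear_stable_eqI[OF linear_sigma assms(1)]) (use assms sigma_inj in auto)

lemma orthogonal_sum_stable:
  assumes S: "subspace S" "\<And>x. x \<in> S \<Longrightarrow> \<sigma> x \<in> S"
    and nd: "\<And>x. x \<in> S \<Longrightarrow> (\<And>y. y \<in> S \<Longrightarrow> f y x = 0) \<Longrightarrow> x = 0"
  shows "orthogonal_sum scale f S {x. \<forall>y\<in>S. f y x = 0}"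
  unfolding orthogonal_sum_def
proof (intro conjI ballI)
  let ?W = "{x. \<forall>y\<in>S. f y x = 0}"
  show "subspace S" by fact
  show "subspace ?W" by (auto simp: subspace_def f_lin)
  show "S \<inter> ?W = {0}" using nd subspace_0[OF S(1)] by auto
  obtain B where B: "B \<subseteq> S" "independent B" "S \<subseteq> span B" by (rule basis_exists[of S]) (rule that)
  have finB: "finite B" using B(2) by (rule finiteI_independent)
  \<comment> \<open>\<open>?T x\<close> stores the values of f on a basis of S against x. It is
    injective on S, hence maps S onto S, so some u in S has the same values as x and x - u is
    orthogonal to S.\<close>
  let ?T = "\<lambda>x. \<Sum>b\<in>B. f b x *s b"
  have lin: "Vector_Spaces.linear scale scale ?T"
    by (auto simp: Vector_Spaces.linear_iff vector_space_axioms f_radd f_rscale scale_left_distrib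
        sum.distrib scale_sum_right)
  have T_S: "?T x \<in> S" for x using B(1) S(1) by (auto intro!: subspace_sum subspace_scale)
  have T0: "f y x = 0" if "?T x = 0" "y \<in> S" for x y
  proof -
    have "f b x = 0" if "b \<in> B" for b
      using B(2)[unfolded independent_explicit, THEN conjunct2, rule_format, of "\<lambda>b. f b x"]
        \<open>?T x = 0\<close> that by blast
    then show ?thesis using f_zero_span[of B] that B(3) by blast
  qed
  have im: "?T ` S = S"
    by (rule linear_stable_eqI[OF lin S(1)]) (use T_S nd T0 in blast)+
  show "{u + w |u w. u \<in> S \<and> w \<in> ?W} = UNIV"
  proof -
    have "\<exists>u w. x = u + w \<and> u \<in> S \<and> w \<in> ?W" for x
    proof -
      obtain u where u: "u \<in> S" "?T u = ?T x" using im T_S[of x] by (metis (no_types, lifting) imageE)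
      have "?T (x - u) = 0" using u(2) by (simp add: f_rdiff scale_left_diff_distrib sum_subtractf)
      then have "x - u \<in> ?W" using T0 by blast
      with u(1) show ?thesis by (intro exI[of _ u] exI[of _ "x - u"] conjI) simp_all
    qed
    then show ?thesis by blast
  qed
  fix u w assume u: "u \<in> S" and w: "w \<in> ?W"
  show "f u w = 0" using u w by blast
  \<comment> \<open>Stability makes one-sided orthogonality two-sided: f w (\<sigma> u') = f u'
    w.\<close>
  obtain u' where "u' \<in> S" "u = \<sigma> u'" using u stable_image_sigma[OF S] by blast
  then show "f w u = 0" using w by (simp flip: asym)
qed

lemma indecomposable_full:
  assumes "indecomposable scale f" "subspace S" "\<And>x. x \<in> S \<Longrightarrow> \<sigma> x \<in> S"
    and "\<And>x. x \<in> S \<Longrightarrow> (\<And>y. y \<in> S \<Longrightarrow> f y x = 0) \<Longrightarrow> x = 0"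
    and "w \<in> S" "w \<noteq> 0"
  shows "S = UNIV"
proof -
  have o: "orthogonal_sum scale f S {x. \<forall>y\<in>S. f y x = 0}"
    by (rule orthogonal_sum_stable) (use assms in blast)+
  then have "{x. \<forall>y\<in>S. f y x = 0} = {0}"
    using assms(1,5,6) unfolding indecomposable_def by blast
  with o show ?thesis unfolding orthogonal_sum_def by auto
qed

text \<open>For x in U, the W-component of \<sigma> x is orthogonal to U by assumption and to W
  because f w' (\<sigma> x) = f x w' = 0. It thus lies in the radical.\<close>

lemma orthogonal_sum_sigma:
  assumes o: "orthogonal_sum scale f U W"
  shows "x \<in> U \<Longrightarrow> \<sigma> x \<in> U" and "x \<in> W \<Longrightarrow> \<sigma> x \<in> W"
proof -
  have sub: "subspace U" "subspace W" using o by (auto simp: orthogonal_sum_def)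
  have dec: "\<exists>u w. x = u + w \<and> u \<in> U \<and> w \<in> W" for x using o unfolding orthogonal_sum_def by blast
  have orth: "f u w = 0" "f w u = 0" if "u \<in> U" "w \<in> W" for u w
    using o that unfolding orthogonal_sum_def by blast+
  show "\<sigma> x \<in> U" if x: "x \<in> U"
  proof -
    obtain u w where uw: "\<sigma> x = u + w" "u \<in> U" "w \<in> W" using dec by blast
    have "f z w = 0" for z
    proof -
      obtain u' w' where z: "z = u' + w'" "u' \<in> U" "w' \<in> W" using dec by blast
      have "f w' (u + w) = 0" using orth(1)[OF x z(3)] by (simp add: asym[of x] uw(1))
      then show ?thesis using orth z uw by (simp add: f_lin)
    qed
    then have "w = 0" using nondegD[OF nondeg] by blast
    then show ?thesis using uw by simp
  qed
  show "\<sigma> x \<in> W" if x: "x \<in> W"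
  proof -
    obtain u w where uw: "\<sigma> x = u + w" "u \<in> U" "w \<in> W" using dec by blast
    have "f z u = 0" for z
    proof -
      obtain u' w' where z: "z = u' + w'" "u' \<in> U" "w' \<in> W" using dec by blast
      have "f u' (u + w) = 0" using orth(2)[OF z(2) x] by (simp add: asym[of x] uw(1))
      then show ?thesis using orth z uw by (simp add: f_lin)
    qed
    then have "u = 0" using nondegD[OF nondeg] by blast
    then show ?thesis using uw by simp
  qed
qed

text \<open>With \<open>\<tau> = \<sigma>\<^sup>-\<^sup>1\<close>, the operator \<open>\<sigma> + \<tau> - (a + a\<^sup>-\<^sup>1)\<close> is self-adjoint, so its Fitting
  decomposition is orthogonal.\<close>

lemma indecomposable_spectrum:
  assumes ind: "indecomposable scale f" and w: "w \<noteq> 0" "\<sigma> w = a *s w"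
  obtains K where "a \<noteq> 0" "\<And>x. P (([:-a, 1:] * [:-inverse a, 1:]) ^ K) x = 0"
proof -
  have a: "a \<noteq> 0" using w sigma_inj by auto
  define y where "y = t + [:-(a + inverse a), 1:]"
  have Py: "P y x = P t x + \<sigma> x - (a + inverse a) *s x" for x
    unfolding y_def P_add P_linear_factor by (rule add_diff_eq)
  have pow: "(P y ^^ k) x = P (y ^ k) x" for k x by (induction k) (simp_all add: P_mult)
  have self: "f (P (y ^ k) x) z = f x (P (y ^ k) z)" for k x z
    by (induction k arbitrary: x z)
      (simp_all add: P_mult P_commute[of y] Py f_lin adj_t adj_sigma P_sigma P_vadd P.diff P_vscale
        P_commute[of t])
  obtain K where K: "K > 0" "\<And>x. \<exists>z. P (y ^ K) (x - P (y ^ K) z) = 0"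
    "\<And>z. P (y ^ K) (P (y ^ K) z) = 0 \<Longrightarrow> P (y ^ K) z = 0"
    by (rule fitting[OF P_linear[of y]]) (auto simp: pow)
  define U where "U = {x. P (y ^ K) x = 0}"
  define W where "W = range (P (y ^ K))"
  have "orthogonal_sum scale f U W"
    unfolding orthogonal_sum_def
  proof (intro conjI ballI)
    show "subspace U" unfolding U_def by (auto simp: subspace_def P_vadd P_vscale)
    show "subspace W" unfolding W_def using P.subspace_image[OF subspace_UNIV] by blast
    show "U \<inter> W = {0}" unfolding U_def W_def using K(3) by (auto intro: range_eqI[of _ _ 0])
    have "\<exists>u w. x = u + w \<and> u \<in> U \<and> w \<in> W" for x
    proof -
      obtain z where "P (y ^ K) (x - P (y ^ K) z) = 0" using K(2) by blast
      then show ?thesis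
        by (intro exI[of _ "x - P (y ^ K) z"] exI[of _ "P (y ^ K) z"]) (auto simp: U_def W_def)
    qed
    then show "{u + w |u w. u \<in> U \<and> w \<in> W} = UNIV" by blast
    fix u w assume "u \<in> U" "w \<in> W"
    then show "f u w = 0" "f w u = 0" unfolding U_def W_def by (auto simp: self simp flip: self[of _ u])
  qed
  moreover have "w \<in> U"
  proof -
    have "P t w = inverse a *s w" using t_sigma[of w] w(2) a by (simp add: P_vscale) (metis scale_scale scale_one left_inverse)
    then have "P y w = 0" using w(2) by (simp add: Py scale_left_distrib)
    then show ?thesis unfolding U_def using K(1) P_dvd[of y "y ^ K"] by (auto simp: dvd_power)
  qed
  ultimately have "W = {0}" using ind w(1) unfolding indecomposable_def by blast
  then have yK: "P (y ^ K) x = 0" for x unfolding W_def by blast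
  \<comment> \<open>(X - a)(X - 1/a) = X (X + 1/X - (a + 1/a)): the quadratic factor is \<sigma>
    times the self-adjoint operator, so nilpotency carries over.\<close>
  have Q: "P ([:-a, 1:] * [:-inverse a, 1:]) x = \<sigma> (P y x)" for x
    using a by (simp only: P_mult P_linear_factor Py)
      (simp add: sigma.add sigma.diff sigma.scale sigma_t scale_right_diff_distrib scale_left_distrib)
  have "P (([:-a, 1:] * [:-inverse a, 1:]) ^ k) x = (\<sigma> ^^ k) (P (y ^ k) x)" for k x
  proof (induction k arbitrary: x)
    case (Suc k)
    have s: "P p ((\<sigma> ^^ k) x) = (\<sigma> ^^ k) (P p x)" for p k x by (induction k) (simp_all add: P_sigma)
    show ?case by (simp only: power_Suc P_mult[of _ "_ ^ k"] Suc Q s) (simp add: P_mult funpow_swap1)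
  qed simp
  then have "P (([:-a, 1:] * [:-inverse a, 1:]) ^ K) x = 0" for x
    using yK by (metis P_monom P.zero scale_one)
  then show ?thesis using that a by blast
qed

section \<open>Hyperbolic pairs and the Gram matrix of a Jordan block\<close>

definition adjoint_factor :: "'a \<Rightarrow> 'a poly" where "adjoint_factor a = pcompose [:-a, 1:] t"

lemma pcompose_factor_power: "pcompose ([:-a, 1:] ^ i) t = adjoint_factor a ^ i"
  by (simp add: pcompose_power adjoint_factor_def)

lemma P_adjoint_factor: "P (adjoint_factor a) x = P t x - a *s x"
  by (simp add: adjoint_factor_def pcompose_pCons P_add)

text \<open>For a b = 1 and \<tau> = \<sigma>^-1 one has \<tau> - b = -b \<tau> (\<sigma> - a): up
  to a unit, the adjoint of \<sigma> - b is \<sigma> - a.\<close>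

lemma adjoint_factor_inverse:
  assumes "a * b = 1"
  shows "P (adjoint_factor b ^ i) x = (- b) ^ i *s P (t ^ i) (P ([:-a, 1:] ^ i) x)"
proof (induction i arbitrary: x)
  case (Suc i)
  have b: "P (adjoint_factor b) x = - b *s P t (P [:-a, 1:] x)" for x
    using assms by (simp add: P_adjoint_factor P_linear_factor P.diff P_vscale t_sigma
      scale_right_diff_distrib mult.commute[of b])
  show ?case
    by (simp only: power_Suc P_mult b Suc P_vscale scale_scale P_commute[of "[:-a, 1:]" "t ^ i"] mult.commute)
qed simp

text \<open>\<open>u\<close> and \<open>v\<close> generate totally isotropic cyclic submodules that are paired perfectly by \<open>f\<close>,
  the first one being a Jordan block of size \<open>k + 1\<close> and eigenvalue \<open>a\<close>.\<close>

definition hyp_pair :: "'a \<Rightarrow> nat \<Rightarrow> 'v \<Rightarrow> 'v \<Rightarrow> bool" where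
  "hyp_pair a k u v \<longleftrightarrow> P ([:-a, 1:] ^ Suc k) u = 0 \<and> P (adjoint_factor a ^ Suc k) v = 0 \<and>
     f v (P ([:-a, 1:] ^ k) u) \<noteq> 0 \<and>
     (\<forall>x\<in>cyc u. \<forall>y\<in>cyc u. f x y = 0) \<and> (\<forall>x\<in>cyc v. \<forall>y\<in>cyc v. f x y = 0)"

lemma hyp_pair_chain: "hyp_pair a k u v \<Longrightarrow> chain a k u" by (auto simp: hyp_pair_def chain_def)

lemma hyp_pair_reach:
  assumes h: "hyp_pair a k u v" and y: "y \<in> cyc u" and 0: "\<And>i. f v (P ([:-a, 1:] ^ i) y) = 0"
  shows "y = 0"
proof (rule ccontr)
  assume "y \<noteq> 0"
  moreover obtain p where "y = P p u" using y by (rule cycE)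
  ultimately obtain j c where "c \<noteq> 0" "P ([:-a, 1:] ^ j) y = c *s P ([:-a, 1:] ^ k) u"
    using chain_reach[OF hyp_pair_chain[OF h]] by metis
  then show False using 0[of j] h by (simp add: f_rscale hyp_pair_def)
qed

text \<open>For z = q(\<sigma>) v, adjunction moves q over to u, where \<open>hyp_pair_reach\<close>
  applies. So (X - a)^(k+1) divides \<open>pcompose q t\<close>; taking adjoints once more turns
  this into a multiple of the polynomial that kills v.\<close>

lemma hyp_pair_reach':
  assumes h: "hyp_pair a k u v" and z: "z \<in> cyc v" and 0: "\<And>i. f z (P ([:-a, 1:] ^ i) u) = 0"
  shows "z = 0"
proof -
  obtain q where q: "z = P q v" using z by (rule cycE)
  have "f v (P ([:-a, 1:] ^ i) (P (pcompose q t) u)) = 0" for i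
    using 0[of i] unfolding q adj by (simp only: P_commute)
  then have "P (pcompose q t) u = 0" using hyp_pair_reach[OF h cycI] by blast
  then have "[:-a, 1:] ^ Suc k dvd pcompose q t" using chain_ann_iff[OF hyp_pair_chain[OF h]] by simp
  then obtain r where r: "pcompose q t = [:-a, 1:] ^ Suc k * r" by (rule dvdE)
  have "P q v = P (pcompose (pcompose q t) t) v" by (simp add: P_pcompose_twice)
  also have "\<dots> = 0"
    unfolding r pcompose_mult pcompose_factor_power using h P_dvd[OF dvd_triv_left] by (auto simp: hyp_pair_def)
  finally show ?thesis by (simp add: q)
qed

lemma hyp_pair_full:
  assumes ind: "indecomposable scale f" and h: "hyp_pair a k u v"
  obtains y z where "x = y + z" "y \<in> cyc u" "z \<in> cyc v"
proof -
  define S where "S = {y + z |y z. y \<in> cyc u \<and> z \<in> cyc v}"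
  have S: "subspace S" unfolding S_def by (rule subspace_sums[OF subspace_cyc subspace_cyc])
  have SP: "P p x \<in> S" if "x \<in> S" for x p
    using that cyc_P unfolding S_def by (auto simp: P_vadd) blast
  have uS: "cyc u \<subseteq> S" and vS: "cyc v \<subseteq> S"
    unfolding S_def using subspace_0[OF subspace_cyc]
    by (auto, metis add.right_neutral, metis add.left_neutral)
  have "S = UNIV"
  proof (rule indecomposable_full[OF ind S])
    show "\<sigma> x \<in> S" if "x \<in> S" for x using SP[OF that, of "[:0, 1:]"] by (simp add: P_X)
    show "u \<in> S" using uS cyc_self by blast
    show "u \<noteq> 0" using h by (auto simp: hyp_pair_def)
    fix x assume x: "x \<in> S" and 0: "\<And>y. y \<in> S \<Longrightarrow> f y x = 0"
    obtain y z where yz: "x = y + z" "y \<in> cyc u" "z \<in> cyc v" using x unfolding S_def by blast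
    have "f v (P ([:-a, 1:] ^ i) y) = 0" for i
    proof -
      have "f v (P ([:-a, 1:] ^ i) x) = 0"
        unfolding adj' by (rule 0) (use vS in auto)
      moreover have "f v (P ([:-a, 1:] ^ i) z) = 0" using h yz(3) cyc_P by (simp add: hyp_pair_def)
      ultimately show ?thesis by (simp add: yz(1) P_vadd f_radd)
    qed
    then have y: "y = 0" using hyp_pair_reach[OF h yz(2)] by blast
    have "f z (P ([:-a, 1:] ^ i) u) = 0" for i
    proof -
      \<comment> \<open>The hypothesis tests x from the left only, so the vector of
        \<open>cyc u\<close> is moved to the left argument by means of the asymmetry.\<close>
      have "f x (P ([:-a, 1:] ^ i) u) = f (P t (P ([:-a, 1:] ^ i) u)) x" by (simp add: asym[of x] adj_t)
      also have "\<dots> = 0" by (rule 0) (use uS cyc_P in auto)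
      finally show ?thesis by (simp add: yz(1) y)
    qed
    then have "z = 0" using hyp_pair_reach'[OF h yz(3)] by blast
    then show "x = 0" using y yz(1) by simp
  qed
  then show ?thesis using that unfolding S_def by (auto simp: set_eq_iff)
qed

text \<open>Descend from i = k. After scaling, the value at i = k - (j+1) is removed by subtracting
  a multiple of the (j+1)-st power of the adjoint of N = \<sigma> - a applied to v'. This shifts the
  values by j + 1, so it contributes 1 there and nothing at larger i.\<close>

lemma hyp_pair_normalise:
  assumes h: "hyp_pair a k u v"
  obtains v' where "v' \<in> cyc v" "\<And>i. i \<le> k \<Longrightarrow> f v' (P ([:-a, 1:] ^ i) u) = (if i = k then 1 else 0)"
proof -
  let ?N = "\<lambda>i. P ([:-a, 1:] ^ i) u"
  have N0: "?N i = 0" if "i > k" for i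
    using P_dvd[OF le_imp_power_dvd[of "Suc k" i]] that h by (auto simp: hyp_pair_def)
  have "\<exists>v'\<in>cyc v. \<forall>i. k - j \<le> i \<and> i \<le> k \<longrightarrow> f v' (?N i) = (if i = k then 1 else 0)" if "j \<le> k" for j
    using that
  proof (induction j)
    case 0
    have "inverse (f v (?N k)) *s v \<in> cyc v" by (intro subspace_scale[OF subspace_cyc]) simp
    then show ?case using h by (intro bexI[of _ "inverse (f v (?N k)) *s v"]) (auto simp: f_lscale hyp_pair_def)
  next
    case (Suc j)
    then obtain v' where v': "v' \<in> cyc v"
      "\<And>i. k - j \<le> i \<Longrightarrow> i \<le> k \<Longrightarrow> f v' (?N i) = (if i = k then 1 else 0)" by auto
    define c where "c = f v' (?N (k - Suc j))"
    let ?v = "v' - c *s P (adjoint_factor a ^ Suc j) v'"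
    have "?v \<in> cyc v" using v'(1) by (intro subspace_diff subspace_scale subspace_cyc cyc_P)
    moreover have "f ?v (?N i) = (if i = k then 1 else 0)" if i: "k - Suc j \<le> i" "i \<le> k" for i
    proof -
      have shift: "f (P (adjoint_factor a ^ Suc j) v') (?N i) = f v' (?N (Suc j + i))"
        unfolding pcompose_factor_power[symmetric] adj'[symmetric] P_mult[symmetric] power_add[symmetric] ..
      have val: "f ?v (?N i) = f v' (?N i) - c * f v' (?N (Suc j + i))"
        by (simp only: f_ldiff f_lscale shift)
      show ?thesis
      proof (cases "i = k - Suc j")
        case True
        then have eq: "Suc j + i = k" using Suc.prems by simp
        have "f v' (?N (Suc j + i)) = 1" unfolding eq using v'(2)[of k] by simp
        moreover have "f v' (?N i) = c" by (simp only: c_def True)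
        moreover have "i \<noteq> k" using eq by simp
        ultimately show ?thesis unfolding val by simp
      next
        case False
        then have "Suc j + i > k" "k - j \<le> i" using i Suc.prems by simp_all
        then show ?thesis unfolding val using v'(2)[of i] i N0[of "Suc j + i"] by simp
      qed
    qed
    ultimately show ?case by blast
  qed
  from this[of k] show ?thesis using that by auto
qed

lemma hyp_pair_gram:
  assumes ind: "indecomposable scale f" and h: "hyp_pair a k u v"
  shows "has_gram_matrix scale f (jordan_form_mat (Suc k) a)"
proof -
  let ?N = "\<lambda>i. P ([:-a, 1:] ^ i) u"
  obtain v' where v': "v' \<in> cyc v" "\<And>i. i \<le> k \<Longrightarrow> f v' (?N i) = (if i = k then 1 else 0)"
    using hyp_pair_normalise[OF h] by blast
  have N0: "?N i = 0" if "i > k" for i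
    using P_dvd[OF le_imp_power_dvd[of "Suc k" i]] that h by (auto simp: hyp_pair_def)
  have sub: "cyc v' \<subseteq> cyc v" using v'(1) cyc_P by (auto elim!: cycE)
  have M0: "P (adjoint_factor a ^ Suc k) v' = 0"
  proof -
    obtain q where "v' = P q v" using v'(1) by (rule cycE)
    then show ?thesis using h by (simp only: P_commute[of _ q] hyp_pair_def P.zero)
  qed
  have "f v' (?N k) \<noteq> 0" using v'(2)[of k] by simp
  with h M0 sub have h': "hyp_pair a k u v'" unfolding hyp_pair_def by blast
  \<comment> \<open>The chain of u is listed from the bottom upwards. Then f(e' i, e j) is the
    identity block, and f(e i, e' j) = f(e' j, \<sigma> (e i)) with \<sigma> (e i) = a e i + e (i-1)
    is the lower triangular Jordan block.\<close>
  define e where "e i = ?N (k - i)" for i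
  define e' where "e' i = P (adjoint_factor a ^ i) v'" for i
  have e'e: "f (e' i) (e j) = (if i = j then 1 else 0)" if "i \<le> k" "j \<le> k" for i j
  proof -
    have "f (e' i) (e j) = f v' (?N (i + (k - j)))"
      unfolding e_def e'_def pcompose_factor_power[symmetric] adj'[symmetric] P_mult[symmetric] power_add[symmetric] ..
    also have "\<dots> = (if i = j then 1 else 0)"
    proof (cases "i + (k - j) \<le> k")
      case True
      then show ?thesis using v'(2)[OF True] that by auto
    next
      case False
      then show ?thesis using N0[of "i + (k - j)"] that by auto
    qed
    finally show ?thesis .
  qed
  have e_cyc: "e i \<in> cyc u" "e' i \<in> cyc v'" for i unfolding e_def e'_def by simp_all
  have iso: "f (e i) (e j) = 0" "f (e' i) (e' j) = 0" for i j
    using h' e_cyc unfolding hyp_pair_def by blast+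
  have ee': "f (e i) (e' j) = (if i = j then a else if i = Suc j then 1 else 0)"
    if "i \<le> k" "j \<le> k" for i j
  proof -
    have "\<sigma> (e i) = a *s e i + ?N (Suc (k - i))"
      unfolding e_def by (simp only: power_Suc P_mult P_linear_factor) simp
    then have "f (e i) (e' j) = a * f (e' j) (e i) + f (e' j) (?N (Suc (k - i)))"
      by (simp add: asym[of "e i"] f_lin)
    moreover have "f (e' j) (?N (Suc (k - i))) = (if i = Suc j then 1 else 0)"
    proof (cases i)
      case 0
      then show ?thesis using N0[of "Suc k"] by simp
    next
      case (Suc l)
      then have "?N (Suc (k - i)) = e l" using that unfolding e_def by (simp add: Suc_diff_Suc del: power_Suc)
      then show ?thesis using e'e[of j l] that Suc by auto
    qed
    ultimately show ?thesis using e'e[OF that(2,1)] by auto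
  qed
  define vs where "vs = map e [0..<Suc k] @ map e' [0..<Suc k]"
  have len: "length vs = Suc k + Suc k" unfolding vs_def by simp
  have nth: "vs ! i = (if i < Suc k then e i else e' (i - Suc k))" if "i < Suc k + Suc k" for i
    using that unfolding vs_def by (auto simp: nth_append simp del: upt_Suc)
  have S: "(\<Sum>i<length vs. c i *s vs ! i) = (\<Sum>i<Suc k. c i *s e i) + (\<Sum>j<Suc k. c (Suc k + j) *s e' j)" for c
    unfolding len sum_lessThan_add using nth by (intro arg_cong2[of _ _ _ _ "(+)"] sum.cong) auto
  have coord: "f (e' i) (\<Sum>j<Suc k. c j *s e j) = c i" if "i \<le> k" for i c
  proof -
    have "f (e' i) (\<Sum>j<Suc k. c j *s e j) = (\<Sum>j<Suc k. if j = i then c i else 0)"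
      unfolding f_rsum f_rscale using that e'e by (intro sum.cong) auto
    then show ?thesis using that by (simp add: sum.delta)
  qed
  have coord': "f (\<Sum>j<Suc k. c j *s e' j) (e i) = c i" if "i \<le> k" for i c
  proof -
    have "f (\<Sum>j<Suc k. c j *s e' j) (e i) = (\<Sum>j<Suc k. if j = i then c i else 0)"
      unfolding f_lsum f_lscale using that e'e by (intro sum.cong) auto
    then show ?thesis using that by (simp add: sum.delta)
  qed
  have basis: "ordered_basis scale vs"
  proof (rule ordered_basisI)
    fix x
    obtain y z where yz: "x = y + z" "y \<in> cyc u" "z \<in> cyc v'" by (rule hyp_pair_full[OF ind h'])
    obtain c where c: "y = (\<Sum>i<Suc k. c i *s ?N i)"
      using cyc_sum[OF _ yz(2)] h by (auto simp: hyp_pair_def simp del: power_Suc)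
    have y: "y = (\<Sum>i<Suc k. c (k - i) *s e i)"
      unfolding c e_def by (subst sum.nat_diff_reindex[symmetric]) simp
    define d where "d j = f z (e j)" for j
    define w where "w = z - (\<Sum>j<Suc k. d j *s e' j)"
    have w: "w \<in> cyc v'"
      unfolding w_def using yz(3) e_cyc by (intro subspace_diff subspace_sum subspace_scale subspace_cyc)
    have "f w (?N i) = 0" for i
    proof (cases "i \<le> k")
      case True
      then have "?N i = e (k - i)" by (simp add: e_def)
      then show ?thesis using coord'[of "k - i" d] by (simp add: w_def f_ldiff d_def)
    next
      case False
      then show ?thesis using N0[of i] by simp
    qed
    then have "w = 0" using hyp_pair_reach'[OF h' w] by blast
    then have z: "z = (\<Sum>j<Suc k. d j *s e' j)" by (simp add: w_def)
    show "\<exists>c. x = (\<Sum>i<length vs. c i *s vs ! i)"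
      unfolding S yz(1) y z
      by (rule exI[of _ "\<lambda>i. if i < Suc k then c (k - i) else d (i - Suc k)"]) simp
  next
    fix c assume "(\<Sum>i<length vs. c i *s vs ! i) = 0"
    then have eq: "(\<Sum>i<Suc k. c i *s e i) + (\<Sum>j<Suc k. c (Suc k + j) *s e' j) = 0" unfolding S .
    have c1: "c i = 0" if "i \<le> k" for i
    proof -
      have "0 = f (e' i) ((\<Sum>i<Suc k. c i *s e i) + (\<Sum>j<Suc k. c (Suc k + j) *s e' j))" by (simp only: eq f_rzero)
      also have "\<dots> = c i" unfolding f_radd coord[OF that] by (simp add: f_rsum f_rscale iso f_radd)
      finally show ?thesis by simp
    qed
    have c2: "c (Suc k + i) = 0" if "i \<le> k" for i
    proof -
      have "0 = f ((\<Sum>i<Suc k. c i *s e i) + (\<Sum>j<Suc k. c (Suc k + j) *s e' j)) (e i)" by (simp only: eq f_lzero)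
      also have "\<dots> = c (Suc k + i)"
        unfolding f_ladd coord'[OF that, of "\<lambda>j. c (Suc k + j)"] by (simp add: f_lsum f_lscale iso f_ladd)
      finally show ?thesis by simp
    qed
    show "\<forall>i<length vs. c i = 0"
    proof (intro allI impI)
      fix i assume "i < length vs"
      then show "c i = 0" using c1[of i] c2[of "i - Suc k"] unfolding len by (cases "i \<le> k") auto
    qed
  qed
  have "gram_matrix scale f vs = jordan_form_mat (Suc k) a"
  proof (rule eq_matI)
    show d: "dim_row (gram_matrix scale f vs) = dim_row (jordan_form_mat (Suc k) a)"
      "dim_col (gram_matrix scale f vs) = dim_col (jordan_form_mat (Suc k) a)"
      by (simp_all add: gram_matrix_def jordan_form_mat_def len lower_jordan_block_def mat1_def)
    fix i j assume "i < dim_row (jordan_form_mat (Suc k) a)" "j < dim_col (jordan_form_mat (Suc k) a)"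
    then have ij: "i < Suc k + Suc k" "j < Suc k + Suc k"
      by (simp_all add: jordan_form_mat_def lower_jordan_block_def mat1_def)
    then show "gram_matrix scale f vs $$ (i, j) = jordan_form_mat (Suc k) a $$ (i, j)"
      using e'e[of "i - Suc k" j] ee'[of i "j - Suc k"]
      by (auto simp: gram_matrix_def len nth iso jordan_form_mat_def lower_jordan_block_def mat1_def
          index_mat_four_block)
  qed
  then show ?thesis using basis unfolding has_gram_matrix_def by blast
qed

lemma hyp_pair_exists:
  assumes ind: "indecomposable scale f" and w: "w \<noteq> 0" "\<sigma> w = a *s w" and a2: "a\<^sup>2 \<noteq> 1"
  obtains k u v where "hyp_pair a k u v"
proof -
  obtain K where a: "a \<noteq> 0" and K: "\<And>x. P (([:-a, 1:] * [:-inverse a, 1:]) ^ K) x = 0"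
    using indecomposable_spectrum[OF ind w] by blast
  define b where "b = inverse a"
  have ab: "a * b = 1" "b * a = 1" using a by (simp_all add: b_def)
  have neq: "a \<noteq> b" using ab a2 by (auto simp: power2_eq_square)
  define A where "A = [:-a, 1:] ^ K"
  define B where "B = [:-b, 1:] ^ K"
  have AB: "P (A * B) x = 0" for x using K[of x] by (simp only: A_def B_def b_def power_mult_distrib)
  obtain r s where rs: "r * A + s * B = 1"
    unfolding A_def B_def by (rule comaximal_linear[OF neq])
  have dec: "x = P (s * B) x + P (r * A) x" for x
  proof -
    have "P (s * B + r * A) x = x" using rs by (simp only: add.commute P_one)
    then show ?thesis unfolding P_add by (rule sym)
  qed
  have decA: "P A (P (s * B) x) = 0" and decB: "P B (P (r * A) x) = 0" for x
  proof -
    have "P A (P (s * B) x) = P s (P (A * B) x)" by (simp only: P_mult P_commute[of A s])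
    then show "P A (P (s * B) x) = 0" by (simp only: AB P.zero)
    have "P B (P (r * A) x) = P r (P (A * B) x)" by (simp only: P_mult P_commute[of B])
    then show "P B (P (r * A) x) = 0" by (simp only: AB P.zero)
  qed
  \<comment> \<open>On ker A the operator B is inverted by s, and the adjoint of B is a unit times
    A, which kills x.\<close>
  have isoA: "f x y = 0" if "P A x = 0" "P A y = 0" for x y
  proof -
    have "P B (P s y) = P (s * B) y + P (r * A) y"
      by (simp only: P_mult that(2) P.zero add_0_right P_commute[of B s])
    then have "f x y = f x (P B (P s y))" by (intro arg_cong[of _ _ "f x"] trans[OF dec[of y] sym])
    also have "\<dots> = f (P (pcompose B t) x) (P s y)" by (rule adj')
    also have "P (pcompose B t) x = 0"
      unfolding B_def pcompose_factor_power adjoint_factor_inverse[OF ab(1)] using that(1) by (simp add: A_def)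
    finally show ?thesis by simp
  qed
  have isoB: "f x y = 0" if "P B x = 0" "P B y = 0" for x y
  proof -
    have "P A (P r y) = P (s * B) y + P (r * A) y"
      by (simp only: P_mult that(2) P.zero add_0_left P_commute[of A r])
    then have "f x y = f x (P A (P r y))" by (intro arg_cong[of _ _ "f x"] trans[OF dec[of y] sym])
    also have "\<dots> = f (P (pcompose A t) x) (P r y)" by (rule adj')
    also have "P (pcompose A t) x = 0"
      unfolding A_def pcompose_factor_power adjoint_factor_inverse[OF ab(2)] using that(1) by (simp add: B_def)
    finally show ?thesis by simp
  qed
  \<comment> \<open>The exact nilpotency order of \<sigma> - a on ker A, so that a vector u with
    nonzero bottom exists.\<close>
  define m where "m = (LEAST j. \<forall>x. P A x = 0 \<longrightarrow> P ([:-a, 1:] ^ j) x = 0)"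
  have m: "\<And>x. P A x = 0 \<Longrightarrow> P ([:-a, 1:] ^ m) x = 0"
    unfolding m_def by (rule LeastI2[of _ K]) (auto simp: A_def)
  have Kpos: "K \<noteq> 0" using K[of w] w(1) by (intro notI) simp
  have wA: "P A w = 0"
    unfolding A_def using P_dvd[of "[:-a, 1:]" "[:-a, 1:] ^ K" w] w(2) Kpos
    by (simp add: P_linear_factor dvd_power)
  have "m \<noteq> 0" using m[OF wA] w(1) by (intro notI) simp
  then obtain k where k: "m = Suc k" by (cases m) auto
  have "\<not> (\<forall>x. P A x = 0 \<longrightarrow> P ([:-a, 1:] ^ k) x = 0)"
    using not_less_Least[of k "\<lambda>j. \<forall>x. P A x = 0 \<longrightarrow> P ([:-a, 1:] ^ j) x = 0"] k m_def by simp
  then obtain u where u: "P A u = 0" "P ([:-a, 1:] ^ k) u \<noteq> 0" by blast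
  let ?e = "P ([:-a, 1:] ^ k) u"
  have eA: "P A ?e = 0" using u(1) by (simp add: P_commute[of A] del: power_Suc)
  \<comment> \<open>Some y pairs with the bottom vector. Its component in ker A does not contribute,
    since ker A is isotropic, so the component in ker B serves as v.\<close>
  obtain y where "f y ?e \<noteq> 0" using u(2) nondegD[OF nondeg] by blast
  then have v: "f (P (r * A) y) ?e \<noteq> 0"
    using dec[of y] isoA[OF decA eA] by (metis f_ladd add_0)
  let ?v = "P (r * A) y"
  have vB: "P B ?v = 0" by (rule decB)
  have "hyp_pair a k u ?v"
    unfolding hyp_pair_def
  proof (intro conjI ballI)
    show "P ([:-a, 1:] ^ Suc k) u = 0" using m[OF u(1)] k by simp
    show "f ?v ?e \<noteq> 0" by (rule v)
    show "f x y = 0" if "x \<in> cyc u" "y \<in> cyc u" for x y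
      using that u(1) by (auto elim!: cycE intro!: isoA simp: P_commute[of A])
    show "f x y = 0" if "x \<in> cyc ?v" "y \<in> cyc ?v" for x y
      using that vB by (auto elim!: cycE intro!: isoB simp: P_commute[of B])
    \<comment> \<open>Test against z and split z: the part in ker A dies by the choice of m, the
      part in ker B because ker B is isotropic.\<close>
    show "P (adjoint_factor a ^ Suc k) ?v = 0"
    proof (rule left_eqI)
      fix z
      have "f (P (adjoint_factor a ^ Suc k) ?v) z = f ?v (P ([:-a, 1:] ^ Suc k) z)"
        by (simp only: adj' pcompose_factor_power)
      also have "\<dots> = f ?v (P ([:-a, 1:] ^ Suc k) (P (s * B) z)) + f ?v (P ([:-a, 1:] ^ Suc k) (P (r * A) z))"
        using dec[of z] by (metis P_vadd f_radd)
      also have "P ([:-a, 1:] ^ Suc k) (P (s * B) z) = 0" using m[OF decA] k by simp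
      also have "f ?v (P ([:-a, 1:] ^ Suc k) (P (r * A) z)) = 0"
        by (rule isoB[OF vB], subst P_commute, simp only: decB P.zero)
      finally show "f (P (adjoint_factor a ^ Suc k) ?v) z = f 0 z" by simp
    qed
  qed
  then show ?thesis by (rule that)
qed

end

section \<open>Adjusting a generator in the unipotent case\<close>

lemma two_eq_0_iff_CHAR: "(2 :: 'a::field) = 0 \<longleftrightarrow> CHAR('a) = 2"
proof -
  have "(2 :: 'a) = 0 \<longleftrightarrow> CHAR('a) dvd 2" using of_nat_eq_0_iff_char_dvd[where 'a='a, of 2] by simp
  also have "\<dots> \<longleftrightarrow> CHAR('a) = 2"
    using CHAR_not_1'[where 'a='a] prime_nat_iff[of 2] two_is_prime_nat by auto
  finally show ?thesis .
qed

lemma even_pderiv_power: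
  fixes p :: "'a::field poly"
  assumes "(2 :: 'a) = 0" "even r"
  shows "pderiv (p ^ r) = 0"
proof -
  obtain i where "r = 2 * i" using assms(2) by (rule evenE)
  then have "(of_nat r :: 'a) = 0" using assms(1) by simp
  then show ?thesis by (cases r) (simp_all add: pderiv_power_Suc del: power_Suc)
qed

lemma quadratically_closed_root:
  fixes c b d :: "'a::field"
  assumes qc: "quadratically_closed TYPE('a)" and b: "b \<noteq> 0"
  obtains x where "c + x * b + x * x * d = 0"
proof (cases "d = 0")
  case True
  then show ?thesis using that[of "- c / b"] b by simp
next
  case False
  then have "degree [:c, b, d:] = 2" by simp
  then obtain x where "poly [:c, b, d:] x = 0" using qc unfolding quadratically_closed_def by blast
  then show ?thesis using that[of x] by (simp add: algebra_simps)
qed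

lemma quadratically_closed_sqrt:
  fixes c :: "'a::field"
  assumes qc: "quadratically_closed TYPE('a)"
  obtains x where "x * x = c"
proof -
  have "degree [:- c, 0, 1:] = 2" by simp
  then obtain x where "poly [:- c, 0, 1:] x = 0" using qc unfolding quadratically_closed_def by blast
  then show ?thesis using that[of x] by simp
qed

text \<open>\<open>t\<close> represents the inverse of \<open>X\<close> to first order at \<open>e\<close>. If \<open>t\<close> acts as \<open>\<sigma>\<^sup>-\<^sup>1\<close>, then \<open>f u (p(\<sigma>) u)\<close> is
  unchanged when \<open>p\<close> is replaced by \<open>dag t p\<close>.\<close>

definition dag :: "'a::field poly \<Rightarrow> 'a poly \<Rightarrow> 'a poly" where "dag t p = pcompose p t * [:0, 1:]"

text \<open>\<open>t1\<close> is the quotient (t - e)/(X - e), so t(e) = e and t'(e) = t1(e) = -1,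
  the 1-jet of 1/X at e when e^2 = 1. Substituting t turns (X - e)^r into (X - e)^r t1^r; this is
  the origin of all signs (-1)^r below.\<close>

locale inverse_at =
  fixes e :: "'a::field" and t t1 :: "'a poly"
  assumes ee: "e * e = 1" and t1: "t - [:e:] = [:-e, 1:] * t1" "poly t1 e = - 1"
begin

lemma t_e: "poly t e = e"
proof -
  have "poly (t - [:e:]) e = 0" by (simp only: t1 poly_mult) simp
  then show ?thesis by simp
qed


lemma pderiv_t: "poly (pderiv t) e = - 1"
proof -
  have "pderiv (t - [:e:]) = [:-e, 1:] * pderiv t1 + t1 * pderiv [:-e, 1:]"
    by (simp only: t1(1) pderiv_mult)
  then have "poly (pderiv t) e = poly ([:-e, 1:] * pderiv t1 + t1 * pderiv [:-e, 1:]) e"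
    by (simp add: pderiv_diff)
  also have "\<dots> = - 1" by (simp only: poly_add poly_mult t1(2)) (simp add: pderiv_pCons)
  finally show ?thesis .
qed

lemma pcompose_lin: "pcompose [:-e, 1:] t = [:-e, 1:] * t1"
  unfolding t1(1)[symmetric] by (simp add: pcompose_pCons)

lemma dag_lin_power: "dag t ([:-e, 1:] ^ r * q) = [:-e, 1:] ^ r * (t1 ^ r * [:0, 1:] * pcompose q t)"
  by (simp only: dag_def pcompose_mult pcompose_power pcompose_lin power_mult_distrib ac_simps)

text \<open>Modulo (X - e)^(r+1), the product (X - e)^r q depends on q(e) alone.\<close>

lemma linear_functional_eval:
  assumes add: "\<And>p q. \<phi> (p + q) = \<phi> p + \<phi> q" and scale: "\<And>c p. \<phi> (smult c p) = c * \<phi> p"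
    and top: "\<And>p. \<phi> ([:-e, 1:] ^ Suc r * p) = (0 :: 'a)"
  shows "\<phi> ([:-e, 1:] ^ r * q) = poly q e * \<phi> ([:-e, 1:] ^ r)"
proof -
  have "[:-e, 1:] ^ r * q = [:-e, 1:] ^ r * ([:-e, 1:] * synthetic_div q e + [:poly q e:])"
    by (simp only: synthetic_div_correct')
  also have "\<dots> = [:-e, 1:] ^ Suc r * synthetic_div q e + smult (poly q e) ([:-e, 1:] ^ r)"
    by (simp only: distrib_left power_Suc ac_simps smult_one[symmetric] mult_smult_right) simp
  finally show ?thesis by (simp only: add scale top add_0_left)
qed


text \<open>\<open>dag\<close> multiplies the leading term (X - e)^r by t1^r X, whose value at e is
  (-1)^r e, so invariance forces this sign to be 1. In characteristic 2 the sign carries no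
  information, and the term one order lower is examined instead.\<close>

lemma dag_invariant_parity:
  assumes add: "\<And>p q. \<phi> (p + q) = \<phi> p + \<phi> q" and scale: "\<And>c p. \<phi> (smult c p) = c * \<phi> p"
    and dag: "\<And>p. \<phi> (dag t p) = \<phi> p"
    and top: "\<And>p. \<phi> ([:-e, 1:] ^ Suc r * p) = (0 :: 'a)"
    and nz: "\<phi> ([:-e, 1:] ^ r) \<noteq> 0"
  shows "(- 1) ^ r * e = 1" and "(2 :: 'a) = 0 \<Longrightarrow> even r"
proof -
  note ev = linear_functional_eval[of \<phi>, OF add scale top]
  have "\<phi> ([:-e, 1:] ^ r) = \<phi> ([:-e, 1:] ^ r * (t1 ^ r * [:0, 1:]))"
    using dag[of "[:-e, 1:] ^ r"] dag_lin_power[of r 1] by (simp only: pcompose_1 mult_1_right)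
  also have "\<dots> = (- 1) ^ r * e * \<phi> ([:-e, 1:] ^ r)" unfolding ev by (simp add: poly_power t1(2))
  finally show "(- 1) ^ r * e = 1" using nz by simp
  show "even r" if two: "(2 :: 'a) = 0"
  proof (rule ccontr)
    assume "odd r"
    then obtain j where j: "r = Suc j" "even j" by (cases r) auto
    \<comment> \<open>Invariance at order j = r - 1 says that \<phi> vanishes on (X - e)^j
      \<open>?E\<close>. Here \<open>?E\<close> vanishes at e, and its derivative there is 1 since
      t1^j has derivative 0 for even j. So \<phi> would vanish on a leading term of order r.\<close>
    let ?E = "t1 ^ j * [:0, 1:] - 1"
    have m1: "(- 1 :: 'a) = 1" using two by (simp add: eq_neg_iff_add_eq_0)
    have "(e - 1) * (e + 1) = 0" using ee by (simp add: algebra_simps)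
    then have e1: "e = 1" using m1 by (auto simp: eq_neg_iff_add_eq_0[symmetric])
    have "poly ?E e = 0" by (simp add: poly_power t1(2) m1) (simp add: e1)
    then have "[:-e, 1:] dvd ?E" by (simp only: poly_eq_0_iff_dvd)
    then obtain q where q: "?E = [:-e, 1:] * q" by (rule dvdE)
    have "poly (pderiv ?E) e = 1"
      unfolding pderiv_diff pderiv_mult even_pderiv_power[OF two j(2)]
      by (simp add: pderiv_pCons poly_power t1(2) m1 pderiv_1)
    then have "poly q e = 1"
      unfolding q pderiv_mult poly_add poly_mult by (simp add: pderiv_pCons)
    have "\<phi> ([:-e, 1:] ^ j) = \<phi> ([:-e, 1:] ^ j * (t1 ^ j * [:0, 1:]))"
      using dag[of "[:-e, 1:] ^ j"] dag_lin_power[of j 1] by (simp only: pcompose_1 mult_1_right)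
    also have "[:-e, 1:] ^ j * (t1 ^ j * [:0, 1:]) = [:-e, 1:] ^ j + [:-e, 1:] ^ j * ?E"
      by (simp only: right_diff_distrib mult_1_right) simp
    also have "[:-e, 1:] ^ j * ?E = [:-e, 1:] ^ r * q"
      unfolding q j(1) by (simp only: power_Suc ac_simps)
    finally have "\<phi> ([:-e, 1:] ^ r * q) = 0" unfolding add by (metis add_cancel_left_right)
    then show False using nz \<open>poly q e = 1\<close> unfolding ev by simp
  qed
qed

end

lemma inverse_at_exists:
  fixes e :: "'a::field" and k :: nat
  assumes ee: "e * e = 1"
  obtains t t1 where "inverse_at e t t1" "[:-e, 1:] ^ Suc k dvd [:0, 1:] * t - 1"
proof -
  let ?X = "[:0, 1:] :: 'a poly" and ?L = "[:-e, 1:]"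
  let ?Y = "1 - smult e ?X"
  have Y: "?Y = smult (- e) ?L" using ee by (simp add: one_pCons)
  \<comment> \<open>Since X = e (1 - Y) with Y = 1 - e X, the inverse is e times a geometric series.
    One term more than nilpotency requires makes the error of order k + 2, so t'(e) can be read off
    even for k = 0.\<close>
  define t where "t = smult e (\<Sum>i<Suc (Suc k). ?Y ^ i)"
  have Xt: "?X * t - 1 = - (?Y ^ Suc (Suc k))"
  proof -
    have "?X * t = (1 - ?Y) * (\<Sum>i<Suc (Suc k). ?Y ^ i)" by (simp add: t_def del: sum.lessThan_Suc)
    also have "\<dots> = 1 - ?Y ^ Suc (Suc k)" by (rule one_diff_power_eq[symmetric])
    finally show ?thesis by simp
  qed
  define q where "q = [:- ((- e) ^ Suc (Suc k)):]"
  have q: "?X * t - 1 = ?L ^ Suc (Suc k) * q"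
    unfolding Xt Y smult_power q_def by (simp del: power_Suc)
  have te: "poly t e = e"
  proof -
    have "poly (?X * t - 1) e = 0" unfolding q by simp
    then have "e * (e * poly t e) = e * 1" by simp
    then show ?thesis using ee by (simp flip: mult.assoc)
  qed
  then have "poly (t - [:e:]) e = 0" by simp
  then have "?L dvd t - [:e:]" by (simp only: poly_eq_0_iff_dvd)
  then obtain t1 where t1: "t - [:e:] = ?L * t1" by (rule dvdE)
  have "?L * (?X * t1) = ?X * t - smult e ?X"
    unfolding mult.left_commute[of ?L] t1[symmetric] by (simp add: right_diff_distrib)
  also have "\<dots> = (?X * t - 1) + ?Y" by simp
  also have "\<dots> = ?L * (?L ^ Suc k * q + [:- e:])" unfolding q Y by (simp add: algebra_simps)
  finally have "?X * t1 = ?L ^ Suc k * q + [:- e:]" by (subst (asm) mult_left_cancel) simp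
  then have "poly (?X * t1) e = poly (?L ^ Suc k * q + [:- e:]) e" by (rule arg_cong)
  then have "e * (e * poly t1 e) = e * (- e)" by simp
  then have "poly t1 e = - 1" using ee by (simp flip: mult.assoc)
  then have "inverse_at e t t1" using ee t1 by unfold_locales
  moreover have "?L ^ Suc k dvd ?X * t - 1"
    unfolding q by (intro dvd_mult2 le_imp_power_dvd) simp
  ultimately show ?thesis by (rule that)
qed

section \<open>The descent on generators when \<sigma> - e is nilpotent\<close>

locale unipotent_form = fd_form scale Basis f \<sigma> t + inverse_at e t t1
  for scale :: "'a::field \<Rightarrow> 'v::ab_group_add \<Rightarrow> 'v" (infixr "*s" 75) and Basis
    and f :: "'v \<Rightarrow> 'v \<Rightarrow> 'a" and \<sigma> :: "'v \<Rightarrow> 'v" and t t1 :: "'a poly" and e :: 'a +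
  fixes k :: nat
  assumes nil: "P ([:-e, 1:] ^ Suc k) v = 0"
begin

definition h :: "'v \<Rightarrow> 'v \<Rightarrow> 'a" where "h x y = f x (P ([:-e, 1:] ^ k) y)"

lemma swap_dag: "f y (P p x) = f x (P (dag t p) y)"
proof -
  have "f x (P (dag t p) y) = f (P p x) (\<sigma> y)" by (simp only: dag_def P_mult P_X adj)
  then show ?thesis by (simp only: asym[of y])
qed

lemma P_top: "P ([:-e, 1:] ^ k * q) y = poly q e *s P ([:-e, 1:] ^ k) y"
  by (rule P_chain_top[OF nil])

lemma f_top: "f x (P ([:-e, 1:] ^ k * q) y) = poly q e * h x y"
  by (simp only: P_top f_rscale h_def)

lemma nil_mult: "k < i \<Longrightarrow> P ([:-e, 1:] ^ i * q) y = 0"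
  using P_dvd[OF dvd_trans[OF le_imp_power_dvd dvd_triv_left], of "Suc k" i] nil by (metis Suc_leI)

lemma h_swap: "h y x = (- 1) ^ k * e * h x y"
proof -
  have "h y x = f x (P ([:-e, 1:] ^ k * (t1 ^ k * [:0, 1:])) y)"
    unfolding h_def swap_dag[of y _ x] using dag_lin_power[of k 1] by (simp only: pcompose_1 mult_1_right)
  then show ?thesis unfolding f_top by (simp add: poly_power t1(2))
qed

lemma f_shift: "f (P ([:-e, 1:] ^ j) x) (P p y) = f x (P ([:-e, 1:] ^ j * (t1 ^ j * p)) y)"
  by (simp only: adj pcompose_power pcompose_lin power_mult_distrib P_mult[symmetric] mult.assoc)

text \<open>The two cross terms are merged by \<open>swap_dag\<close> into a single polynomial
  acting in order r + j. In the quadratic term, t1^j arises from moving (\<sigma> - e)^j across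
  f.\<close>

lemma quadratic_expansion:
  assumes "y = P ([:-e, 1:] ^ j) v"
  shows "f (u + a *s y) (P ([:-e, 1:] ^ r * q) (u + a *s y)) =
    f u (P ([:-e, 1:] ^ r * q) u) +
    a * f u (P ([:-e, 1:] ^ (r + j) * (q + t1 ^ r * [:0, 1:] * pcompose q t)) v) +
    a * a * f v (P ([:-e, 1:] ^ (j + r + j) * (t1 ^ j * q)) v)"
proof -
  let ?p = "[:-e, 1:] ^ r * q"
  have 1: "f y (P ?p u) = f u (P (dag t ?p) y)" by (rule swap_dag)
  have 2: "f u (P ?p y) + f u (P (dag t ?p) y) =
      f u (P ([:-e, 1:] ^ (r + j) * (q + t1 ^ r * [:0, 1:] * pcompose q t)) v)"
    unfolding f_radd[symmetric] P_add[symmetric] dag_lin_power assms P_mult[symmetric] distrib_left power_add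
    by (simp only: ac_simps)
  have 3: "f y (P ?p y) = f v (P ([:-e, 1:] ^ (j + r + j) * (t1 ^ j * q)) v)"
    unfolding assms f_shift P_mult[symmetric] power_add by (simp only: ac_simps)
  have "f (u + a *s y) (P ?p (u + a *s y)) =
    f u (P ?p u) + a * (f u (P ?p y) + f y (P ?p u)) + a * a * f y (P ?p y)"
    by (simp only: P_vadd P_vscale f_ladd f_radd f_lscale f_rscale) (simp only: algebra_simps)
  then show ?thesis by (simp only: 1 2 3)
qed

text \<open>One descent step: \<open>u' = u + a N\<^sup>j v\<close> with \<open>N = \<sigma> - e\<close>. Choosing \<open>j = k - r\<close> changes the coefficient
  at order \<open>r\<close> by \<open>2 a h(u,v)\<close>. In characteristic 2 this vanishes, and \<open>j = k - r - 1\<close> leads to a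
  quadratic equation for \<open>a\<close> whose linear coefficient is \<open>h(u,v)\<close>.\<close>

lemma generator_step:
  assumes qc: "quadratically_closed TYPE('a)"
    and add: "\<And>p q. \<gamma> (p + q) = \<gamma> p + \<gamma> q" and scale: "\<And>c p. \<gamma> (smult c p) = c * \<gamma> p"
    and dag: "\<And>p. \<gamma> (dag t p) = \<gamma> p"
    and St: "\<And>p. f u (P ([:-e, 1:] ^ Suc r * p) u) = \<gamma> ([:-e, 1:] ^ Suc r * p)"
    and r: "r < k" and huv: "h u v \<noteq> 0" and v: "(2 :: 'a) = 0 \<Longrightarrow> odd k \<Longrightarrow> h v v = 0"
  obtains u' where "\<And>p. f u' (P ([:-e, 1:] ^ r * p) u') = \<gamma> ([:-e, 1:] ^ r * p)" "h u' v = h u v"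
proof -
  \<comment> \<open>The discrepancy from the target functional. It vanishes from order r + 1 on, so
    at order r it is q(e) times the single number \<open>\<delta>\<close>.\<close>
  define \<phi> where "\<phi> p = f u (P p u) - \<gamma> p" for p
  have \<phi>: "\<And>p q. \<phi> (p + q) = \<phi> p + \<phi> q" "\<And>c p. \<phi> (smult c p) = c * \<phi> p" "\<And>p. \<phi> (dag t p) = \<phi> p"
    "\<And>p. \<phi> ([:-e, 1:] ^ Suc r * p) = 0"
    unfolding \<phi>_def St dag swap_dag[of u _ u, symmetric]
    by (simp_all add: P_add P_smult f_lin add scale algebra_simps del: power_Suc)
  define \<delta> where "\<delta> = \<phi> ([:-e, 1:] ^ r)"
  have ev: "f u (P ([:-e, 1:] ^ r * q) u) = \<gamma> ([:-e, 1:] ^ r * q) + poly q e * \<delta>" for q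
  proof -
    have "\<phi> ([:-e, 1:] ^ r * q) = poly q e * \<delta>"
      using linear_functional_eval[of \<phi> r q, OF \<phi>(1,2,4)] by (simp only: \<delta>_def)
    then show ?thesis unfolding \<phi>_def by (simp only: diff_eq_eq add.commute)
  qed
  show ?thesis
  proof (cases "\<delta> = 0")
    case True
    then show ?thesis using that[of u] ev by simp
  next
    case False
    \<comment> \<open>The discrepancy is \<open>dag\<close>-invariant with nonzero leading term at
      order r. The resulting parity makes the two cross terms equal at e rather than
      opposite.\<close>
    then have par: "(- 1) ^ r * e = 1" "(2 :: 'a) = 0 \<Longrightarrow> even r"
      using dag_invariant_parity[of \<phi> r, OF \<phi>] unfolding \<delta>_def by blast+
    show ?thesis
    proof (cases "(2 :: 'a) = 0")
      case two: False
      define j where "j = k - r"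
      have j: "r + j = k" "k < j + r + j" using r by (simp_all add: j_def)
      define y where "y = P ([:-e, 1:] ^ j) v"
      define a where "a = - \<delta> / (2 * h u v)"
      have a: "a * (2 * h u v) = - \<delta>" using huv two by (simp add: a_def)
      show ?thesis
      proof (rule that[of "u + a *s y"])
        fix q
        have "poly (q + t1 ^ r * [:0, 1:] * pcompose q t) e = 2 * poly q e"
          using par(1) par(1)[unfolded mult.commute[of _ e]] by (simp add: poly_power poly_pcompose t1(2) t_e)
        then have "f (u + a *s y) (P ([:-e, 1:] ^ r * q) (u + a *s y)) =
          \<gamma> ([:-e, 1:] ^ r * q) + poly q e * (\<delta> + a * (2 * h u v))"
          unfolding quadratic_expansion[OF y_def] nil_mult[OF j(2)] unfolding j(1) f_top ev
          by (simp add: algebra_simps)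
        then show "f (u + a *s y) (P ([:-e, 1:] ^ r * q) (u + a *s y)) = \<gamma> ([:-e, 1:] ^ r * q)"
          by (simp add: a)
        \<comment> \<open>The modification keeps h(u,v): moving N^j across f puts h(y,v) into order
          j + k, which exceeds k.\<close>
        have "f y (P ([:-e, 1:] ^ k) v) = f v (P ([:-e, 1:] ^ (j + k) * t1 ^ j) v)"
          unfolding y_def f_shift power_add by (simp only: ac_simps)
        also have "\<dots> = 0" using r by (simp add: nil_mult j_def)
        finally show "h (u + a *s y) v = h u v" by (simp add: h_def f_ladd f_lscale)
      qed
    next
      case two: True
      define j where "j = k - Suc r"
      have j: "Suc (r + j) = k" using r by (simp add: j_def)
      have m1: "(- 1 :: 'a) = 1" using two by (simp add: eq_neg_iff_add_eq_0)
      have re: "even r" using par(2) two by blast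
      have e1: "e = 1" using par(1) m1 by simp
      note t1' = t1(2)[unfolded e1] and t_e' = t_e[unfolded e1]
      define y where "y = P ([:-e, 1:] ^ j) v"
      \<comment> \<open>At e the cross polynomial is 2 q(e) = 0, so it contributes one more factor X
        - e and reaches order k. The value of the quotient at e is the derivative q(e): t1^r has
        derivative 0 for even r, X contributes q(e), and q'(e) cancels against the derivative of
        q(t) because t'(e) = -1.\<close>
      have lin: "f u (P ([:-e, 1:] ^ (r + j) * (q + t1 ^ r * [:0, 1:] * pcompose q t)) v) = poly q e * h u v" for q
      proof -
        let ?E = "q + t1 ^ r * [:0, 1:] * pcompose q t"
        have "poly ?E e = 2 * poly q e" by (simp add: poly_power poly_pcompose t1' t_e' m1 e1)
        then have "[:-e, 1:] dvd ?E" unfolding poly_eq_0_iff_dvd[symmetric] two by simp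
        then obtain q' where q': "?E = [:-e, 1:] * q'" by (rule dvdE)
        have "poly (pderiv ?E) e = poly q e"
          unfolding pderiv_add pderiv_mult pderiv_pcompose even_pderiv_power[OF two re]
          by (simp add: pderiv_pCons poly_power poly_pcompose t1' m1 t_e' e1 pderiv_t[unfolded e1] two)
        then have "poly q' e = poly q e" unfolding q' pderiv_mult by (simp add: pderiv_pCons)
        moreover have "[:-e, 1:] ^ (r + j) * ?E = [:-e, 1:] ^ k * q'"
          unfolding q' j[symmetric] by (simp only: power_Suc ac_simps)
        ultimately show ?thesis by (simp only: f_top)
      qed
      \<comment> \<open>j = 0 means k = r + 1 with r even, so k is odd and the hypothesis on h(v,v)
        applies.\<close>
      have j0: "h v v = 0" if "j = 0" using v two re j that by auto
      \<comment> \<open>The quadratic term has order k - 1 + j: it vanishes for j \<ge> 2 and is a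
        top term for j = 1. For j = 0 it starts at order k - 1, and h(v,v) = 0 removes order k, so
        again only q(e) matters.\<close>
      have "\<exists>c. \<forall>q. f v (P ([:-e, 1:] ^ (j + r + j) * (t1 ^ j * q)) v) = poly q e * c"
      proof (cases "j \<ge> 2")
        case True
        then have "k < j + r + j" using j by simp
        then show ?thesis by (simp add: nil_mult)
      next
        case False
        then consider "j = 0" | "j = 1" by linarith
        then show ?thesis
        proof cases
          case 1
          then have k: "k = Suc r" using j by simp
          have "f v (P ([:-e, 1:] ^ Suc r * p) v) = 0" for p
            using f_top[of v p v] j0[OF 1] unfolding k by simp
          then have "f v (P ([:-e, 1:] ^ r * q) v) = poly q e * f v (P ([:-e, 1:] ^ r) v)" for q
            using linear_functional_eval[of "\<lambda>p. f v (P p v)" r q]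
            by (simp add: P_add P_smult f_lin del: power_Suc)
          then show ?thesis using 1 by auto
        next
          case 2
          then have k: "j + r + j = k" using j by simp
          show ?thesis unfolding k f_top using 2 by (intro exI[of _ "- h v v"]) (simp add: t1(2))
        qed
      qed
      then obtain c where c: "\<And>q. f v (P ([:-e, 1:] ^ (j + r + j) * (t1 ^ j * q)) v) = poly q e * c" by blast
      obtain a where a: "\<delta> + a * h u v + a * a * c = 0" using quadratically_closed_root[OF qc huv] by blast
      show ?thesis
      proof (rule that[of "u + a *s y"])
        fix q
        have "f (u + a *s y) (P ([:-e, 1:] ^ r * q) (u + a *s y)) =
          \<gamma> ([:-e, 1:] ^ r * q) + poly q e * (\<delta> + a * h u v + a * a * c)"
          unfolding quadratic_expansion[OF y_def] lin c ev by (simp add: algebra_simps)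
        then show "f (u + a *s y) (P ([:-e, 1:] ^ r * q) (u + a *s y)) = \<gamma> ([:-e, 1:] ^ r * q)"
          by (simp add: a)
        have "f y (P ([:-e, 1:] ^ k) v) = f v (P ([:-e, 1:] ^ (j + k) * t1 ^ j) v)"
          unfolding y_def f_shift power_add by (simp only: ac_simps)
        also have "\<dots> = 0"
          using j0 by (cases "j = 0") (simp_all add: nil_mult h_def)
        finally show "h (u + a *s y) v = h u v" by (simp add: h_def f_ladd f_lscale)
      qed
    qed
  qed
qed

text \<open>The target \<gamma> is 0 when an isotropic generator is wanted, and the functional of
  another form when two generators are to be matched. \<open>start\<close> is agreement at order k,
  and the invariance of h(u,v) keeps each further step solvable.\<close>

lemma adjust_generator:
  assumes qc: "quadratically_closed TYPE('a)"
    and add: "\<And>p q. \<gamma> (p + q) = \<gamma> p + \<gamma> q" and scale: "\<And>c p. \<gamma> (smult c p) = c * \<gamma> p"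
    and dag: "\<And>p. \<gamma> (dag t p) = \<gamma> p"
    and start: "\<And>p. \<gamma> ([:-e, 1:] ^ k * p) = poly p e * h u u"
    and huv: "h u v \<noteq> 0" and v: "(2 :: 'a) = 0 \<Longrightarrow> odd k \<Longrightarrow> h v v = 0"
  obtains u' where "\<And>p. f u' (P p u') = \<gamma> p" "h u' v = h u v"
proof -
  have "\<exists>u'. (\<forall>p. f u' (P ([:-e, 1:] ^ (k - j) * p) u') = \<gamma> ([:-e, 1:] ^ (k - j) * p)) \<and> h u' v = h u v"
    if "j \<le> k" for j
    using that
  proof (induction j)
    case 0
    show ?case by (rule exI[of _ u]) (simp add: f_top start)
  next
    case (Suc j)
    then obtain u1 where u1: "\<And>p. f u1 (P ([:-e, 1:] ^ (k - j) * p) u1) = \<gamma> ([:-e, 1:] ^ (k - j) * p)"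
      "h u1 v = h u v" by auto
    have eq: "k - j = Suc (k - Suc j)" using Suc.prems by simp
    show ?case
      by (rule generator_step[of \<gamma> u1 "k - Suc j" v, OF qc add scale dag u1(1)[unfolded eq]])
        (use Suc.prems u1(2) huv v in auto)
  qed
  from this[of k] show ?thesis using that by auto
qed

text \<open>By adjunction, f(u, p(\<sigma>) u) = 0 for all p amounts to total isotropy of
  \<open>cyc u\<close>. First y is adjusted against x, giving u; then x is adjusted against u,
  giving v. The second adjustment preserves h(x,u), so v still meets the bottom of u.\<close>

lemma alternating_hyp_pair:
  assumes qc: "quadratically_closed TYPE('a)" and alt: "\<And>x. h x x = 0"
    and x: "P ([:-e, 1:] ^ k) x \<noteq> 0"
  obtains u v where "hyp_pair e k u v" "(- 1) ^ k * e = - 1"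
proof -
  have skew: "h y z = - h z y" for y z
  proof -
    have "h (y + z) (y + z) = h y y + h y z + h z y + h z z" by (simp add: h_def P_vadd f_lin)
    then show ?thesis by (simp add: alt eq_neg_iff_add_eq_0)
  qed
  obtain y where y: "h y x \<noteq> 0" using x nondegD[OF nondeg] unfolding h_def by blast
  obtain u where u: "\<And>p. f u (P p u) = 0" "h u x = h y x"
    by (rule adjust_generator[of "\<lambda>_. 0" y x, OF qc]) (use alt y in auto)
  have "h x u \<noteq> 0" using skew[of x u] u(2) y by simp
  obtain v where v: "\<And>p. f v (P p v) = 0" "h v u = h x u"
    by (rule adjust_generator[of "\<lambda>_. 0" x u, OF qc]) (use alt \<open>h x u \<noteq> 0\<close> in auto)
  have "hyp_pair e k u v"
    unfolding hyp_pair_def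
  proof (intro conjI ballI)
    show "P ([:-e, 1:] ^ Suc k) u = 0" by (rule nil)
    show "P (adjoint_factor e ^ Suc k) v = 0"
      unfolding pcompose_factor_power[symmetric] by (rule left_eqI) (simp only: adj'[symmetric] nil f_rzero f_lzero)
    show "f v (P ([:-e, 1:] ^ k) u) \<noteq> 0" using v(2) \<open>h x u \<noteq> 0\<close> by (simp add: h_def)
    show "f y z = 0" if "y \<in> cyc u" "z \<in> cyc u" for y z
      using that u(1) by (auto elim!: cycE simp: adj simp flip: P_mult)
    show "f y z = 0" if "y \<in> cyc v" "z \<in> cyc v" for y z
      using that v(1) by (auto elim!: cycE simp: adj simp flip: P_mult)
  qed
  moreover have "(- 1) ^ k * e = - 1"
    using h_swap[of y x] skew[of y x] y by (metis equation_minus_iff minus_mult_left mult_cancel_right1 mult_minus1 skew)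
  ultimately show ?thesis by (rule that)
qed

lemma anisotropic_parity:
  assumes "h u u \<noteq> 0"
  shows "(- 1) ^ k * e = 1" and "(2 :: 'a) = 0 \<Longrightarrow> even k"
  by (rule dag_invariant_parity[of "\<lambda>p. f u (P p u)"];
      use assms in \<open>simp add: P_add P_smult f_lin nil_mult h_def swap_dag[of u _ u, symmetric] del: power_Suc\<close>)+

lemma anisotropic_chain: "h u u \<noteq> 0 \<Longrightarrow> chain e k u" using nil by (auto simp: chain_def h_def)

lemma anisotropic_full:
  assumes ind: "indecomposable scale f" and u: "h u u \<noteq> 0"
  shows "cyc u = UNIV"
proof (rule indecomposable_full[OF ind subspace_cyc])
  show "u \<in> cyc u" "u \<noteq> 0" using u by (auto simp: h_def)
  show "\<sigma> x \<in> cyc u" if "x \<in> cyc u" for x using that by (rule cyc_sigma)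
  fix x assume x: "x \<in> cyc u" and 0: "\<And>y. y \<in> cyc u \<Longrightarrow> f y x = 0"
  show "x = 0"
  proof (rule ccontr)
    assume "x \<noteq> 0"
    moreover obtain p where "x = P p u" using x by (rule cycE)
    ultimately obtain j c where c: "c \<noteq> 0" "P ([:-e, 1:] ^ j) x = c *s P ([:-e, 1:] ^ k) u"
      using chain_reach[OF anisotropic_chain[OF u]] by metis
    have "f u (P ([:-e, 1:] ^ j) x) = 0" unfolding adj' by (rule 0) simp
    then show False using c u by (simp add: f_rscale h_def)
  qed
qed

end

text \<open>By adjunction a form is determined on a cyclic module by its functional on the
  generator, so generators with equal functionals give an isometry. Both locales carry the same t,
  which makes adjunction the same polynomial operation on both sides.\<close>

lemma anisotropic_equivalent:
  assumes qc: "quadratically_closed TYPE('a::field)"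
    and f: "unipotent_form scale Basis f \<sigma> t t1 (e :: 'a) k"
    and g: "unipotent_form scale Basis g \<rho> t t1 e k"
    and u: "unipotent_form.h scale f \<sigma> e k u u \<noteq> 0" "fd_endo.cyc scale \<sigma> u = UNIV"
    and w: "unipotent_form.h scale g \<rho> e k w w \<noteq> 0" "fd_endo.cyc scale \<rho> w = UNIV"
  shows "equivalent_forms scale scale f g"
proof -
  interpret f: unipotent_form scale Basis f \<sigma> t t1 e k by (rule f)
  interpret g: unipotent_form scale Basis g \<rho> t t1 e k by (rule g)
  \<comment> \<open>Scaling u by a multiplies h(u,u) by a^2; this choice makes the two functionals
    agree at order k.\<close>
  obtain a where a: "a * a = g.h w w / f.h u u" by (rule quadratically_closed_sqrt[OF qc])
  define u0 where "u0 = scale a u"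
  have u0: "f.h u0 u0 = g.h w w"
    using a u(1) by (simp add: u0_def f.h_def f.P_vscale f.f_lin field_simps)
  have "\<exists>u1. \<forall>p. f u1 (f.P p u1) = g w (g.P p w)"
  proof (rule f.adjust_generator[of "\<lambda>p. g w (g.P p w)" u0 u0, OF qc])
    show "g w (g.P (p + q) w) = g w (g.P p w) + g w (g.P q w)" for p q by (simp add: g.P_add g.f_radd)
    show "g w (g.P (smult c p) w) = c * g w (g.P p w)" for c p by (simp add: g.P_smult g.f_rscale)
    show "g w (g.P (dag t p) w) = g w (g.P p w)" for p by (rule g.swap_dag[symmetric])
    show "g w (g.P ([:-e, 1:] ^ k * p) w) = poly p e * f.h u0 u0" for p by (simp only: g.f_top u0)
    show "f.h u0 u0 \<noteq> 0" using u0 w(1) by simp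
    \<comment> \<open>Odd k in characteristic 2 is impossible here, because w is anisotropic for the
      top form of g.\<close>
    show "f.h u0 u0 = 0" if "(2 :: 'a) = 0" "odd k" using g.anisotropic_parity(2)[OF w(1)] that by blast
    show "\<exists>u1. \<forall>p. f u1 (f.P p u1) = g w (g.P p w)" if "\<And>p. f u' (f.P p u') = g w (g.P p w)" for u'
      using that by blast
  qed
  then obtain u1 where u1: "\<And>p. f u1 (f.P p u1) = g w (g.P p w)" by blast
  have "f.h u1 u1 \<noteq> 0" using w(1) u1 by (simp add: f.h_def g.h_def)
  then have c1: "f.chain e k u1" by (rule f.anisotropic_chain)
  have cw: "g.chain e k w" by (rule g.anisotropic_chain[OF w(1)])
  have "f.dim UNIV = Suc k" using f.chain_dim[OF f.anisotropic_chain[OF u(1)] u(2)] .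
  then have full: "f.cyc u1 = UNIV" by (rule f.chain_full_cyc[OF c1])
  have eq_iff: "f.P p u1 = f.P q u1 \<longleftrightarrow> g.P p w = g.P q w" for p q
    using f.chain_ann_iff[OF c1, of "p - q"] g.chain_ann_iff[OF cw, of "p - q"]
    by (simp add: f.P_diff g.P_diff)
  \<comment> \<open>P p u1 |-> P p w is well defined and injective since both generators have
    annihilator ((X - e)^(k+1)).\<close>
  define x where "x z = g.P (SOME p. z = f.P p u1) w" for z
  have x: "x (f.P p u1) = g.P p w" for p
  proof -
    have "f.P p u1 = f.P (SOME q. f.P p u1 = f.P q u1) u1" by (rule someI) (rule refl)
    then show ?thesis unfolding x_def eq_iff by simp
  qed
  have rep: "\<exists>p. z = f.P p u1" for z using full unfolding f.cyc_def by blast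
  have repw: "\<exists>p. z = g.P p w" for z using w(2) unfolding g.cyc_def by blast
  have "Vector_Spaces.linear scale scale x"
    unfolding Vector_Spaces.linear_iff
  proof (intro conjI allI f.vector_space_axioms)
    fix y z c
    obtain p q where pq: "y = f.P p u1" "z = f.P q u1" using rep by metis
    show "x (y + z) = x y + x z" unfolding pq f.P_add[symmetric] x by (rule g.P_add)
    show "x (scale c y) = scale c (x y)" unfolding pq f.P_smult[symmetric] x by (rule g.P_smult)
  qed
  moreover have "bij x"
  proof (rule bijI')
    fix y z
    obtain p q where pq: "y = f.P p u1" "z = f.P q u1" using rep by metis
    show "x y = x z \<longleftrightarrow> y = z" unfolding pq x eq_iff ..
    show "\<exists>z. y = x z" using repw[of y] x by metis
  qed
  moreover have "g (x y) (x z) = f y z" for y z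
  proof -
    obtain p q where pq: "y = f.P p u1" "z = f.P q u1" using rep by metis
    show ?thesis unfolding pq x f.adj g.adj f.P_mult[symmetric] g.P_mult[symmetric] u1 ..
  qed
  ultimately show ?thesis unfolding equivalent_forms_def by blast
qed

section \<open>Gram matrices and elementary divisors\<close>

context finite_dimensional_vector_space
begin

definition coord :: "'b list \<Rightarrow> 'b \<Rightarrow> nat \<Rightarrow> 'a" where
  "coord vs x = (SOME c. x = (\<Sum>i<length vs. c i *s vs ! i))"

context
  fixes vs assumes vs: "ordered_basis scale vs"
begin

lemma coord_sum: "(\<Sum>i<length vs. coord vs x i *s vs ! i) = x"
proof -
  have "\<exists>c. x = (\<Sum>i<length vs. c i *s vs ! i)" using ordered_basis_coords[OF vs, of x] by metis
  from someI_ex[OF this] show ?thesis unfolding coord_def by (rule sym)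
qed

lemma coord_unique:
  assumes "x = (\<Sum>i<length vs. c i *s vs ! i)" "i < length vs"
  shows "coord vs x i = c i"
proof -
  have "(\<Sum>i<length vs. (coord vs x i - c i) *s vs ! i) = 0"
    unfolding scale_left_diff_distrib sum_subtractf coord_sum assms(1)[symmetric] by simp
  then have "coord vs x i - c i = 0" by (rule ordered_basis_independent[OF vs _ assms(2)])
  then show ?thesis by simp
qed

lemma coord_add: "i < length vs \<Longrightarrow> coord vs (x + y) i = coord vs x i + coord vs y i"
  by (rule coord_unique) (simp_all add: scale_left_distrib sum.distrib coord_sum)

lemma coord_scale: "i < length vs \<Longrightarrow> coord vs (c *s x) i = c * coord vs x i"
  by (rule coord_unique) (simp_all add: coord_sum flip: scale_scale scale_sum_right)

lemma coord_basis: "i < length vs \<Longrightarrow> j < length vs \<Longrightarrow> coord vs (vs ! j) i = (if i = j then 1 else 0)"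
proof (rule coord_unique)
  assume "j < length vs"
  have "(\<Sum>i<length vs. (if i = j then 1 else 0) *s vs ! i) = (\<Sum>i<length vs. if i = j then vs ! i else 0)"
    by (rule sum.cong) auto
  then show "vs ! j = (\<Sum>i<length vs. (if i = j then 1 else 0) *s vs ! i)" using \<open>j < length vs\<close> by simp
qed

lemma ordered_basis_map:
  assumes y: "Vector_Spaces.linear scale scale y" "bij y"
  shows "ordered_basis scale (map y vs)"
proof -
  interpret y: Vector_Spaces.linear scale scale y by (rule y)
  have S: "(\<Sum>i<length (map y vs). c i *s map y vs ! i) = y (\<Sum>i<length vs. c i *s vs ! i)" for c
    by (simp add: y.sum y.scale)
  show ?thesis
  proof (rule ordered_basisI)
    show "\<exists>c. x = (\<Sum>i<length (map y vs). c i *s map y vs ! i)" for x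
    proof -
      obtain z where "x = y z" using y(2) by (metis bij_pointE)
      then show ?thesis unfolding S by (intro exI[of _ "coord vs z"]) (simp add: coord_sum)
    qed
    fix c assume "(\<Sum>i<length (map y vs). c i *s map y vs ! i) = 0"
    then have "y (\<Sum>i<length vs. c i *s vs ! i) = y 0" unfolding S by simp
    then have "(\<Sum>i<length vs. c i *s vs ! i) = 0" using y(2) by (metis bij_is_inj injD)
    then show "\<forall>i<length (map y vs). c i = 0" using ordered_basis_independent[OF vs] by simp
  qed
qed

text \<open>Provides the model form on the given space against which an anisotropic form is
  compared.\<close>

lemma form_with_gram_exists:
  assumes M: "M \<in> carrier_mat (length vs) (length vs)"
  obtains g where "bilinear_form scale g" "gram_matrix scale g vs = M"
proof -
  define g where "g x y = (\<Sum>i<length vs. \<Sum>j<length vs. coord vs x i * M $$ (i, j) * coord vs y j)" for x y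
  have "bilinear_form scale g"
    unfolding bilinear_form_def Vector_Spaces.linear_iff
    by (auto simp: vector_space_axioms vector_space_mult g_def coord_add coord_scale algebra_simps
        sum.distrib sum_distrib_left)
  moreover have "gram_matrix scale g vs = M"
  proof (rule eq_matI)
    fix i j assume "i < dim_row M" "j < dim_col M"
    then have ij: "i < length vs" "j < length vs" using M by auto
    have "g (vs ! i) (vs ! j) =
        (\<Sum>i'<length vs. \<Sum>j'<length vs. if j' = j then (if i' = i then M $$ (i, j) else 0) else 0)"
      unfolding g_def using ij by (intro sum.cong) (auto simp: coord_basis)
    also have "\<dots> = M $$ (i, j)" using ij by (simp add: sum.delta)
    finally show "gram_matrix scale g vs $$ (i, j) = M $$ (i, j)" using ij by (simp add: gram_matrix_def)
  qed (use M in \<open>auto simp: gram_matrix_def\<close>)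
  ultimately show ?thesis by (rule that)
qed

end

lemma has_gram_matrix_equivalent:
  assumes "equivalent_forms scale scale f g" "has_gram_matrix scale g M"
  shows "has_gram_matrix scale f M"
proof -
  obtain x where x: "Vector_Spaces.linear scale scale x" "bij x" "\<And>u v. g (x u) (x v) = f u v"
    using assms(1) unfolding equivalent_forms_def by blast
  obtain vs where vs: "ordered_basis scale vs" "gram_matrix scale g vs = M"
    using assms(2) unfolding has_gram_matrix_def by blast
  have lin: "Vector_Spaces.linear scale scale (inv_into UNIV x)"
    using inj_linear_imp_inv_linear[OF x(1)] x(2) by (simp add: bij_is_inj)
  have "gram_matrix scale f (map (inv_into UNIV x) vs) = M"
    unfolding vs(2)[symmetric] gram_matrix_def
    by (rule eq_matI) (simp_all add: x(3)[symmetric] bij_is_surj[OF x(2)] surj_f_inv_f)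
  moreover have "ordered_basis scale (map (inv_into UNIV x) vs)"
    using ordered_basis_map[OF vs(1) lin] x(2) by (simp add: bij_imp_bij_inv)
  ultimately show ?thesis unfolding has_gram_matrix_def by blast
qed

end

lemma (in fd_bilinear) f_expand:
  "f (\<Sum>i\<in>A. c i *s x i) (\<Sum>j\<in>B. d j *s y j) = (\<Sum>i\<in>A. \<Sum>j\<in>B. c i * d j * f (x i) (y j))"
  by (simp only: f_lsum f_lscale) (simp only: f_rsum f_rscale sum_distrib_left mult.assoc)

lemma (in finite_dimensional_vector_space) equivalent_if_same_gram:
  assumes f: "bilinear_form scale f" "has_gram_matrix scale f M"
    and g: "bilinear_form scale g" "has_gram_matrix scale g M"
  shows "equivalent_forms scale scale f g"
proof -
  interpret f: fd_bilinear scale Basis f by unfold_locales (rule f)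
  interpret g: fd_bilinear scale Basis g by unfold_locales (rule g)
  obtain vs where vs: "ordered_basis scale vs" "gram_matrix scale f vs = M"
    using f(2) unfolding has_gram_matrix_def by blast
  obtain ws where ws: "ordered_basis scale ws" "gram_matrix scale g ws = M"
    using g(2) unfolding has_gram_matrix_def by blast
  have len: "length ws = length vs"
    using ordered_basis_length[OF vs(1)] ordered_basis_length[OF ws(1)] by simp
  have eq: "f (vs ! i) (vs ! j) = g (ws ! i) (ws ! j)" if "i < length vs" "j < length vs" for i j
  proof -
    have "gram_matrix scale f vs $$ (i, j) = gram_matrix scale g ws $$ (i, j)" using vs(2) ws(2) by simp
    then show ?thesis using that len by (simp add: gram_matrix_def)
  qed
  define x where "x z = (\<Sum>i<length vs. coord vs z i *s ws ! i)" for z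
  have lin: "Vector_Spaces.linear scale scale x"
    unfolding Vector_Spaces.linear_iff x_def
    by (simp add: vector_space_axioms coord_add[OF vs(1)] coord_scale[OF vs(1)] scale_left_distrib
        sum.distrib scale_sum_right)
  interpret x: Vector_Spaces.linear scale scale x by (rule lin)
  have "inj x" unfolding x.inj_iff_eq_0
  proof (intro allI impI)
    fix z assume "x z = 0"
    then have "coord vs z i = 0" if "i < length vs" for i
      using ordered_basis_independent[OF ws(1), of "coord vs z" i] that unfolding x_def len by simp
    then show "z = 0" using coord_sum[OF vs(1), of z] by simp
  qed
  then have "bij x" using linear_inj_imp_surj[OF lin] by (simp add: bij_def)
  moreover have "g (x u) (x v) = f u v" for u v
  proof -
    have "g (x u) (x v) = f (\<Sum>i<length vs. coord vs u i *s vs ! i) (\<Sum>i<length vs. coord vs v i *s vs ! i)"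
      unfolding x_def f.f_expand g.f_expand using eq by simp
    then show ?thesis by (simp add: coord_sum[OF vs(1)])
  qed
  ultimately show ?thesis using lin unfolding equivalent_forms_def by blast
qed

lemma (in fd_bilinear) fd_form_exists:
  assumes nondeg
  obtains t where "fd_form scale Basis f (asymmetry scale f) t"
proof -
  obtain \<sigma> where \<sigma>: "\<sigma> \<in> general_linear scale" "\<And>u v. f v u = f u (\<sigma> v)"
    using asymmetry_exists[OF assms] by blast
  have eq: "asymmetry scale f = \<sigma>" by (rule asymmetry_eqI[OF assms \<sigma>])
  have lin: "Vector_Spaces.linear scale scale \<sigma>" and bij: "bij \<sigma>" using \<sigma>(1) by (auto simp: general_linear_def)
  interpret e: fd_endo scale Basis \<sigma>
    by (intro fd_endo.intro fd_endo_axioms.intro finite_dimensional_vector_space_axioms lin)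
  have inj: "\<sigma> x = 0 \<Longrightarrow> x = 0" for x using bij e.sigma.zero by (metis bij_is_inj injD)
  obtain t where "\<And>x. \<sigma> (e.P t x) = x" by (rule e.inverse_polynomial[OF inj]) (assumption, rule that)
  then have "fd_form scale Basis f \<sigma> t" using assms \<sigma>(2) by unfold_locales
  then show ?thesis using that eq by blast
qed

section \<open>Elementary divisors and annihilators\<close>

context fd_endo
begin

text \<open>Bridge from the module presentation to annihilators: putting the same q at every
  position of the kernel condition tests q on all generators at once.\<close>

lemma elementary_divisors_annihilator:
  assumes "has_elementary_divisors scale \<sigma> D"
  shows "(\<forall>v. P q v = 0) \<longleftrightarrow> (\<forall>d\<in>#D. d dvd q)"
proof -
  obtain ds vs where ds: "mset ds = D" "\<And>v. \<exists>ps. v = (\<Sum>i<length ds. P (ps i) (vs ! i))"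
    "\<And>ps. (\<Sum>i<length ds. P (ps i) (vs ! i)) = 0 \<longleftrightarrow> (\<forall>i<length ds. ds ! i dvd ps i)"
    using assms unfolding has_elementary_divisors_def by blast
  show ?thesis
  proof
    assume q: "\<forall>v. P q v = 0"
    show "\<forall>d\<in>#D. d dvd q"
    proof
      fix d assume "d \<in># D"
      then obtain i where i: "i < length ds" "ds ! i = d" using ds(1) by (metis in_set_conv_nth set_mset_mset)
      have "(\<Sum>i<length ds. P q (vs ! i)) = 0" using q by simp
      then show "d dvd q" using ds(3)[of "\<lambda>_. q"] i by blast
    qed
  next
    assume d: "\<forall>d\<in>#D. d dvd q"
    have dvd: "ds ! i dvd q" if "i < length ds" for i using d ds(1) nth_mem_mset[OF that] by auto
    show "\<forall>v. P q v = 0"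
    proof
      fix v
      obtain ps where v: "v = (\<Sum>i<length ds. P (ps i) (vs ! i))" using ds(2) by blast
      have "P q v = (\<Sum>i<length ds. P (q * ps i) (vs ! i))" unfolding v by (simp only: P.sum P_mult)
      also have "\<dots> = 0" unfolding ds(3) using dvd by (auto intro: dvd_mult2)
      finally show "P q v = 0" .
    qed
  qed
qed

lemma chain_elementary_divisors:
  assumes "chain a k u" "cyc u = UNIV"
  shows "has_elementary_divisors scale \<sigma> {# [:-a, 1:] ^ Suc k #}"
  unfolding has_elementary_divisors_def
proof (intro conjI ballI exI)
  show "irreducible [:-a, 1:]" by (rule irreducible_linear_field_poly) simp
  show "mset [[:-a, 1:] ^ Suc k] = {# [:-a, 1:] ^ Suc k #}" by simp
  show "length [u] = length [[:-a, 1:] ^ Suc k]" by simp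
  show "\<forall>v. \<exists>ps. v = (\<Sum>i<length [[:-a, 1:] ^ Suc k]. P (ps i) ([u] ! i))"
  proof
    fix v
    have "v \<in> cyc u" using assms(2) by simp
    then obtain p where "v = P p u" by (rule cycE)
    then show "\<exists>ps. v = (\<Sum>i<length [[:-a, 1:] ^ Suc k]. P (ps i) ([u] ! i))"
      by (intro exI[of _ "\<lambda>_. p"]) simp
  qed
  show "\<forall>ps. (\<Sum>i<length [[:-a, 1:] ^ Suc k]. P (ps i) ([u] ! i)) = 0 \<longleftrightarrow>
    (\<forall>i<length [[:-a, 1:] ^ Suc k]. [[:-a, 1:] ^ Suc k] ! i dvd ps i)"
    using chain_ann_iff[OF assms(1)] by (simp del: power_Suc)
  show "d = [:-a, 1:] ^ Suc k" if "d \<in># {# [:-a, 1:] ^ Suc k #}" for d using that by simp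
qed simp_all

lemma two_chains_elementary_divisors:
  assumes u: "chain a k u" and v: "chain b k v"
    and full: "\<And>x. \<exists>y z. x = y + z \<and> y \<in> cyc u \<and> z \<in> cyc v"
    and direct: "\<And>y z. y \<in> cyc u \<Longrightarrow> z \<in> cyc v \<Longrightarrow> y + z = 0 \<Longrightarrow> y = 0"
  shows "has_elementary_divisors scale \<sigma> {# [:-a, 1:] ^ Suc k, [:-b, 1:] ^ Suc k #}"
  unfolding has_elementary_divisors_def
proof (intro conjI ballI exI)
  let ?ds = "[[:-a, 1:] ^ Suc k, [:-b, 1:] ^ Suc k]"
  show "irreducible [:-c, 1:]" for c :: 'a by (rule irreducible_linear_field_poly) simp
  show "mset ?ds = {# [:-a, 1:] ^ Suc k, [:-b, 1:] ^ Suc k #}" by simp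
  show "length [u, v] = length ?ds" by simp
  have len: "length ?ds = Suc (Suc 0)" by simp
  show "\<forall>x. \<exists>ps. x = (\<Sum>i<length ?ds. P (ps i) ([u, v] ! i))"
  proof
    fix x
    obtain y z where x: "x = y + z" and yz: "y \<in> cyc u" "z \<in> cyc v" using full by blast
    obtain p where p: "y = P p u" using yz(1) by (rule cycE)
    obtain q where q: "z = P q v" using yz(2) by (rule cycE)
    show "\<exists>ps. x = (\<Sum>i<length ?ds. P (ps i) ([u, v] ! i))"
      by (rule exI[of _ "\<lambda>i. if i = 0 then p else q"]) (simp add: x p q)
  qed
  show "\<forall>ps. (\<Sum>i<length ?ds. P (ps i) ([u, v] ! i)) = 0 \<longleftrightarrow> (\<forall>i<length ?ds. ?ds ! i dvd ps i)"
  proof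
    fix ps :: "nat \<Rightarrow> 'a poly"
    have "P (ps 0) u + P (ps 1) v = 0 \<longleftrightarrow> P (ps 0) u = 0 \<and> P (ps 1) v = 0"
      using direct[of "P (ps 0) u" "P (ps 1) v"] by auto
    also have "\<dots> \<longleftrightarrow> [:-a, 1:] ^ Suc k dvd ps 0 \<and> [:-b, 1:] ^ Suc k dvd ps 1"
      by (simp only: chain_ann_iff[OF u] chain_ann_iff[OF v])
    finally show "(\<Sum>i<length ?ds. P (ps i) ([u, v] ! i)) = 0 \<longleftrightarrow> (\<forall>i<length ?ds. ?ds ! i dvd ps i)"
      unfolding len All_less_Suc2 by (simp del: power_Suc)
  qed
  \<comment> \<open>One expression must serve as the irreducible factor for both divisors, hence the
    conditional inside it.\<close>
  fix d assume "d \<in># {# [:-a, 1:] ^ Suc k, [:-b, 1:] ^ Suc k #}"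
  then show "d = [:-(if d = [:-a, 1:] ^ Suc k then a else b), 1:] ^ Suc k" by (auto simp del: power_Suc)
qed simp_all

lemma splits_prod_linear: "splits (\<Prod>a\<leftarrow>as. [:-a, 1:] :: 'a poly)"
  unfolding splits_def by (rule exI[of _ 1], rule exI[of _ as]) simp

text \<open>The minimal polynomial is the least common multiple of the divisors. Working with the
  underlying set and allowing a = b covers a single block and two equal blocks as well.\<close>

lemma splits_two_powers:
  assumes D: "has_elementary_divisors scale \<sigma> D" and D': "set_mset D = {[:-a, 1:] ^ m, [:-b, 1:] ^ m}"
  shows "splits (minimal_polynomial scale \<sigma>)"
proof -
  have pow: "[:-c, 1:] ^ m = (\<Prod>a\<leftarrow>replicate m c. [:-a, 1:])" for c :: 'a
    by (induction m) simp_all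
  have monic: "lead_coeff ([:-c, 1:] ^ m) = 1" for c :: 'a by (simp add: lead_coeff_power)
  have ann: "(\<forall>v. P q v = 0) \<longleftrightarrow> [:-a, 1:] ^ m dvd q \<and> [:-b, 1:] ^ m dvd q" for q
    unfolding elementary_divisors_annihilator[OF D] D' by simp
  show ?thesis
  proof (cases "a = b")
    case True
    have "minimal_polynomial scale \<sigma> = [:-a, 1:] ^ m"
      by (rule minimal_polynomial_eqI[OF monic]) (simp only: ann True simp_thms)
    then show ?thesis unfolding pow by (simp only: splits_prod_linear)
  next
    case False
    obtain r s where rs: "r * [:-a, 1:] ^ m + s * [:-b, 1:] ^ m = 1" by (rule comaximal_linear[OF False])
    have "minimal_polynomial scale \<sigma> = [:-a, 1:] ^ m * [:-b, 1:] ^ m"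
    proof (rule minimal_polynomial_eqI)
      show "lead_coeff ([:-a, 1:] ^ m * [:-b, 1:] ^ m) = 1" by (simp only: lead_coeff_mult monic mult_1_right)
      fix q
      show "(\<forall>v. P q v = 0) \<longleftrightarrow> [:-a, 1:] ^ m * [:-b, 1:] ^ m dvd q"
        unfolding ann
      proof
        assume d: "[:-a, 1:] ^ m dvd q \<and> [:-b, 1:] ^ m dvd q"
        have "q = (r * [:-a, 1:] ^ m + s * [:-b, 1:] ^ m) * q" by (simp only: rs mult_1_left)
        also have "\<dots> = r * ([:-a, 1:] ^ m * q) + s * (q * [:-b, 1:] ^ m)"
          by (simp only: distrib_right mult.assoc mult.commute[of q "[:-b, 1:] ^ m"])
        finally have q: "q = r * ([:-a, 1:] ^ m * q) + s * (q * [:-b, 1:] ^ m)" .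
        have d': "[:-a, 1:] ^ m * [:-b, 1:] ^ m dvd [:-a, 1:] ^ m * q"
          "[:-a, 1:] ^ m * [:-b, 1:] ^ m dvd q * [:-b, 1:] ^ m"
          using d by (auto intro: mult_dvd_mono)
        have "[:-a, 1:] ^ m * [:-b, 1:] ^ m dvd r * ([:-a, 1:] ^ m * q) + s * (q * [:-b, 1:] ^ m)"
          by (rule dvd_add[OF dvd_mult[OF d'(1)] dvd_mult[OF d'(2)]])
        then show "[:-a, 1:] ^ m * [:-b, 1:] ^ m dvd q" by (simp only: q[symmetric])
      next
        assume "[:-a, 1:] ^ m * [:-b, 1:] ^ m dvd q"
        then show "[:-a, 1:] ^ m dvd q \<and> [:-b, 1:] ^ m dvd q" by (auto elim: dvd_mult_left dvd_mult_right)
      qed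
    qed
    moreover have "[:-a, 1:] ^ m * [:-b, 1:] ^ m = (\<Prod>a\<leftarrow>replicate m a @ replicate m b. [:-a, 1:])"
      unfolding pow by simp
    ultimately show ?thesis by (simp only: splits_prod_linear)
  qed
qed

lemma nilpotent_reaches_kernel:
  assumes "P ([:-a, 1:] ^ m) x = 0" "x \<noteq> 0"
  obtains j where "P ([:-a, 1:] ^ j) x \<noteq> 0" "\<sigma> (P ([:-a, 1:] ^ j) x) = a *s P ([:-a, 1:] ^ j) x"
proof -
  define l where "l = (LEAST m. P ([:-a, 1:] ^ m) x = 0)"
  have l: "P ([:-a, 1:] ^ l) x = 0" unfolding l_def by (rule LeastI[of _ m]) (rule assms(1))
  have "l \<noteq> 0" using l assms(2) by (intro notI) simp
  then obtain j where j: "l = Suc j" by (cases l) auto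
  have "P ([:-a, 1:] ^ j) x \<noteq> 0"
    using not_less_Least[of j "\<lambda>m. P ([:-a, 1:] ^ m) x = 0"] j unfolding l_def by simp
  then show ?thesis using that chain_bottom_eigen l unfolding j by blast
qed

end

section \<open>Indecomposability read off from Jordan chains\<close>

context fd_form
begin

text \<open>Both components of w are killed by (X - c)^(k+1). If neither were 0, each would lead to
  an eigenvector in its own summand; but the eigenspace is the line through the bottom of w, and the
  summands meet in 0.\<close>

lemma chain_in_summand:
  assumes o: "orthogonal_sum scale f U W" and w: "chain c k w"
    and eig: "\<And>y. \<sigma> y = c *s y \<Longrightarrow> \<exists>d. y = d *s P ([:-c, 1:] ^ k) w"
  shows "w \<in> U \<or> w \<in> W"
proof -
  have sub: "subspace U" "subspace W" and int: "U \<inter> W = {0}" using o by (auto simp: orthogonal_sum_def)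
  obtain x y where xy: "w = x + y" "x \<in> U" "y \<in> W" using o unfolding orthogonal_sum_def by blast
  have UP: "P p x \<in> U" and WP: "P p y \<in> W" for p
    using subspace_P[OF sub(1) orthogonal_sum_sigma(1)[OF o]] subspace_P[OF sub(2) orthogonal_sum_sigma(2)[OF o]] xy
    by blast+
  have "P ([:-c, 1:] ^ Suc k) x = - P ([:-c, 1:] ^ Suc k) y"
    using w unfolding chain_def xy P_vadd by (simp only: eq_neg_iff_add_eq_0)
  then have "P ([:-c, 1:] ^ Suc k) x \<in> U \<inter> W"
    using UP WP subspace_neg[OF sub(2)] by (metis IntI)
  then have 0: "P ([:-c, 1:] ^ Suc k) x = 0" "P ([:-c, 1:] ^ Suc k) y = 0"
    using int \<open>_ = - _\<close> by auto
  show ?thesis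
  proof (rule ccontr)
    assume "\<not> ?thesis"
    then have "x \<noteq> 0" "y \<noteq> 0" using xy sub by auto
    let ?E = "P ([:-c, 1:] ^ k) w"
    obtain i where i: "P ([:-c, 1:] ^ i) x \<noteq> 0" "\<sigma> (P ([:-c, 1:] ^ i) x) = c *s P ([:-c, 1:] ^ i) x"
      by (rule nilpotent_reaches_kernel[OF 0(1) \<open>x \<noteq> 0\<close>])
    obtain j where j: "P ([:-c, 1:] ^ j) y \<noteq> 0" "\<sigma> (P ([:-c, 1:] ^ j) y) = c *s P ([:-c, 1:] ^ j) y"
      by (rule nilpotent_reaches_kernel[OF 0(2) \<open>y \<noteq> 0\<close>])
    obtain d1 where d1: "P ([:-c, 1:] ^ i) x = d1 *s ?E" using eig[OF i(2)] by blast
    obtain d2 where d2: "P ([:-c, 1:] ^ j) y = d2 *s ?E" using eig[OF j(2)] by blast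
    have "d1 \<noteq> 0" "d2 \<noteq> 0" using d1 d2 i j by auto
    have "d1 *s ?E \<in> U" "d2 *s ?E \<in> W"
      using UP[of "[:-c, 1:] ^ i"] WP[of "[:-c, 1:] ^ j"] by (simp_all only: d1 d2)
    then have "inverse d1 *s (d1 *s ?E) \<in> U" "inverse d2 *s (d2 *s ?E) \<in> W"
      by (simp_all only: subspace_scale sub)
    then have "?E \<in> U \<inter> W" using \<open>d1 \<noteq> 0\<close> \<open>d2 \<noteq> 0\<close> by simp
    then show False using int w by (auto simp: chain_def)
  qed
qed

lemma chain_indecomposable:
  assumes c: "chain a k u" and full: "cyc u = UNIV"
  shows "indecomposable scale f"
  unfolding indecomposable_def
proof (intro allI impI)
  fix U W assume o: "orthogonal_sum scale f U W"
  then have sub: "subspace U" "subspace W" and int: "U \<inter> W = {0}" by (auto simp: orthogonal_sum_def)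
  have "u \<in> U \<or> u \<in> W"
    by (rule chain_in_summand[OF o c]) (use chain_kernel[OF c] full in blast)
  moreover have all: "S = UNIV" if "subspace S" "\<And>x. x \<in> S \<Longrightarrow> \<sigma> x \<in> S" "u \<in> S" for S
  proof -
    have "cyc u \<subseteq> S" using subspace_P[OF that] by (auto elim!: cycE)
    then show ?thesis using full by blast
  qed
  ultimately have "U = UNIV \<or> W = UNIV"
    using all[OF sub(1) orthogonal_sum_sigma(1)[OF o]] all[OF sub(2) orthogonal_sum_sigma(2)[OF o]]
    by blast
  then show "U = {0} \<or> W = {0}" using int by auto
qed

lemma P_t_inj: "P (t ^ i) x = 0 \<Longrightarrow> x = 0"
  by (induction i) (auto simp: P_mult dest: arg_cong[of "P t _" 0 \<sigma>] simp: sigma_t)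

context
  fixes a b k u v
  assumes hp: "hyp_pair a k u v" and ab: "a * b = 1"
    and full: "\<And>x. \<exists>y z. x = y + z \<and> y \<in> cyc u \<and> z \<in> cyc v"
begin

text \<open>By \<open>adjoint_factor_inverse\<close> the adjoint of \<sigma> - a is, up to a unit,
  \<sigma> - b, so the second generator is the top of a Jordan chain for b.\<close>

lemma hyp_pair_chain_right: "chain b k v"
proof -
  have ba: "b * a = 1" using ab by (simp add: mult.commute)
  have a: "(- a) ^ i \<noteq> 0" for i using ab by auto
  note eq = adjoint_factor_inverse[OF ba]
  have "P ([:-b, 1:] ^ Suc k) v = 0"
    using hp a[of "Suc k"] P_t_inj[of "Suc k"] unfolding hyp_pair_def eq scale_eq_0_iff by blast
  moreover have "P ([:-b, 1:] ^ k) v \<noteq> 0"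
  proof
    assume "P ([:-b, 1:] ^ k) v = 0"
    then have "f v (P ([:-a, 1:] ^ k) u) = 0" unfolding adj' pcompose_factor_power eq by simp
    then show False using hp by (simp add: hyp_pair_def)
  qed
  ultimately show ?thesis by (simp add: chain_def)
qed

lemma hyp_pair_direct: "y \<in> cyc u \<Longrightarrow> z \<in> cyc v \<Longrightarrow> y + z = 0 \<Longrightarrow> y = 0"
proof (rule hyp_pair_reach[OF hp])
  fix i assume "z \<in> cyc v" "y + z = 0"
  then have "y = - z" by (simp add: eq_neg_iff_add_eq_0)
  then show "f v (P ([:-a, 1:] ^ i) y) = 0"
    using hp cyc_P[OF \<open>z \<in> cyc v\<close>] by (simp add: P.neg f_rminus hyp_pair_def)
qed

lemma hyp_pair_elementary_divisors:
  "has_elementary_divisors scale \<sigma> {# [:-a, 1:] ^ Suc k, [:-b, 1:] ^ Suc k #}"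
  by (rule two_chains_elementary_divisors[OF hyp_pair_chain[OF hp] hyp_pair_chain_right full hyp_pair_direct])

lemma hyp_pair_eigen:
  assumes "\<sigma> x = c *s x" "x = y + z" "y \<in> cyc u" "z \<in> cyc v"
  shows "\<sigma> y = c *s y" "\<sigma> z = c *s z"
proof -
  have "(\<sigma> y - c *s y) + (\<sigma> z - c *s z) = 0"
    using assms(1) unfolding assms(2) by (simp add: sigma.add scale_right_distrib algebra_simps)
  moreover have "\<sigma> y - c *s y \<in> cyc u" "\<sigma> z - c *s z \<in> cyc v"
    using assms(3,4) by (auto intro!: subspace_diff subspace_scale subspace_cyc cyc_sigma)
  ultimately have "\<sigma> y - c *s y = 0" using hyp_pair_direct by blast
  then show "\<sigma> y = c *s y" "\<sigma> z = c *s z" using \<open>_ + _ = 0\<close> by auto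
qed

lemma foreign_eigen_zero:
  assumes w: "chain c k w" and x: "x \<in> cyc w" "\<sigma> x = d *s x" and cd: "c \<noteq> d"
  shows "x = 0"
proof -
  obtain p where p: "x = P p w" using x(1) by (rule cycE)
  have "P ([:-c, 1:] ^ Suc k) x = 0"
    using w unfolding p P_commute[of _ p] chain_def by (simp only: P.zero)
  moreover have "P ([:-c, 1:] ^ Suc k) x = (d - c) ^ Suc k *s x"
    unfolding P_eigen[OF x(2)] poly_power by simp
  ultimately have "(d - c) ^ Suc k = 0 \<or> x = 0" by (simp only: scale_eq_0_iff)
  then show ?thesis using cd by simp
qed

text \<open>For distinct eigenvalues each eigenspace is a line, so u and v each lie in one summand.
  It is the same summand because v pairs nontrivially with the bottom of u, and together they
  generate V.\<close>

lemma hyp_pair_indecomposable: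
  assumes neq: "a \<noteq> b"
  shows "indecomposable scale f"
  unfolding indecomposable_def
proof (intro allI impI)
  fix U W assume o: "orthogonal_sum scale f U W"
  then have sub: "subspace U" "subspace W" and int: "U \<inter> W = {0}"
    and orth: "\<And>x y. x \<in> U \<Longrightarrow> y \<in> W \<Longrightarrow> f x y = 0" "\<And>x y. x \<in> U \<Longrightarrow> y \<in> W \<Longrightarrow> f y x = 0"
    by (auto simp: orthogonal_sum_def)
  note cu = hyp_pair_chain[OF hp] and cv = hyp_pair_chain_right
  have PU: "P p x \<in> U" if "x \<in> U" for p x by (rule subspace_P[OF sub(1) orthogonal_sum_sigma(1)[OF o] that])
  have PW: "P p x \<in> W" if "x \<in> W" for p x by (rule subspace_P[OF sub(2) orthogonal_sum_sigma(2)[OF o] that])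
  have u: "u \<in> U \<or> u \<in> W"
  proof (rule chain_in_summand[OF o cu])
    fix x assume x: "\<sigma> x = a *s x"
    obtain y z where yz: "x = y + z" "y \<in> cyc u" "z \<in> cyc v" using full by blast
    note e = hyp_pair_eigen[OF x yz]
    have "z = 0" by (rule foreign_eigen_zero[OF cv yz(3) e(2)]) (use neq in blast)
    then show "\<exists>d. x = d *s P ([:-a, 1:] ^ k) u" using chain_kernel[OF cu yz(2) e(1)] yz(1) by auto
  qed
  have v: "v \<in> U \<or> v \<in> W"
  proof (rule chain_in_summand[OF o cv])
    fix x assume x: "\<sigma> x = b *s x"
    obtain y z where yz: "x = y + z" "y \<in> cyc u" "z \<in> cyc v" using full by blast
    note e = hyp_pair_eigen[OF x yz]
    have "y = 0" by (rule foreign_eigen_zero[OF cu yz(2) e(1)]) (use neq in blast)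
    then show "\<exists>d. x = d *s P ([:-b, 1:] ^ k) v" using chain_kernel[OF cv yz(3) e(2)] yz(1) by auto
  qed
  have top: "f v (P ([:-a, 1:] ^ k) u) \<noteq> 0" using hp by (simp add: hyp_pair_def)
  have all: "S = UNIV" if "subspace S" "\<And>p x. x \<in> S \<Longrightarrow> P p x \<in> S" "u \<in> S" "v \<in> S" for S
  proof -
    have "x \<in> S" for x
    proof -
      obtain y z where "x = y + z" "y \<in> cyc u" "z \<in> cyc v" using full by blast
      then show ?thesis using that by (auto elim!: cycE intro!: subspace_add)
    qed
    then show ?thesis by blast
  qed
  consider "u \<in> U" "v \<in> U" | "u \<in> W" "v \<in> W" | "u \<in> U" "v \<in> W" | "u \<in> W" "v \<in> U" using u v by blast
  then show "U = {0} \<or> W = {0}"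
  proof cases
    case 1
    then show ?thesis using all[OF sub(1) PU] int by auto
  next
    case 2
    then show ?thesis using all[OF sub(2) PW] int by auto
  next
    case 3
    then show ?thesis using orth(2) PU top by blast
  next
    case 4
    then show ?thesis using orth(1) PW top by blast
  qed
qed

text \<open>The source of the equivalence between the parameters a and 1/a. The new top pairing
  differs from the old one by powers of b, a sign and a factor a, since the bottom of u is an
  eigenvector.\<close>

lemma hyp_pair_swap: "hyp_pair b k v u"
proof -
  have ba: "b * a = 1" using ab by (simp add: mult.commute)
  have b: "(- b) ^ i \<noteq> 0" "a \<noteq> 0" for i using ab by auto
  let ?E = "P ([:-a, 1:] ^ k) u"
  have E: "\<sigma> ?E = a *s ?E" using hp by (intro chain_bottom_eigen) (simp add: hyp_pair_def)
  have tE: "P t ?E = b *s ?E"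
  proof -
    have "b *s ?E = b *s P t (\<sigma> ?E)" by (simp only: t_sigma)
    also have "\<dots> = P t ?E" unfolding E P_vscale scale_scale ba by simp
    finally show ?thesis by simp
  qed
  have tkE: "P (t ^ i) ?E = b ^ i *s ?E" for i
  proof (induction i)
    case (Suc i)
    have "P (t ^ Suc i) ?E = P t (P (t ^ i) ?E)" by (simp add: P_mult)
    then show ?case unfolding Suc P_vscale tE scale_scale by (simp add: mult.commute)
  qed simp
  have "f u (P ([:-b, 1:] ^ k) v) = (- b) ^ k * b ^ k * f ?E v"
    unfolding adj' pcompose_factor_power adjoint_factor_inverse[OF ab] tkE f_lscale by simp
  moreover have "f ?E v = a * f v ?E" unfolding asym[of ?E] E f_rscale ..
  ultimately have "f u (P ([:-b, 1:] ^ k) v) \<noteq> 0"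
    using hp b(1)[of k] b(2) ab by (auto simp: hyp_pair_def)
  moreover have "P (adjoint_factor b ^ Suc k) u = 0"
    unfolding adjoint_factor_inverse[OF ab] using hp by (simp only: hyp_pair_def P.zero scale_zero_right)
  ultimately show ?thesis
    using hp hyp_pair_chain_right unfolding hyp_pair_def chain_def by blast
qed

end
end

section \<open>The canonical Gram matrices\<close>

context unipotent_form
begin

text \<open>The kernel of \<open>\<sigma> - e\<close> has dimension 2. In an orthogonal decomposition, the alternating form \<open>h\<close>
  forces two independent kernel vectors into one summand, leaving none for the other.\<close>

lemma alternating_indecomposable:
  assumes hp: "hyp_pair e k u v" and par: "(- 1) ^ k * e = - 1"
    and full: "\<And>x. \<exists>y z. x = y + z \<and> y \<in> cyc u \<and> z \<in> cyc v"
  shows "indecomposable scale f"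
  unfolding indecomposable_def
proof (intro allI impI)
  fix U W assume o: "orthogonal_sum scale f U W"
  then have sub: "subspace U" "subspace W" and int: "U \<inter> W = {0}"
    and orth: "\<And>x y. x \<in> U \<Longrightarrow> y \<in> W \<Longrightarrow> f y x = 0"
    by (auto simp: orthogonal_sum_def)
  let ?N = "P ([:-e, 1:] ^ k)"
  have PU: "P p x \<in> U" if "x \<in> U" for p x by (rule subspace_P[OF sub(1) orthogonal_sum_sigma(1)[OF o] that])
  have PW: "P p x \<in> W" if "x \<in> W" for p x by (rule subspace_P[OF sub(2) orthogonal_sum_sigma(2)[OF o] that])
  note cu = hyp_pair_chain[OF hp] and cv = hyp_pair_chain_right[OF hp ee full]
  have skew: "h x y = - h y x" for x y using h_swap[of x y] par by simp
  \<comment> \<open>In characteristic 2 skewness alone does not give this; h vanishes on both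
    isotropic halves, and the cross terms cancel.\<close>
  have alt: "h x x = 0" for x
  proof -
    obtain y z where yz: "x = y + z" "y \<in> cyc u" "z \<in> cyc v" using full by blast
    have "h y y = 0" "h z z = 0" using hp yz cyc_P unfolding h_def hyp_pair_def by blast+
    then have "h x x = h y z + h z y" by (simp add: yz(1) h_def P_vadd f_lin)
    then show ?thesis using skew[of y z] by simp
  qed
  have ker: "\<exists>c d. x = c *s ?N u + d *s ?N v" if x: "\<sigma> x = e *s x" for x
  proof -
    obtain y z where yz: "x = y + z" "y \<in> cyc u" "z \<in> cyc v" using full by blast
    note eig = hyp_pair_eigen[OF hp ee full x yz]
    obtain c where "y = c *s ?N u" by (rule chain_kernel[OF cu yz(2) eig(1)])
    moreover obtain d where "z = d *s ?N v" by (rule chain_kernel[OF cv yz(3) eig(2)])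
    ultimately show ?thesis using yz(1) by blast
  qed
  show "U = {0} \<or> W = {0}"
  proof (rule ccontr)
    assume "\<not> ?thesis"
    then obtain x w where x: "x \<in> U" "x \<noteq> 0" and w: "w \<in> W" "w \<noteq> 0"
      using sub subspace_0 by blast
    obtain i where p: "P ([:-e, 1:] ^ i) x \<noteq> 0" "\<sigma> (P ([:-e, 1:] ^ i) x) = e *s P ([:-e, 1:] ^ i) x"
      by (rule nilpotent_reaches_kernel[OF nil x(2)])
    define p where "p = P ([:-e, 1:] ^ i) x"
    note p = p[folded p_def]
    have pU: "p \<in> U" unfolding p_def by (rule PU[OF x(1)])
    obtain j where q: "P ([:-e, 1:] ^ j) w \<noteq> 0" "\<sigma> (P ([:-e, 1:] ^ j) w) = e *s P ([:-e, 1:] ^ j) w"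
      by (rule nilpotent_reaches_kernel[OF nil w(2)])
    define q where "q = P ([:-e, 1:] ^ j) w"
    note q = q[folded q_def]
    have qW: "q \<in> W" unfolding q_def by (rule PW[OF w(1)])
    obtain p1 p2 where p12: "p = p1 *s ?N u + p2 *s ?N v" using ker[OF p(2)] by blast
    obtain q1 q2 where q12: "q = q1 *s ?N u + q2 *s ?N v" using ker[OF q(2)] by blast
    \<comment> \<open>A kernel vector p is N^k of a combination of u and v. Splitting that
      combination along U and W shows that p is N^k of a vector of U.\<close>
    obtain y y' where y: "p1 *s u + p2 *s v = y + y'" "y \<in> U" "y' \<in> W"
      using o unfolding orthogonal_sum_def by blast
    have "?N y + ?N y' = p" unfolding P_vadd[symmetric] y(1)[symmetric] p12 by (simp add: P_vadd P_vscale)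
    then have "?N y' = p - ?N y" by (simp add: algebra_simps)
    then have "?N y' \<in> U" by (simp only: subspace_diff[OF sub(1) pU PU[OF y(2)]])
    then have "?N y' \<in> U \<inter> W" using PW[OF y(3)] by blast
    then have Ny: "?N y = p" using int \<open>?N y + ?N y' = p\<close> by simp
    obtain z0 where "f z0 p \<noteq> 0" using p(1) nondegD[OF nondeg] by blast
    obtain z z' where z: "z0 = z + z'" "z \<in> U" "z' \<in> W" using o unfolding orthogonal_sum_def by blast
    have "f z p \<noteq> 0" using \<open>f z0 p \<noteq> 0\<close> orth[OF pU z(3)] by (simp add: z(1) f_ladd)
    then have hz: "h z y \<noteq> 0" by (simp add: h_def Ny)
    define p' where "p' = ?N z"
    have p'U: "p' \<in> U" unfolding p'_def by (rule PU[OF z(2)])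
    have "\<sigma> p' = e *s p'" unfolding p'_def by (rule chain_bottom_eigen[OF nil])
    then obtain p1' p2' where p12': "p' = p1' *s ?N u + p2' *s ?N v" using ker by blast
    \<comment> \<open>If p' were c p, then h(y,z) would be c h(y,y) = 0. So U contains two
      independent kernel vectors.\<close>
    have indep: "p' \<noteq> c *s p" for c
    proof
      assume "p' = c *s p"
      then have "h y z = c * h y y" unfolding h_def Ny p'_def[symmetric] by (simp add: f_rscale)
      then show False using hz skew[of y z] alt[of y] by simp
    qed
    \<comment> \<open>Cramer's rule in the kernel plane: \<open>?D\<close> times q is a combination
      of p and p', hence lies in U \<inter> W = 0. Thus \<open>?D\<close> = 0, against the
      independence of p and p'.\<close>
    let ?D = "p1 * p2' - p2 * p1'"
    have "(q1 * p2' - q2 * p1') *s p + (p1 * q2 - p2 * q1) *s p' = ?D *s q"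
    proof -
      have "(q1 * p2' - q2 * p1') *s p + (p1 * q2 - p2 * q1) *s p' =
        ((q1 * p2' - q2 * p1') * p1 + (p1 * q2 - p2 * q1) * p1') *s ?N u +
        ((q1 * p2' - q2 * p1') * p2 + (p1 * q2 - p2 * q1) * p2') *s ?N v"
        unfolding p12 p12' by (simp only: scale_right_distrib scale_scale scale_left_distrib add_ac)
      also have "(q1 * p2' - q2 * p1') * p1 + (p1 * q2 - p2 * q1) * p1' = ?D * q1" by (simp add: algebra_simps)
      also have "(q1 * p2' - q2 * p1') * p2 + (p1 * q2 - p2 * q1) * p2' = ?D * q2" by (simp add: algebra_simps)
      finally show ?thesis unfolding q12 by (simp only: scale_right_distrib scale_scale)
    qed
    then have "?D *s q \<in> U" using pU p'U sub(1) by (metis subspace_add subspace_scale)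
    then have "?D *s q = 0" using qW subspace_scale[OF sub(2)] int by blast
    then have D: "p1 * p2' = p2 * p1'" using q(1) by simp
    have "p1 \<noteq> 0 \<or> p2 \<noteq> 0" using p(1) unfolding p12 by auto
    then show False
    proof
      assume "p1 \<noteq> 0"
      then have "p2' = (p1' / p1) * p2" using D by (simp add: field_simps)
      then have "p' = (p1' / p1) *s p"
        unfolding p12 p12' using \<open>p1 \<noteq> 0\<close> by (simp add: scale_right_distrib)
      then show False using indep by blast
    next
      assume "p2 \<noteq> 0"
      then have "p1' = (p2' / p2) * p1" using D by (simp add: field_simps)
      then have "p' = (p2' / p2) *s p"
        unfolding p12 p12' using \<open>p2 \<noteq> 0\<close> by (simp add: scale_right_distrib)
      then show False using indep by blast
    qed
  qed
qed

end

section \<open>Reading the asymmetry off a Jordan Gram matrix\<close>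

text \<open>A basis adapted to the Gram matrix \<open>jordan_form_mat (Suc k) a\<close>.\<close>

locale jordan_gram = fd_bilinear scale Basis f
  for scale :: "'a::field \<Rightarrow> 'v::ab_group_add \<Rightarrow> 'v" (infixr "*s" 75) and Basis
    and f :: "'v \<Rightarrow> 'v \<Rightarrow> 'a" +
  fixes a :: 'a and k :: nat and x y :: "nat \<Rightarrow> 'v"
  assumes a: "a \<noteq> 0"
    and xx: "f (x i) (x j) = 0" and yy: "f (y i) (y j) = 0"
    and yx: "i \<le> k \<Longrightarrow> j \<le> k \<Longrightarrow> f (y i) (x j) = (if i = j then 1 else 0)"
    and xy: "i \<le> k \<Longrightarrow> j \<le> k \<Longrightarrow> f (x i) (y j) = (if i = j then a else if i = Suc j then 1 else 0)"
    and x0: "k < i \<Longrightarrow> x i = 0" and y0: "k < i \<Longrightarrow> y i = 0"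
    and spanning: "\<exists>c d. w = (\<Sum>i<Suc k. c i *s x i) + (\<Sum>j<Suc k. d j *s y j)"
begin

lemma zero_test_left: "(\<And>i. i \<le> k \<Longrightarrow> f (x i) z = 0) \<Longrightarrow> (\<And>i. i \<le> k \<Longrightarrow> f (y i) z = 0) \<Longrightarrow> f w z = 0"
proof -
  assume 0: "\<And>i. i \<le> k \<Longrightarrow> f (x i) z = 0" "\<And>i. i \<le> k \<Longrightarrow> f (y i) z = 0"
  obtain c d where w: "w = (\<Sum>i<Suc k. c i *s x i) + (\<Sum>j<Suc k. d j *s y j)" using spanning by blast
  show ?thesis unfolding w f_ladd f_lsum f_lscale using 0 by simp
qed

lemma zero_test_right: "(\<And>i. i \<le> k \<Longrightarrow> f z (x i) = 0) \<Longrightarrow> (\<And>i. i \<le> k \<Longrightarrow> f z (y i) = 0) \<Longrightarrow> f z w = 0"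
proof -
  assume 0: "\<And>i. i \<le> k \<Longrightarrow> f z (x i) = 0" "\<And>i. i \<le> k \<Longrightarrow> f z (y i) = 0"
  obtain c d where w: "w = (\<Sum>i<Suc k. c i *s x i) + (\<Sum>j<Suc k. d j *s y j)" using spanning by blast
  show ?thesis unfolding w f_radd f_rsum f_rscale using 0 by simp
qed

lemma jordan_nondeg: nondeg
  unfolding nondeg_def
proof (intro allI impI)
  fix w assume 0: "\<forall>z. f z w = 0"
  obtain c d where w: "w = (\<Sum>i<Suc k. c i *s x i) + (\<Sum>j<Suc k. d j *s y j)" using spanning by blast
  have c: "c i = 0" if "i \<le> k" for i
  proof -
    have "f (y i) w = (\<Sum>j<Suc k. if j = i then c i else 0)"
      unfolding w f_radd f_rsum f_rscale yy mult_zero_right sum.neutral_const add_0_right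
      using yx[OF that] by (intro sum.cong) auto
    then show ?thesis using 0 that by (simp add: sum.delta del: sum.lessThan_Suc)
  qed
  \<comment> \<open>The block f(x i, y j) is lower bidiagonal with diagonal a \<noteq> 0, so the
    coefficients vanish by forward substitution.\<close>
  have d: "d i = 0" if "i \<le> k" for i
    using that
  proof (induction i)
    case 0
    have "f (x 0) w = (\<Sum>j<Suc k. if j = 0 then a * d 0 else 0)"
      unfolding w f_radd f_rsum f_rscale xx mult_zero_right sum.neutral_const add_0_left
      using xy[of 0] by (intro sum.cong) auto
    then show ?case using \<open>\<forall>z. f z w = 0\<close> a by (simp add: sum.delta del: sum.lessThan_Suc)
  next
    case (Suc i)
    have "f (x (Suc i)) w = (\<Sum>j<Suc k. if j = Suc i then a * d (Suc i) else 0)"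
      unfolding w f_radd f_rsum f_rscale xx mult_zero_right sum.neutral_const add_0_left
      using xy[of "Suc i"] Suc by (intro sum.cong) auto
    then show ?case using 0 a Suc.prems by (simp add: sum.delta del: sum.lessThan_Suc)
  qed
  show "w = 0" unfolding w using c d by simp
qed

end

locale jordan_gram_form = jordan_gram scale Basis f a k x y + fd_form scale Basis f \<sigma> t
  for scale :: "'a::field \<Rightarrow> 'v::ab_group_add \<Rightarrow> 'v" (infixr "*s" 75) and Basis
    and f :: "'v \<Rightarrow> 'v \<Rightarrow> 'a" and a k x y \<sigma> t
begin

lemma sigma_x: "i \<le> k \<Longrightarrow> \<sigma> (x i) = a *s x i + (if i = 0 then 0 else x (i - 1))"
proof (rule right_eqI)
  fix z assume i: "i \<le> k"
  let ?w = "\<sigma> (x i) - (a *s x i + (if i = 0 then 0 else x (i - 1)))"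
  have "f z ?w = 0"
  proof (rule zero_test_left)
    fix j assume j: "j \<le> k"
    show "f (x j) ?w = 0" using xx by (simp add: f_lin flip: asym)
    show "f (y j) ?w = 0" using i j yx[of j] xy[of i j] by (auto simp: f_lin simp flip: asym)
  qed
  then show "f z (\<sigma> (x i)) = f z (a *s x i + (if i = 0 then 0 else x (i - 1)))" by (simp add: f_rdiff)
qed

lemma factor_x: "i \<le> k \<Longrightarrow> P [:-a, 1:] (x i) = (if i = 0 then 0 else x (i - 1))"
  by (simp add: P_linear_factor sigma_x del: P_pCons)

lemma factor_y: "i \<le> k \<Longrightarrow> P (adjoint_factor a) (y i) = y (Suc i)"
proof (rule left_eqI)
  fix z assume i: "i \<le> k"
  have "f (P (adjoint_factor a) (y i) - y (Suc i)) z = 0"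
  proof (rule zero_test_right)
    fix j assume j: "j \<le> k"
    have "f (P (adjoint_factor a) (y i)) (x j) = f (y (Suc i)) (x j)"
      unfolding adjoint_factor_def adj'[symmetric] factor_x[OF j]
      using yx[OF i, of "j - 1"] yx[of "Suc i" j] i j y0[of "Suc i"] by (cases "Suc i \<le> k") auto
    then show "f (P (adjoint_factor a) (y i) - y (Suc i)) (x j) = 0" by (simp add: f_ldiff)
    have "f (P (adjoint_factor a) (y i)) (y j) = 0"
      unfolding adjoint_factor_def adj'[symmetric] P_linear_factor by (simp add: f_lin yy flip: asym)
    then show "f (P (adjoint_factor a) (y i) - y (Suc i)) (y j) = 0" by (simp add: f_ldiff yy)
  qed
  then show "f (P (adjoint_factor a) (y i)) z = f (y (Suc i)) z" by (simp add: f_ldiff)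
qed

lemma factor_power_x: "i \<le> k \<Longrightarrow> P ([:-a, 1:] ^ i) (x k) = x (k - i)"
proof (induction i)
  case (Suc i)
  have "P ([:-a, 1:] ^ Suc i) (x k) = P [:-a, 1:] (P ([:-a, 1:] ^ i) (x k))" by (simp only: power_Suc P_mult)
  also have "\<dots> = P [:-a, 1:] (x (k - i))" using Suc by simp
  also have "\<dots> = x (k - Suc i)" using factor_x[of "k - i"] Suc.prems by simp
  finally show ?case .
qed simp

lemma factor_power_y: "P (adjoint_factor a ^ i) (y 0) = y i"
proof (induction i)
  case (Suc i)
  have "P (adjoint_factor a ^ Suc i) (y 0) = P (adjoint_factor a) (y i)" by (simp only: power_Suc P_mult Suc)
  then show ?case using factor_y[of i] y0[of i] y0[of "Suc i"] by (cases "i \<le> k") simp_all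
qed simp

lemma jordan_hyp_pair: "hyp_pair a k (x k) (y 0)"
  unfolding hyp_pair_def
proof (intro conjI ballI)
  have "P ([:-a, 1:] ^ Suc k) (x k) = P [:-a, 1:] (P ([:-a, 1:] ^ k) (x k))" by (simp only: power_Suc P_mult)
  also have "\<dots> = 0" using factor_power_x[of k] factor_x[of 0] by simp
  finally show u0: "P ([:-a, 1:] ^ Suc k) (x k) = 0" .
  show "P (adjoint_factor a ^ Suc k) (y 0) = 0" unfolding factor_power_y by (simp add: y0)
  show "f (y 0) (P ([:-a, 1:] ^ k) (x k)) \<noteq> 0" using factor_power_x[of k] yx[of 0 0] by simp
  show "f z w = 0" if zw: "z \<in> cyc (x k)" "w \<in> cyc (x k)" for z w
  proof -
    have *: "\<exists>c. z = (\<Sum>i<Suc k. c i *s x (k - i))" if z: "z \<in> cyc (x k)" for z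
    proof -
      obtain c where c: "z = (\<Sum>i<Suc k. c i *s P ([:-a, 1:] ^ i) (x k))" using cyc_sum[OF u0 z] by blast
      have "z = (\<Sum>i<Suc k. c i *s x (k - i))" unfolding c using factor_power_x by (intro sum.cong) auto
      then show ?thesis by blast
    qed
    obtain c where c: "z = (\<Sum>i<Suc k. c i *s x (k - i))" using *[OF zw(1)] by blast
    obtain d where d: "w = (\<Sum>i<Suc k. d i *s x (k - i))" using *[OF zw(2)] by blast
    show ?thesis unfolding c d f_expand by (simp add: xx)
  qed
  show "f z w = 0" if zw: "z \<in> cyc (y 0)" "w \<in> cyc (y 0)" for z w
  proof -
    \<comment> \<open>The y-chain is generated by the adjoint factor, so stability under \<sigma>^-1
      is the visible one. An injective map of this subspace into itself is onto, which yields
      stability under \<sigma>.\<close>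
    let ?T = "span (range y)"
    have Pt: "P t z \<in> ?T" if "z \<in> ?T" for z
      using that
    proof (induction rule: span_induct_alt)
      case (step c b z)
      then obtain i where b: "b = y i" by blast
      have "P t (y i) = y (Suc i) + a *s y i"
      proof (cases "i \<le> k")
        case True
        show ?thesis unfolding factor_y[OF True, symmetric] P_adjoint_factor by simp
      next
        case False
        then show ?thesis using y0[of i] y0[of "Suc i"] by simp
      qed
      moreover have "y (Suc i) + a *s y i \<in> ?T" by (intro span_add span_scale span_base rangeI)
      ultimately have "P t (y i) \<in> ?T" by (simp only:)
      then show ?case unfolding b P_vadd P_vscale using step.IH by (intro span_add span_scale)
    qed (simp add: span_zero)
    have "P t ` ?T = ?T"
    proof (rule linear_stable_eqI[OF P_linear subspace_span])
      show "P t ` ?T \<subseteq> ?T" using Pt by blast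
      show "z = 0" if "P t z = 0" for z using P_t_inj[of 1 z] that by simp
    qed
    then have "\<sigma> z \<in> ?T" if "z \<in> ?T" for z using that sigma_t by (metis imageE)
    then have "P p (y 0) \<in> ?T" for p by (rule subspace_P[OF subspace_span]) (auto intro: span_base)
    then have zw': "z \<in> ?T" "w \<in> ?T" using zw by (auto elim!: cycE)
    have "f (y i) w = 0" for i
      using zw'(2) by (induction rule: span_induct_alt) (auto simp: f_lin yy)
    then show ?thesis using f_zero_span[OF _ zw'(1)] by blast
  qed
qed

lemma jordan_full: "\<exists>z w. v = z + w \<and> z \<in> cyc (x k) \<and> w \<in> cyc (y 0)"
proof -
  obtain c d where v: "v = (\<Sum>i<Suc k. c i *s x i) + (\<Sum>j<Suc k. d j *s y j)" using spanning by blast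
  have "x i \<in> cyc (x k)" if "i \<le> k" for i
    using factor_power_x[of "k - i"] that cycI[of "[:-a, 1:] ^ (k - i)" "x k"] by simp
  then have "(\<Sum>i<Suc k. c i *s x i) \<in> cyc (x k)"
    by (intro subspace_sum subspace_scale subspace_cyc) auto
  moreover have "y j \<in> cyc (y 0)" for j
    using cycI[of "adjoint_factor a ^ j" "y 0"] by (simp only: factor_power_y)
  then have "(\<Sum>j<Suc k. d j *s y j) \<in> cyc (y 0)"
    by (intro subspace_sum subspace_scale subspace_cyc)
  ultimately show ?thesis using v by blast
qed

end

lemma (in fd_bilinear) jordan_gram_exists:
  assumes "has_gram_matrix scale f (jordan_form_mat (Suc k) a)" "a \<noteq> 0"
  obtains x y where "jordan_gram scale Basis f a k x y" "dim (UNIV :: 'v set) = 2 * Suc k"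
proof -
  obtain vs where vs: "ordered_basis scale vs" "gram_matrix scale f vs = jordan_form_mat (Suc k) a"
    using assms(1) unfolding has_gram_matrix_def by blast
  have len: "length vs = Suc k + Suc k"
    using arg_cong[OF vs(2), of dim_row]
    by (simp add: gram_matrix_def jordan_form_mat_def lower_jordan_block_def mat1_def)
  define x where "x i = (if i \<le> k then vs ! i else 0)" for i
  define y where "y i = (if i \<le> k then vs ! (Suc k + i) else 0)" for i
  have g: "f (vs ! i) (vs ! j) = jordan_form_mat (Suc k) a $$ (i, j)" if "i < Suc k + Suc k" "j < Suc k + Suc k" for i j
    using arg_cong[OF vs(2), of "\<lambda>M. M $$ (i, j)"] that by (simp add: gram_matrix_def len)
  have "jordan_gram scale Basis f a k x y"
  proof unfold_locales
    fix i j
    show "f (x i) (x j) = 0"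
      by (auto simp: x_def g jordan_form_mat_def lower_jordan_block_def mat1_def)
    show "f (y i) (y j) = 0"
      by (auto simp: y_def g jordan_form_mat_def lower_jordan_block_def mat1_def)
    show "f (y i) (x j) = (if i = j then 1 else 0)" if "i \<le> k" "j \<le> k"
      using that by (auto simp: x_def y_def g jordan_form_mat_def lower_jordan_block_def mat1_def)
    show "f (x i) (y j) = (if i = j then a else if i = Suc j then 1 else 0)" if "i \<le> k" "j \<le> k"
      using that by (auto simp: x_def y_def g jordan_form_mat_def lower_jordan_block_def mat1_def)
  next
    fix w
    obtain c where "w = (\<Sum>i<length vs. c i *s vs ! i)" by (rule ordered_basis_coords[OF vs(1)])
    moreover have "(\<Sum>i<Suc k. c i *s vs ! i) = (\<Sum>i<Suc k. c i *s x i)"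
      by (rule sum.cong) (auto simp: x_def)
    moreover have "(\<Sum>j<Suc k. c (Suc k + j) *s vs ! (Suc k + j)) = (\<Sum>j<Suc k. c (Suc k + j) *s y j)"
      by (rule sum.cong) (auto simp: y_def)
    ultimately have "w = (\<Sum>i<Suc k. c i *s x i) + (\<Sum>j<Suc k. c (Suc k + j) *s y j)"
      by (simp only: len sum_lessThan_add)
    then show "\<exists>c d. w = (\<Sum>i<Suc k. c i *s x i) + (\<Sum>j<Suc k. d j *s y j)"
      by (intro exI[of _ c] exI[of _ "\<lambda>j. c (Suc k + j)"])
  qed (simp_all add: assms x_def y_def)
  moreover have "dim (UNIV :: 'v set) = 2 * Suc k" using ordered_basis_length[OF vs(1)] len by simp
  ultimately show ?thesis by (rule that)
qed

section \<open>Anti-triangular Gram matrices and a single Jordan block\<close>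

text \<open>Gram matrices that vanish above the antidiagonal and for which \<open>\<sigma> - e\<close> shifts the basis
  down by exactly one step.\<close>

locale antitriangular_gram = fd_bilinear scale Basis f
  for scale :: "'a::field \<Rightarrow> 'v::ab_group_add \<Rightarrow> 'v" (infixr "*s" 75) and Basis
    and f :: "'v \<Rightarrow> 'v \<Rightarrow> 'a" +
  fixes e :: 'a and k :: nat and b :: "nat \<Rightarrow> 'v"
  assumes above: "i + j < k \<Longrightarrow> f (b i) (b j) = 0"
    and anti: "i + j = k \<Longrightarrow> f (b i) (b j) \<noteq> 0"
    and anti_swap: "i + j = k \<Longrightarrow> f (b j) (b i) = e * f (b i) (b j)"
    and below_swap: "i \<le> k \<Longrightarrow> j \<le> k \<Longrightarrow> i + j = Suc k \<Longrightarrow> f (b j) (b i) \<noteq> e * f (b i) (b j)"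
    and spanning: "\<exists>c. w = (\<Sum>i<Suc k. c i *s b i)"
begin

text \<open>Backward substitution along the antidiagonal: pairing with \<open>b (k - l)\<close> does
  not see indices below l, and those above l are settled by induction.\<close>

lemma anti_coeff_zero:
  assumes "\<And>i. i + m \<le> k \<Longrightarrow> f (b i) (\<Sum>l<Suc k. c l *s b l) = 0" "m \<le> l" "l \<le> k"
  shows "c l = 0"
  using assms(2,3)
proof (induction "k - l" arbitrary: l rule: less_induct)
  case less
  have "f (b (k - l)) (\<Sum>l<Suc k. c l *s b l) = (\<Sum>l'<Suc k. if l' = l then c l * f (b (k - l)) (b l) else 0)"
    unfolding f_rsum f_rscale
  proof (rule sum.cong[OF refl])
    fix l' assume "l' \<in> {..<Suc k}"
    consider "l' < l" | "l' = l" | "l' > l" by linarith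
    then show "c l' * f (b (k - l)) (b l') = (if l' = l then c l * f (b (k - l)) (b l) else 0)"
    proof cases
      case 1
      then show ?thesis using above[of "k - l" l'] less.prems by simp
    next
      case 3
      then show ?thesis using less.hyps[of l'] less.prems \<open>l' \<in> {..<Suc k}\<close> by simp
    qed simp
  qed
  also have "\<dots> = c l * f (b (k - l)) (b l)" using less.prems by (simp add: sum.delta)
  finally show ?case using assms(1)[of "k - l"] anti[of "k - l" l] less.prems by simp
qed

lemma antitriangular_nondeg: nondeg
  unfolding nondeg_def
proof (intro allI impI)
  fix w assume "\<forall>z. f z w = 0"
  moreover obtain c where w: "w = (\<Sum>i<Suc k. c i *s b i)" using spanning by blast
  ultimately have "c i = 0" if "i \<le> k" for i using anti_coeff_zero[of 0 c i] that by auto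
  then show "w = 0" unfolding w by simp
qed

end

locale antitriangular_form = antitriangular_gram scale Basis f e k b + fd_form scale Basis f \<sigma> t
  for scale :: "'a::field \<Rightarrow> 'v::ab_group_add \<Rightarrow> 'v" (infixr "*s" 75) and Basis
    and f :: "'v \<Rightarrow> 'v \<Rightarrow> 'a" and e k b \<sigma> t
begin

lemma f_factor: "f (b i) (P [:-e, 1:] (b j)) = f (b j) (b i) - e * f (b i) (b j)"
  by (simp only: P_linear_factor f_rdiff f_rscale asym[symmetric])

text \<open>f(b i, N (b j)) = f(b j, b i) - e f(b i, b j) with N = \<sigma> - e. It vanishes for i +
  j \<le> k, which removes the indices from j on; that it is nonzero for i + j = k + 1 makes the
  coefficient at j - 1 nonzero.\<close>

lemma factor_b:
  assumes "j \<le> k"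
  obtains c where "P [:-e, 1:] (b j) = (\<Sum>l<j. c l *s b l)" "\<And>l. j = Suc l \<Longrightarrow> c l \<noteq> 0"
proof -
  obtain c where c: "P [:-e, 1:] (b j) = (\<Sum>l<Suc k. c l *s b l)" using spanning by blast
  have 0: "c l = 0" if "j \<le> l" "l \<le> k" for l
  proof (rule anti_coeff_zero[OF _ that])
    fix i assume "i + j \<le> k"
    then show "f (b i) (\<Sum>l<Suc k. c l *s b l) = 0"
      unfolding c[symmetric] f_factor
      using above[of i j] above[of j i] anti_swap[of i j] by (cases "i + j = k") (auto simp: add.commute)
  qed
  have eq: "P [:-e, 1:] (b j) = (\<Sum>l<j. c l *s b l)"
    unfolding c using 0 assms by (intro sum.mono_neutral_right) auto
  have "c l \<noteq> 0" if l: "j = Suc l" for l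
  proof
    assume "c l = 0"
    let ?i = "k - l"
    have i: "?i \<le> k" "?i + j = Suc k" using l assms by auto
    have "f (b ?i) (P [:-e, 1:] (b j)) = 0"
      unfolding eq f_rsum f_rscale
    proof (rule sum.neutral, rule ballI)
      fix l' assume "l' \<in> {..<j}"
      then consider "l' = l" | "l' < l" using l by fastforce
      then show "c l' * f (b ?i) (b l') = 0"
        using \<open>c l = 0\<close> above[of ?i l'] assms l by cases auto
    qed
    then show False using below_swap[OF i(1) assms i(2)] unfolding f_factor by simp
  qed
  with eq show ?thesis using that by blast
qed

lemma factor_power_b:
  assumes "i \<le> k" "j \<le> k"
  shows "i + j < k + m \<Longrightarrow> f (b i) (P ([:-e, 1:] ^ m) (b j)) = 0"
    and "i + j = k + m \<Longrightarrow> f (b i) (P ([:-e, 1:] ^ m) (b j)) \<noteq> 0"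
  using assms(2)
proof (induction m arbitrary: j)
  case 0
  {
    case 1
    then show ?case using above by simp
  next
    case 2
    then show ?case using anti by simp
  }
next
  case (Suc m)
  have *: "P ([:-e, 1:] ^ Suc m) (b j) = P ([:-e, 1:] ^ m) (P [:-e, 1:] (b j))" for j
    by (simp only: power_Suc2 P_mult)
  {
    case (1 j)
    obtain c where c: "P [:-e, 1:] (b j) = (\<Sum>l<j. c l *s b l)" using factor_b[OF 1(2)] by blast
    have "c l * f (b i) (P ([:-e, 1:] ^ m) (b l)) = 0" if "l < j" for l
      using Suc.IH(1)[of l] 1 that by simp
    then show ?case unfolding * c P.sum P.scale f_rsum f_rscale by (simp add: sum.neutral)
  next
    case (2 j)
    then obtain l where l: "j = Suc l" using assms(1) by (cases j) auto
    obtain c where c: "P [:-e, 1:] (b j) = (\<Sum>l<j. c l *s b l)" "c l \<noteq> 0"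
      using factor_b[OF 2(2)] l by metis
    have "c l' * f (b i) (P ([:-e, 1:] ^ m) (b l')) = 0" if "l' < l" for l'
      using Suc.IH(1)[of l'] 2 that l by simp
    moreover have "f (b i) (P ([:-e, 1:] ^ m) (b l)) \<noteq> 0" using Suc.IH(2)[of l] 2 l by simp
    ultimately show ?case
      unfolding * c(1) P.sum P.scale f_rsum f_rscale unfolding l using c(2) by (simp add: sum.neutral)
  }
qed

lemma antitriangular_nil: "P ([:-e, 1:] ^ Suc k) v = 0"
proof -
  have "P ([:-e, 1:] ^ Suc k) (b j) = 0" if "j \<le> k" for j
  proof (rule right_eqI)
    fix z
    obtain c where z: "z = (\<Sum>i<Suc k. c i *s b i)" using spanning by blast
    have "f (b i) (P ([:-e, 1:] ^ Suc k) (b j)) = 0" if "i \<le> k" for i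
      using factor_power_b(1)[OF that \<open>j \<le> k\<close>, of "Suc k"] that \<open>j \<le> k\<close> by simp
    then show "f z (P ([:-e, 1:] ^ Suc k) (b j)) = f z 0"
      unfolding z f_lsum f_lscale by (simp del: power_Suc)
  qed
  moreover obtain c where v: "v = (\<Sum>i<Suc k. c i *s b i)" using spanning by blast
  ultimately show ?thesis unfolding v P.sum P.scale by (simp del: power_Suc)
qed

lemma antitriangular_top: "f (b k) (P ([:-e, 1:] ^ k) (b k)) \<noteq> 0"
  by (rule factor_power_b(2)) simp_all

end

text \<open>With indices from 0 the sign is (-1)^(k-i). Exchanging i and j multiplies it by (-1)^k
  when i + j = k, and by the opposite sign when i + j = k + 1; outside characteristic 2 these signs
  differ.\<close>

lemma (in fd_bilinear) Gamma_antitriangular: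
  assumes "has_gram_matrix scale f (Gamma_mat (Suc k))" "(2 :: 'a) \<noteq> 0"
  obtains b where "antitriangular_gram scale Basis f ((- 1) ^ k) k b" "dim (UNIV :: 'v set) = Suc k"
proof -
  obtain vs where vs: "ordered_basis scale vs" "gram_matrix scale f vs = Gamma_mat (Suc k)"
    using assms(1) unfolding has_gram_matrix_def by blast
  have len: "length vs = Suc k"
    using arg_cong[OF vs(2), of dim_row] by (simp add: gram_matrix_def Gamma_mat_def mat1_def)
  have g: "f (vs ! i) (vs ! j) = (if i + j = k \<or> i + j = Suc k then (- 1) ^ (k - i) else 0)"
    if "i \<le> k" "j \<le> k" for i j
    using arg_cong[OF vs(2), of "\<lambda>M. M $$ (i, j)"] that
    by (auto simp: gram_matrix_def len Gamma_mat_def mat1_def)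
  have sign: "(- 1 :: 'a) ^ k * (- 1) ^ (k - i) = (- 1) ^ i" if "i \<le> k" for i
  proof -
    have "(- 1 :: 'a) ^ k * (- 1) ^ (k - i) = (- 1) ^ (i + 2 * (k - i))"
      unfolding power_add[symmetric] using that by (intro arg_cong[of _ _ "power (- 1)"]) simp
    then show ?thesis by (simp add: power_add)
  qed
  have "antitriangular_gram scale Basis f ((- 1) ^ k) k ((!) vs)"
  proof unfold_locales
    fix i j
    show "f (vs ! i) (vs ! j) = 0" if "i + j < k" using that g[of i j] by simp
    show "f (vs ! i) (vs ! j) \<noteq> 0" if "i + j = k" using that g[of i j] by simp
    show "f (vs ! j) (vs ! i) = (- 1) ^ k * f (vs ! i) (vs ! j)" if "i + j = k"
    proof -
      have "k - j = i" using that by simp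
      then show ?thesis using that g[of i j] g[of j i] sign[of i] by (simp add: add.commute)
    qed
    show "f (vs ! j) (vs ! i) \<noteq> (- 1) ^ k * f (vs ! i) (vs ! j)" if "i \<le> k" "j \<le> k" "i + j = Suc k"
    proof -
      have "i = Suc (k - j)" using that by simp
      moreover have "(- 1 :: 'a) ^ m \<noteq> (- 1) ^ Suc m" for m
      proof
        assume "(- 1 :: 'a) ^ m = (- 1) ^ Suc m"
        then have "2 * (- 1 :: 'a) ^ m = 0" by simp
        then show False using assms(2) by simp
      qed
      ultimately show ?thesis using that g[of i j] g[of j i] sign[of i] by (simp add: add.commute)
    qed
  next
    show "\<exists>c. w = (\<Sum>i<Suc k. c i *s vs ! i)" for w
      using ordered_basis_coords[OF vs(1), of w] unfolding len by blast
  qed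
  moreover have "dim (UNIV :: 'v set) = Suc k" using ordered_basis_length[OF vs(1)] len by simp
  ultimately show ?thesis by (rule that)
qed

text \<open>Signs cannot distinguish an entry from its transpose in characteristic 2. Here, for i +
  j = k + 1 with k even, exactly one of i, j exceeds k/2, so one of the two entries is 1 and the
  other 0.\<close>

lemma (in fd_bilinear) Gamma0_antitriangular:
  assumes "has_gram_matrix scale f (Gamma0_mat (Suc k))" "even k"
  obtains b where "antitriangular_gram scale Basis f 1 k b" "dim (UNIV :: 'v set) = Suc k"
proof -
  obtain vs where vs: "ordered_basis scale vs" "gram_matrix scale f vs = Gamma0_mat (Suc k)"
    using assms(1) unfolding has_gram_matrix_def by blast
  have len: "length vs = Suc k"
    using arg_cong[OF vs(2), of dim_row] by (simp add: gram_matrix_def Gamma0_mat_def mat1_def)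
  have g: "f (vs ! i) (vs ! j) = (if i + j = k \<or> (i + j = Suc k \<and> k div 2 < i) then 1 else 0)"
    if "i \<le> k" "j \<le> k" for i j
    using arg_cong[OF vs(2), of "\<lambda>M. M $$ (i, j)"] that
    by (auto simp: gram_matrix_def len Gamma0_mat_def mat1_def)
  have "antitriangular_gram scale Basis f 1 k ((!) vs)"
  proof unfold_locales
    fix i j
    show "f (vs ! i) (vs ! j) = 0" if "i + j < k" using that g[of i j] by simp
    show "f (vs ! i) (vs ! j) \<noteq> 0" if "i + j = k" using that g[of i j] by simp
    show "f (vs ! j) (vs ! i) = 1 * f (vs ! i) (vs ! j)" if "i + j = k"
      using that g[of i j] g[of j i] by (simp add: add.commute)
    show "f (vs ! j) (vs ! i) \<noteq> 1 * f (vs ! i) (vs ! j)" if "i \<le> k" "j \<le> k" "i + j = Suc k"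
    proof -
      obtain m where "k = 2 * m" using assms(2) by (rule evenE)
      then have "k div 2 = m" "i + j = Suc (2 * m)" using that(3) by simp_all
      then have "k div 2 < i \<longleftrightarrow> \<not> k div 2 < j" by linarith
      moreover have "f (vs ! i) (vs ! j) = (if k div 2 < i then 1 else 0)"
        using that(3) unfolding g[OF that(1,2)] by simp
      moreover have "f (vs ! j) (vs ! i) = (if k div 2 < j then 1 else 0)"
        using that(3) unfolding g[OF that(2,1)] by (simp add: add.commute[of j])
      ultimately show ?thesis by simp
    qed
  next
    show "\<exists>c. w = (\<Sum>i<Suc k. c i *s vs ! i)" for w
      using ordered_basis_coords[OF vs(1), of w] unfolding len by blast
  qed
  moreover have "dim (UNIV :: 'v set) = Suc k" using ordered_basis_length[OF vs(1)] len by simp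
  ultimately show ?thesis by (rule that)
qed

section \<open>Classification\<close>

text \<open>The product of \<open>D\<close> is a common multiple of \<open>D\<close>, which
  transfers roots from one multiset to the other.\<close>

lemma common_root:
  assumes D: "\<And>q. (\<forall>d\<in>#D. d dvd q) \<Longrightarrow> (\<forall>d\<in>#D'. d dvd q)"
    and d': "d' \<in># D'" "poly d' c = 0"
  shows "\<exists>d\<in>#D. poly d (c :: 'a::field) = 0"
proof -
  have "\<forall>d\<in>#D. d dvd prod_mset D" by (auto intro: dvd_prod_mset)
  then have "d' dvd prod_mset D" using D d'(1) by blast
  then have "poly (prod_mset D) c = 0" using d'(2) by (auto elim!: dvdE)
  then show ?thesis by (induction D) auto
qed

lemma canonical_roots:
  assumes "admissible n t" "n \<ge> 1"
  shows "(\<exists>d\<in>#canonical_divisors n t. poly d c = 0) \<longleftrightarrow>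
    (case t of Mat_A \<Rightarrow> c = 1 | Mat_B \<Rightarrow> c = 1 | Mat_C \<Rightarrow> c = - 1 | Mat_D \<Rightarrow> c = 1 | Mat_E \<Rightarrow> c = 1
      | Mat_F \<Rightarrow> c = - 1 | Mat_G a \<Rightarrow> c = a \<or> c = inverse a)"
proof -
  have "- c = 1 \<longleftrightarrow> c = - 1" by (metis minus_minus)
  then show ?thesis using assms by (cases t) (auto simp: poly_power add_eq_0_iff2 add.commute)
qed

lemma lin_power_dvd_imp_le:
  fixes a :: "'a::field"
  assumes "[:a, 1:] ^ n dvd [:a, 1:] ^ m"
  shows "n \<le> m"
  using dvd_imp_degree_le[OF assms] by (simp add: degree_power_eq)

text \<open>Roots, the characteristic and the parities of n and n/2 separate all types except C and
  F. Those two share the root -1 and differ in the exponent, n against n/2.\<close>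

lemma canonical_divisors_unique:
  fixes t t' :: "'a::field canonical"
  assumes n: "n \<ge> 1" and t: "admissible n t" and t': "admissible n t'"
    and eq: "\<And>q. (\<forall>d\<in>#canonical_divisors n t. d dvd q) \<longleftrightarrow> (\<forall>d\<in>#canonical_divisors n t'. d dvd q)"
  shows "t = t' \<or> (\<exists>a. t = Mat_G a \<and> t' = Mat_G (inverse a))"
proof -
  have roots: "(\<exists>d\<in>#canonical_divisors n t. poly d c = 0) \<longleftrightarrow> (\<exists>d\<in>#canonical_divisors n t'. poly d c = 0)" for c
    using common_root[of "canonical_divisors n t" "canonical_divisors n t'" _ c]
      common_root[of "canonical_divisors n t'" "canonical_divisors n t" _ c] eq by blast
  note R = roots[unfolded canonical_roots[OF t n] canonical_roots[OF t' n]]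
  have two: "(1 :: 'a) \<noteq> - 1" if "CHAR('a) \<noteq> 2"
    using that two_eq_0_iff_CHAR[where 'a='a] by (simp add: eq_neg_iff_add_eq_0)

  have CF: False if "{t, t'} = {Mat_C, Mat_F}"
  proof -
    have "admissible n (Mat_F :: 'a canonical)" using t t' that by (metis insertCI insertE singletonD)
    then have "n div 2 < n" using n by simp
    moreover have "(\<forall>d\<in>#canonical_divisors n (Mat_C :: 'a canonical). d dvd q) \<longleftrightarrow>
      (\<forall>d\<in>#canonical_divisors n Mat_F. d dvd q)" for q
      using eq[of q] that by (auto simp: doubleton_eq_iff)
    from this[of "[:1, 1:] ^ (n div 2)"] have "n \<le> n div 2"
      using lin_power_dvd_imp_le[of "1 :: 'a" n "n div 2"] by simp
    ultimately show False by simp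
  qed
  consider a where "t = Mat_G a" | b where "t' = Mat_G b" | "\<And>a. t \<noteq> Mat_G a" "\<And>b. t' \<noteq> Mat_G b" by blast
  then show ?thesis
  proof cases
    case (1 a)
    then have "a\<^sup>2 \<noteq> 1" using t by simp
    then show ?thesis using 1 R[of a] by (cases t') auto
  next
    case (2 b)
    then have "b\<^sup>2 \<noteq> 1" using t' by simp
    then show ?thesis using 2 R[of b] by (cases t) auto
  next
    case 3
    then show ?thesis using t t' R[of 1] R[of "- 1"] two CF by (cases t; cases t') auto
  qed
qed

lemma (in fd_endo) inverse_if_nil:
  assumes "\<And>v. P p v = 0" "p dvd [:0, 1:] * t - 1"
  shows "\<sigma> (P t v) = v"
proof -
  have "P ([:0, 1:] * t - 1) v = 0" using assms P_dvd by blast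
  then have "P ([:0, 1:] * t) v = v" by (simp only: P_diff P_one) simp
  then show ?thesis by (simp only: P_mult P_X)
qed

text \<open>Replaces the inverse polynomial, which depends on \<sigma>, by one with a prescribed jet
  at e.\<close>

lemma (in fd_form) fd_form_change_inverse:
  assumes "\<And>v. P p v = 0" "p dvd [:0, 1:] * s - 1"
  shows "fd_form scale Basis f \<sigma> s"
  using nondeg asym inverse_if_nil[OF assms] by unfold_locales

section \<open>From canonical matrices to forms and back\<close>

context fd_bilinear
begin

text \<open>For a = 1/a the eigenspace is a plane, and indecomposability rests on the sign in
  \<open>par\<close>, which makes the top form skew. This sign is the parity built into types D, E
  and F, where m = k + 1.\<close>

lemma jordan_form_properties:
  assumes gram: "has_gram_matrix scale f (jordan_form_mat (Suc k) a)" and a: "a \<noteq> 0"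
    and par: "a * a = 1 \<Longrightarrow> (- 1) ^ k * a = - 1"
  shows "nondeg" "indecomposable scale f" "splits (minimal_polynomial scale (asymmetry scale f))"
    "has_elementary_divisors scale (asymmetry scale f) {# [:-a, 1:] ^ Suc k, [:-inverse a, 1:] ^ Suc k #}"
    "has_gram_matrix scale f (jordan_form_mat (Suc k) (inverse a))"
proof -
  obtain x y where "jordan_gram scale Basis f a k x y" by (rule jordan_gram_exists[OF gram a])
  then interpret g: jordan_gram scale Basis f a k x y .
  show nd: nondeg by (rule g.jordan_nondeg)
  define \<sigma> where "\<sigma> = asymmetry scale f"
  obtain t where t: "fd_form scale Basis f \<sigma> t" unfolding \<sigma>_def by (rule fd_form_exists[OF nd])
  then interpret F: fd_form scale Basis f \<sigma> t .
  interpret J: jordan_gram_form scale Basis f a k x y \<sigma> t by unfold_locales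
  have ab: "a * inverse a = 1" using a by simp
  note hp = J.jordan_hyp_pair and full = J.jordan_full
  have D: "has_elementary_divisors scale \<sigma> {# [:-a, 1:] ^ Suc k, [:-inverse a, 1:] ^ Suc k #}"
    by (rule F.hyp_pair_elementary_divisors[OF hp ab full])
  then show "has_elementary_divisors scale (asymmetry scale f) {# [:-a, 1:] ^ Suc k, [:-inverse a, 1:] ^ Suc k #}"
    unfolding \<sigma>_def .
  have "splits (minimal_polynomial scale \<sigma>)"
    by (rule F.splits_two_powers[OF D, of a "Suc k" "inverse a"]) (simp only: set_mset_add_mset_insert set_mset_empty)
  then show "splits (minimal_polynomial scale (asymmetry scale f))" unfolding \<sigma>_def .
  show ind: "indecomposable scale f"
  proof (cases "a = inverse a")
    case False
    then show ?thesis by (rule F.hyp_pair_indecomposable[OF hp ab full])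
  next
    case True
    then have aa: "a * a = 1" using ab by simp
    obtain s s1 where s: "inverse_at a s s1" "[:-a, 1:] ^ Suc k dvd [:0, 1:] * s - 1"
      by (rule inverse_at_exists[OF aa])
    have nil: "F.P ([:-a, 1:] ^ Suc k) v = 0" for v
      using F.elementary_divisors_annihilator[OF D, of "[:-a, 1:] ^ Suc k"] True by (simp del: power_Suc)
    interpret S: inverse_at a s s1 by (rule s(1))
    interpret F': fd_form scale Basis f \<sigma> s by (rule F.fd_form_change_inverse[OF nil s(2)])
    interpret J': jordan_gram_form scale Basis f a k x y \<sigma> s by unfold_locales
    interpret U: unipotent_form scale Basis f \<sigma> s s1 a k by unfold_locales (rule nil)
    show ?thesis by (rule U.alternating_indecomposable[OF J'.jordan_hyp_pair par[OF aa] J'.jordan_full])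
  qed
  show "has_gram_matrix scale f (jordan_form_mat (Suc k) (inverse a))"
    by (rule F.hyp_pair_gram[OF ind F.hyp_pair_swap[OF hp ab full]])
qed

text \<open>The inverse polynomial s is an input, so that a given form and its model can be treated
  with the same s.\<close>

lemma antitriangular_unipotent:
  assumes b: "antitriangular_gram scale Basis f e k b" and dim: "dim (UNIV :: 'v set) = Suc k"
    and s: "inverse_at e s s1" "[:-e, 1:] ^ Suc k dvd [:0, 1:] * s - 1"
  obtains w where "unipotent_form scale Basis f (asymmetry scale f) s s1 e k"
    "unipotent_form.h scale f (asymmetry scale f) e k w w \<noteq> 0"
    "fd_endo.cyc scale (asymmetry scale f) w = UNIV" "fd_endo.chain scale (asymmetry scale f) e k w"
proof -
  define \<sigma> where "\<sigma> = asymmetry scale f"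
  interpret g: antitriangular_gram scale Basis f e k b by (rule b)
  obtain t where t: "fd_form scale Basis f \<sigma> t"
    unfolding \<sigma>_def by (rule fd_form_exists[OF g.antitriangular_nondeg])
  then interpret F: fd_form scale Basis f \<sigma> t .
  interpret A: antitriangular_form scale Basis f e k b \<sigma> t by unfold_locales
  interpret S: inverse_at e s s1 by (rule s(1))
  interpret F': fd_form scale Basis f \<sigma> s by (rule F.fd_form_change_inverse[OF A.antitriangular_nil s(2)])
  interpret U: unipotent_form scale Basis f \<sigma> s s1 e k by unfold_locales (rule A.antitriangular_nil)
  have h: "U.h (b k) (b k) \<noteq> 0" unfolding U.h_def by (rule A.antitriangular_top)
  have c: "F.chain e k (b k)" by (rule U.anisotropic_chain[OF h])
  have full: "F.cyc (b k) = UNIV" by (rule F.chain_full_cyc[OF c dim])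
  show ?thesis
    by (rule that[of "b k"]) (use U.unipotent_form_axioms h c full in \<open>simp_all add: \<sigma>_def\<close>)
qed

lemma antitriangular_properties:
  assumes b: "antitriangular_gram scale Basis f e k b" and dim: "dim (UNIV :: 'v set) = Suc k"
    and ee: "e * e = 1"
  shows "nondeg" "indecomposable scale f" "splits (minimal_polynomial scale (asymmetry scale f))"
    "has_elementary_divisors scale (asymmetry scale f) {# [:-e, 1:] ^ Suc k #}"
proof -
  define \<sigma> where "\<sigma> = asymmetry scale f"
  obtain s s1 where s: "inverse_at e s s1" "[:-e, 1:] ^ Suc k dvd [:0, 1:] * s - 1"
    by (rule inverse_at_exists[OF ee])
  obtain w where w: "unipotent_form scale Basis f \<sigma> s s1 e k" "unipotent_form.h scale f \<sigma> e k w w \<noteq> 0"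
    "fd_endo.cyc scale \<sigma> w = UNIV" "fd_endo.chain scale \<sigma> e k w"
    unfolding \<sigma>_def by (rule antitriangular_unipotent[OF b dim s])
  interpret U: unipotent_form scale Basis f \<sigma> s s1 e k by (rule w(1))
  show nondeg by (rule U.nondeg)
  show "indecomposable scale f" by (rule U.chain_indecomposable[OF w(4,3)])
  have D: "has_elementary_divisors scale \<sigma> {# [:-e, 1:] ^ Suc k #}"
    by (rule U.chain_elementary_divisors[OF w(4,3)])
  then show "has_elementary_divisors scale (asymmetry scale f) {# [:-e, 1:] ^ Suc k #}" unfolding \<sigma>_def .
  have "splits (minimal_polynomial scale \<sigma>)"
    by (rule U.splits_two_powers[OF D, of e "Suc k" e]) (simp del: power_Suc)
  then show "splits (minimal_polynomial scale (asymmetry scale f))" unfolding \<sigma>_def .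
qed

lemma canonical_properties:
  assumes n: "dim (UNIV :: 'v set) = n" "n \<ge> 1" and t: "admissible n t"
    and gram: "has_gram_matrix scale f (canonical_matrix n t)"
  shows "nondeg \<and> indecomposable scale f \<and> splits (minimal_polynomial scale (asymmetry scale f)) \<and>
    has_elementary_divisors scale (asymmetry scale f) (canonical_divisors n t)"
proof -
  obtain k where k: "n = Suc k" using n(2) by (cases n) auto
  have m1: "(- 1 :: 'a) = 1" if "CHAR('a) = 2"
    using that two_eq_0_iff_CHAR[where 'a='a] by (simp add: eq_neg_iff_add_eq_0)
  have jordan: ?thesis
    if J: "canonical_matrix n t = jordan_form_mat m a" "canonical_divisors n t = {# [:-a, 1:] ^ m, [:-inverse a, 1:] ^ m #}"
      and m: "n = 2 * m" and a: "a \<noteq> 0" and par: "\<And>l. m = Suc l \<Longrightarrow> a * a = 1 \<Longrightarrow> (- 1) ^ l * a = - 1" for m a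
  proof -
    obtain l where l: "m = Suc l" using n(2) m by (cases m) auto
    show ?thesis
      using jordan_form_properties[of l a, OF gram[unfolded J l] a par[OF l]] unfolding J l by blast
  qed
  have anti: ?thesis
    if "has_elementary_divisors scale (asymmetry scale f) {# [:-e, 1:] ^ Suc k #} \<Longrightarrow>
        has_elementary_divisors scale (asymmetry scale f) (canonical_divisors n t)"
      and "antitriangular_gram scale Basis f e k b" and "e * e = 1" for e b
    using antitriangular_properties[OF that(2) n(1)[unfolded k] that(3)] that(1) by blast
  show ?thesis
  proof (cases t)
    case Mat_A
    then have "even k" "(2 :: 'a) \<noteq> 0" using t k two_eq_0_iff_CHAR[where 'a='a] by simp_all
    obtain b where "antitriangular_gram scale Basis f ((- 1) ^ k) k b"
      by (rule Gamma_antitriangular[OF _ \<open>(2 :: 'a) \<noteq> 0\<close>]) (use gram Mat_A k in auto)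
    then show ?thesis by (rule anti[rotated]) (use Mat_A k \<open>even k\<close> in simp_all)
  next
    case Mat_B
    then have "even k" using t k by simp
    obtain b where "antitriangular_gram scale Basis f 1 k b"
      by (rule Gamma0_antitriangular[OF _ \<open>even k\<close>]) (use gram Mat_B k in auto)
    then show ?thesis by (rule anti[rotated]) (use Mat_B k in simp_all)
  next
    case Mat_C
    then have "odd k" "(2 :: 'a) \<noteq> 0" using t k two_eq_0_iff_CHAR[where 'a='a] by simp_all
    obtain b where "antitriangular_gram scale Basis f ((- 1) ^ k) k b"
      by (rule Gamma_antitriangular[OF _ \<open>(2 :: 'a) \<noteq> 0\<close>]) (use gram Mat_C k in auto)
    then show ?thesis by (rule anti[rotated]) (use Mat_C k \<open>odd k\<close> in simp_all)
  next
    case Mat_D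
    then obtain m where "n = 2 * m" "even m" using t by auto
    then show ?thesis by (intro jordan[of m 1]) (use Mat_D in auto)
  next
    case Mat_E
    then obtain m where "n = 2 * m" "odd m" using t by auto
    then show ?thesis by (intro jordan[of m 1]) (use Mat_E t m1 in auto)
  next
    case Mat_F
    then obtain m where "n = 2 * m" "odd m" using t by auto
    then show ?thesis by (intro jordan[of m "- 1"]) (use Mat_F in auto)
  next
    case (Mat_G a)
    then obtain m where "n = 2 * m" using t by auto
    then show ?thesis by (intro jordan[of m a]) (use Mat_G t in \<open>auto simp: power2_eq_square\<close>)
  qed
qed

lemma canonical_exists:
  assumes qc: "quadratically_closed TYPE('a)" and n: "dim (UNIV :: 'v set) = n" "n \<ge> 1"
    and nd: nondeg and ind: "indecomposable scale f"
    and split: "splits (minimal_polynomial scale (asymmetry scale f))"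
  obtains t where "admissible n t" "has_gram_matrix scale f (canonical_matrix n t)"
proof -
  define \<sigma> where "\<sigma> = asymmetry scale f"
  obtain t where t: "fd_form scale Basis f \<sigma> t" unfolding \<sigma>_def by (rule fd_form_exists[OF nd])
  interpret F: fd_form scale Basis f \<sigma> t by (rule t)
  obtain v0 :: 'v where "v0 \<noteq> 0"
  proof (rule ccontr)
    assume "\<not> thesis"
    then have "(UNIV :: 'v set) = {0}" using that by blast
    then have "dim (UNIV :: 'v set) = dim {0 :: 'v}" by (rule arg_cong)
    then show False using n by (simp only: dim_singleton) simp
  qed
  obtain a w where w: "w \<noteq> 0" "\<sigma> w = scale a w"
    by (rule F.eigenvector[OF split[folded \<sigma>_def] \<open>v0 \<noteq> 0\<close>])
  obtain K where a: "a \<noteq> 0" and K: "\<And>x. F.P (([:-a, 1:] * [:-inverse a, 1:]) ^ K) x = 0"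
    by (rule F.indecomposable_spectrum[OF ind w]) (rule that)
  have dim_jordan: "n = 2 * Suc k" if "has_gram_matrix scale f (jordan_form_mat (Suc k) c)" "c \<noteq> 0" for k c
    using jordan_gram_exists[OF that] n(1) by metis
  show ?thesis
  proof (cases "a\<^sup>2 = 1")
    case False
    obtain k u v where "F.hyp_pair a k u v" by (rule F.hyp_pair_exists[OF ind w False])
    then have g: "has_gram_matrix scale f (jordan_form_mat (Suc k) a)" by (rule F.hyp_pair_gram[OF ind])
    have "n = 2 * Suc k" by (rule dim_jordan[OF g a])
    then show ?thesis using that[of "Mat_G a"] g a False by (simp del: mult_Suc_right)
  next
    case True
    then have aa: "a * a = 1" by (simp add: power2_eq_square)
    then have inv: "inverse a = a" by (simp add: inverse_unique)
    have "F.P ([:-a, 1:] ^ (K + K)) x = 0" for x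
      using K[of x] unfolding inv by (simp only: power_mult_distrib power_add)
    then have ex: "\<exists>m. \<forall>x. F.P ([:-a, 1:] ^ m) x = 0" by blast
    \<comment> \<open>The exact nilpotency order k + 1 of \<sigma> - a, so that the top form h is
      not zero.\<close>
    define m where "m = (LEAST m. \<forall>x. F.P ([:-a, 1:] ^ m) x = 0)"
    have m: "F.P ([:-a, 1:] ^ m) x = 0" for x using LeastI_ex[OF ex] unfolding m_def by blast
    have "m \<noteq> 0" using m[of w] w(1) by (intro notI) simp
    then obtain k where k: "m = Suc k" by (cases m) auto
    have nil: "F.P ([:-a, 1:] ^ Suc k) x = 0" for x using m unfolding k .
    have "\<not> (\<forall>x. F.P ([:-a, 1:] ^ k) x = 0)"
      using not_less_Least[of k "\<lambda>m. \<forall>x. F.P ([:-a, 1:] ^ m) x = 0"] k unfolding m_def by simp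
    then obtain z where z: "F.P ([:-a, 1:] ^ k) z \<noteq> 0" by blast
    obtain s s1 where s: "inverse_at a s s1" "[:-a, 1:] ^ Suc k dvd [:0, 1:] * s - 1"
      by (rule inverse_at_exists[OF aa])
    interpret S: inverse_at a s s1 by (rule s(1))
    interpret F': fd_form scale Basis f \<sigma> s by (rule F.fd_form_change_inverse[OF nil s(2)])
    interpret U: unipotent_form scale Basis f \<sigma> s s1 a k by unfold_locales (rule nil)
    have pm: "a = 1 \<or> a = - 1" using True by (simp add: power2_eq_1_iff)
    show ?thesis
    proof (cases "\<forall>x. U.h x x = 0")
      case True
      obtain u v where uv: "F'.hyp_pair a k u v" "(- 1) ^ k * a = - 1"
        by (rule U.alternating_hyp_pair[OF qc _ z]) (use True in auto)
      have g: "has_gram_matrix scale f (jordan_form_mat (Suc k) a)" by (rule F'.hyp_pair_gram[OF ind uv(1)])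
      have n2: "n = 2 * Suc k" by (rule dim_jordan[OF g a])
      then have nk: "n div 2 = Suc k" by simp
      have half: "\<exists>m. n = 2 * m \<and> even m" if "odd k" using n2 that by (intro exI[of _ "Suc k"]) simp
      have half': "\<exists>m. n = 2 * m \<and> odd m" if "even k" using n2 that by (intro exI[of _ "Suc k"]) simp
      have "\<exists>t. admissible n t \<and> canonical_matrix n t = jordan_form_mat (n div 2) a"
      proof (cases "CHAR('a) = 2")
        case char: True
        then have "(- 1 :: 'a) = 1" using two_eq_0_iff_CHAR[where 'a='a] by (simp add: eq_neg_iff_add_eq_0)
        then have "a = 1" using pm by auto
        show ?thesis
        proof (cases "even k")
          case True
          from half'[OF True] char \<open>a = 1\<close> show ?thesis by (intro exI[of _ Mat_E]) simp
        next
          case False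
          from half[OF False] \<open>a = 1\<close> show ?thesis by (intro exI[of _ Mat_D]) simp
        qed
      next
        case char: False
        then have "(- 1 :: 'a) \<noteq> 1" using two_eq_0_iff_CHAR[where 'a='a] by (simp add: eq_neg_iff_add_eq_0 eq_commute)
        show ?thesis
        proof (cases "even k")
          case True
          then have "a = - 1" using uv(2) by simp
          with half'[OF True] char show ?thesis by (intro exI[of _ Mat_F]) simp
        next
          case False
          then have "a = 1" using uv(2) by simp
          with half[OF False] show ?thesis by (intro exI[of _ Mat_D]) simp
        qed
      qed
      then show ?thesis using that g unfolding nk by metis
    next
      case False
      then obtain u where u: "U.h u u \<noteq> 0" by blast
      have full: "F.cyc u = UNIV" by (rule U.anisotropic_full[OF ind u])
      have nk: "n = Suc k" using F.chain_dim[OF U.anisotropic_chain[OF u] full] n(1) by simp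
      have par: "(- 1) ^ k * a = 1" "(2 :: 'a) = 0 \<Longrightarrow> even k" by (rule U.anisotropic_parity[OF u])+ assumption
      \<comment> \<open>To obtain M as a Gram matrix of f, a form g with Gram matrix M is built on
        the same space. Both are anisotropic at the top with the same e, k and s, hence
        equivalent.\<close>
      have compare: "has_gram_matrix scale f M"
        if M: "M \<in> carrier_mat n n"
          and anti: "\<And>g. fd_bilinear scale Basis g \<Longrightarrow> has_gram_matrix scale g M \<Longrightarrow>
            \<exists>b. antitriangular_gram scale Basis g a k b" for M
      proof -
        obtain vs where vs: "ordered_basis scale vs" "length vs = n"
          using obtain_ordered_basis n(1) by metis
        obtain g where g: "bilinear_form scale g" "gram_matrix scale g vs = M"
          using form_with_gram_exists[OF vs(1), of M] M vs(2) by metis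
        have gM: "has_gram_matrix scale g M" using vs(1) g(2) unfolding has_gram_matrix_def by blast
        interpret g: fd_bilinear scale Basis g by unfold_locales (rule g(1))
        obtain b where b: "antitriangular_gram scale Basis g a k b" using anti[OF g.fd_bilinear_axioms gM] by blast
        obtain w where w: "unipotent_form scale Basis g (asymmetry scale g) s s1 a k"
          "unipotent_form.h scale g (asymmetry scale g) a k w w \<noteq> 0"
          "fd_endo.cyc scale (asymmetry scale g) w = UNIV"
          by (rule g.antitriangular_unipotent[OF b n(1)[unfolded nk] s])
        have "equivalent_forms scale scale f g"
          by (rule anisotropic_equivalent[OF qc U.unipotent_form_axioms w(1) u full w(2,3)])
        then show ?thesis by (rule has_gram_matrix_equivalent[OF _ gM])
      qed
      show ?thesis
      proof (cases "CHAR('a) = 2")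
        case char: True
        then have "(2 :: 'a) = 0" using two_eq_0_iff_CHAR[where 'a='a] by simp
        then have "even k" "a = 1" using par by auto
        have "has_gram_matrix scale f (Gamma0_mat n)"
        proof (rule compare)
          show "Gamma0_mat n \<in> carrier_mat n n" by (simp add: Gamma0_mat_def mat1_def)
          fix g assume "fd_bilinear scale Basis g" "has_gram_matrix scale g (Gamma0_mat n)"
          then show "\<exists>b. antitriangular_gram scale Basis g a k b"
            unfolding nk \<open>a = 1\<close> using fd_bilinear.Gamma0_antitriangular[OF _ _ \<open>even k\<close>] by metis
        qed
        then show ?thesis using that[of Mat_B] char \<open>even k\<close> nk by simp
      next
        case char: False
        then have two: "(2 :: 'a) \<noteq> 0" using two_eq_0_iff_CHAR[where 'a='a] by simp
        have a: "a = (- 1) ^ k" using par(1) pm by (cases "even k") auto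
        have "has_gram_matrix scale f (Gamma_mat n)"
        proof (rule compare)
          show "Gamma_mat n \<in> carrier_mat n n" by (simp add: Gamma_mat_def mat1_def)
          fix g assume "fd_bilinear scale Basis g" "has_gram_matrix scale g (Gamma_mat n)"
          then show "\<exists>b. antitriangular_gram scale Basis g a k b"
            unfolding nk a using fd_bilinear.Gamma_antitriangular[OF _ _ two] by metis
        qed
        then show ?thesis
          using that[of Mat_A] that[of Mat_C] char nk by (cases "even k") simp_all
      qed
    qed
  qed
qed

lemma asymmetry_annihilator:
  assumes n: "dim (UNIV :: 'v set) = n" "n \<ge> 1" and t: "admissible n t"
    and gram: "has_gram_matrix scale f (canonical_matrix n t)"
  shows "(\<forall>v. poly_act scale (asymmetry scale f) q v = 0) \<longleftrightarrow> (\<forall>d\<in>#canonical_divisors n t. d dvd q)"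
proof -
  note p = canonical_properties[OF n t gram]
  obtain s where s: "fd_form scale Basis f (asymmetry scale f) s" using fd_form_exists p by blast
  interpret F: fd_form scale Basis f "asymmetry scale f" s by (rule s)
  show ?thesis using F.elementary_divisors_annihilator p by blast
qed

end

lemma similar_maps_annihilator:
  assumes "fd_endo scale Basis \<sigma>" "fd_endo scale Basis \<rho>" "similar_maps scale \<sigma> \<rho>"
  shows "(\<forall>v. poly_act scale \<sigma> q v = 0) \<longleftrightarrow> (\<forall>v. poly_act scale \<rho> q v = 0)"
proof -
  interpret s: fd_endo scale Basis \<sigma> by (rule assms(1))
  interpret r: fd_endo scale Basis \<rho> by (rule assms(2))
  obtain x where x: "Vector_Spaces.linear scale scale x" "bij x" "x \<circ> \<sigma> = \<rho> \<circ> x"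
    using assms(3) unfolding similar_maps_def general_linear_def by blast
  interpret x: Vector_Spaces.linear scale scale x by (rule x(1))
  have comm: "x (\<sigma> v) = \<rho> (x v)" for v using x(3) by (metis comp_apply)
  have eq: "x (s.P q v) = r.P q (x v)" for v
    by (induction q) (simp_all add: s.P_pCons r.P_pCons x.add x.scale comm)
  have "s.P q v = 0 \<longleftrightarrow> r.P q (x v) = 0" for v
    using eq[of v] x.zero x(2) by (metis bij_is_inj injD)
  then show ?thesis using x(2) by (metis bij_pointE)
qed

theorem theorem8p1:
  fixes scale :: "'a::field \<Rightarrow> 'v::ab_group_add \<Rightarrow> 'v"
    and Basis :: "'v set"
    and n :: nat
  assumes "quadratically_closed TYPE('a)"
    and "finite_dimensional_vector_space scale Basis"
    and "vector_space.dim scale (UNIV :: 'v set) = n"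
    and "n \<ge> 1"
  shows
    "(\<forall>f g.
        bilinear_form scale f \<and> nondegenerate scale f \<and>
        indecomposable scale f \<and> split_form scale f \<and>
        bilinear_form scale g \<and> nondegenerate scale g \<and>
        indecomposable scale g \<and> split_form scale g \<and>
        similar_maps scale (asymmetry scale f) (asymmetry scale g)
        \<longrightarrow> equivalent_forms scale scale f g) \<and>
     (\<forall>f t.
        bilinear_form scale f \<and> admissible n t \<and>
        has_gram_matrix scale f (canonical_matrix n t)
        \<longrightarrow> nondegenerate scale f \<and>
            indecomposable scale f \<and>
            split_form scale f \<and>
            has_elementary_divisors scale
              (asymmetry scale f) (canonical_divisors n t)) \<and>
     (\<forall>f.
        bilinear_form scale f \<and> nondegenerate scale f \<and>
        indecomposable scale f \<and> split_form scale f
        \<longrightarrow> (\<exists>t. admissible n t \<and>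
               has_gram_matrix scale f (canonical_matrix n t)) \<and>
            (\<forall>t t'.
               admissible n t \<and> has_gram_matrix scale f (canonical_matrix n t) \<and>
               admissible n t' \<and> has_gram_matrix scale f (canonical_matrix n t')
               \<longrightarrow> t = t' \<or> (\<exists>a. t = Mat_G a \<and> t' = Mat_G (inverse a)))) \<and>
     (\<forall>f g a.
        bilinear_form scale f \<and> bilinear_form scale g \<and> admissible n (Mat_G a) \<and>
        has_gram_matrix scale f (canonical_matrix n (Mat_G a)) \<and>
        has_gram_matrix scale g (canonical_matrix n (Mat_G (inverse a)))
        \<longrightarrow> equivalent_forms scale scale f g)"
proof -
  interpret finite_dimensional_vector_space scale Basis by (rule assms(2))
  have n: "dim (UNIV :: 'v set) = n" "n \<ge> 1" using assms(3,4) by simp_all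
  have bil: "fd_bilinear scale Basis f" if "bilinear_form scale f" for f
    using that by unfold_locales
  have canon: "nondegenerate scale f \<and> indecomposable scale f \<and> split_form scale f \<and>
      has_elementary_divisors scale (asymmetry scale f) (canonical_divisors n t)"
    if f: "bilinear_form scale f" "admissible n t" "has_gram_matrix scale f (canonical_matrix n t)" for f t
  proof -
    interpret f: fd_bilinear scale Basis f by (rule bil[OF f(1)])
    show ?thesis
      using f.canonical_properties[OF n f(2,3)] by (simp add: split_form_def f.nondegenerate_iff)
  qed
  have exist: "\<exists>t. admissible n t \<and> has_gram_matrix scale f (canonical_matrix n t)"
    if f: "bilinear_form scale f" "nondegenerate scale f" "indecomposable scale f" "split_form scale f" for f
  proof -
    interpret f: fd_bilinear scale Basis f by (rule bil[OF f(1)])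
    obtain t where "admissible n t" "has_gram_matrix scale f (canonical_matrix n t)"
      by (rule f.canonical_exists[OF assms(1) n])
        (use f(2-4) in \<open>auto simp: f.nondegenerate_iff split_form_def\<close>)
    then show ?thesis by blast
  qed
  \<comment> \<open>Stated for two forms with equal annihilators: f = g gives uniqueness of the
    canonical type, and similar asymmetries give the first claim.\<close>
  have unique: "t = t' \<or> (\<exists>a. t = Mat_G a \<and> t' = Mat_G (inverse a))"
    if f: "bilinear_form scale f" "admissible n t" "has_gram_matrix scale f (canonical_matrix n t)"
      and g: "bilinear_form scale g" "admissible n t'" "has_gram_matrix scale g (canonical_matrix n t')"
      and ann: "\<And>q. (\<forall>v. poly_act scale (asymmetry scale f) q v = 0) \<longleftrightarrow>
        (\<forall>v. poly_act scale (asymmetry scale g) q v = 0)" for f g t t'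
    by (rule canonical_divisors_unique[OF n(2) f(2) g(2)])
      (use ann in \<open>simp only: fd_bilinear.asymmetry_annihilator[OF bil[OF f(1)] n f(2,3)]
        fd_bilinear.asymmetry_annihilator[OF bil[OF g(1)] n g(2,3)]\<close>)
  have inv: "equivalent_forms scale scale f g"
    if f: "bilinear_form scale f" "admissible n (Mat_G a)" "has_gram_matrix scale f (canonical_matrix n (Mat_G a))"
      and g: "bilinear_form scale g" "has_gram_matrix scale g (canonical_matrix n (Mat_G (inverse a)))" for f g a
  proof -
    interpret f: fd_bilinear scale Basis f by (rule bil[OF f(1)])
    have a: "a \<noteq> 0" "a * a \<noteq> 1" using f(2) by (simp_all add: power2_eq_square)
    obtain k where k: "n div 2 = Suc k" using f(2) n(2) by (cases "n div 2") auto
    have "has_gram_matrix scale f (jordan_form_mat (Suc k) (inverse a))"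
      by (rule f.jordan_form_properties(5)) (use f(3) a k in auto)
    then show ?thesis
      using equivalent_if_same_gram[OF f(1) _ g(1)] g(2) by (simp add: k)
  qed
  have similar: "equivalent_forms scale scale f g"
    if f: "bilinear_form scale f" "nondegenerate scale f" "indecomposable scale f" "split_form scale f"
      and g: "bilinear_form scale g" "nondegenerate scale g" "indecomposable scale g" "split_form scale g"
      and sim: "similar_maps scale (asymmetry scale f) (asymmetry scale g)" for f g
  proof -
    interpret f: fd_bilinear scale Basis f by (rule bil[OF f(1)])
    interpret g: fd_bilinear scale Basis g by (rule bil[OF g(1)])
    obtain s where "fd_form scale Basis f (asymmetry scale f) s"
      using f.fd_form_exists f(2) f.nondegenerate_iff by blast
    then have ef: "fd_endo scale Basis (asymmetry scale f)" by (simp add: fd_form_def)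
    obtain s' where "fd_form scale Basis g (asymmetry scale g) s'"
      using g.fd_form_exists g(2) g.nondegenerate_iff by blast
    then have eg: "fd_endo scale Basis (asymmetry scale g)" by (simp add: fd_form_def)
    obtain t where t: "admissible n t" "has_gram_matrix scale f (canonical_matrix n t)" using exist[OF f] by blast
    obtain t' where t': "admissible n t'" "has_gram_matrix scale g (canonical_matrix n t')" using exist[OF g] by blast
    have "t = t' \<or> (\<exists>a. t = Mat_G a \<and> t' = Mat_G (inverse a))"
      by (rule unique[OF f(1) t g(1) t' similar_maps_annihilator[OF ef eg sim]])
    then show ?thesis
    proof
      assume "t = t'"
      then show ?thesis using equivalent_if_same_gram[OF f(1) t(2) g(1)] t'(2) by simp
    next
      assume "\<exists>a. t = Mat_G a \<and> t' = Mat_G (inverse a)"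
      then show ?thesis using inv[OF f(1) _ _ g(1)] t t' by blast
    qed
  qed
  show ?thesis
  proof (intro conjI allI impI; elim conjE)
    fix f g
    assume "bilinear_form scale f" "nondegenerate scale f" "indecomposable scale f" "split_form scale f"
      "bilinear_form scale g" "nondegenerate scale g" "indecomposable scale g" "split_form scale g"
      "similar_maps scale (asymmetry scale f) (asymmetry scale g)"
    then show "equivalent_forms scale scale f g" by (rule similar)
  next
    fix f and t :: "'a canonical"
    assume "bilinear_form scale f" "admissible n t" "has_gram_matrix scale f (canonical_matrix n t)"
    note p = canon[OF this]
    show "nondegenerate scale f" "indecomposable scale f" "split_form scale f"
      "has_elementary_divisors scale (asymmetry scale f) (canonical_divisors n t)" using p by blast+
  next
    fix f
    assume "bilinear_form scale f" "nondegenerate scale f" "indecomposable scale f" "split_form scale f"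
    then show "\<exists>t. admissible n t \<and> has_gram_matrix scale f (canonical_matrix n t)" by (rule exist)
  next
    fix f and t t' :: "'a canonical"
    assume "bilinear_form scale f" "admissible n t" "has_gram_matrix scale f (canonical_matrix n t)"
      "admissible n t'" "has_gram_matrix scale f (canonical_matrix n t')"
    then show "t = t' \<or> (\<exists>a. t = Mat_G a \<and> t' = Mat_G (inverse a))" by (intro unique) simp_all
  next
    fix f g and a :: 'a
    assume "bilinear_form scale f" "bilinear_form scale g" "admissible n (Mat_G a)"
      "has_gram_matrix scale f (canonical_matrix n (Mat_G a))"
      "has_gram_matrix scale g (canonical_matrix n (Mat_G (inverse a)))"
    then show "equivalent_forms scale scale f g" by (intro inv)
  qed
qed

end
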